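(* Let $S$ be a tame $d$-sphere and let $\ell$ be an integer with $0 \leq \ell \leq d/2$. Then $g_{\ell+1}(S) \geq 0$. Also, $g_{\ell+1}(S)=0$ if and only if $S$ is $\ell$-stacked.
   Context: All simplicial complexes are finite and abstract, and the empty set is a face (of dimension $-1$) of every simplicial complex. A field $\mathbb{F}$ is fixed and all homology is simplicial homology with coefficients in $\mathbb{F}$. $V(X)$ is the vertex set of $X$; for any set $A$, $X[A]=\{\alpha\in X:\alpha\subseteq A\}$. Bistellar moves. For a non-empty finite set $\alpha$, $\overline{\alpha}$ (resp. $\partial\alpha$) is the simplicial complex whose faces are all subsets (resp. all proper subsets) of $\alpha$. $X_1*X_2$ (join) has as faces the disjoint unions of a face of $X_1$ with a face of $X_2$. Let $\alpha,\beta$ be disjoint non-empty finite sets with $\#(\alpha)+\#(\beta)=d+2$ and let $X$ be a $d$-dimensional simplicial complex. $X$ admits the bistellar move $\alpha\mapsto\beta$ if $X[\alpha\cup\beta]=\overline{\alpha}*\partial\beta$; the result of the move is $Y=(X\setminus(\overline{\alpha}*\partial\beta))\cup(\overline{\beta}*\partial\alpha)$. The index of the move is $t=\#(\beta)-1$. (When $t=0$, $\beta$ consists of a new vertex not in $V(X)$; when $t=d$, the unique vertex in $\alpha$ is deleted.) Tame spheres. $S^d_{d+2}$ denotes the standard $d$-sphere $\partial\alpha$ with $\#(\alpha)=d+2$. A tame $d$-sphere is a $d$-dimensional simplicial complex obtainable from $S^d_{d+2}$ by a finite sequence of bistellar moves, each of index $<d/2$. $g$-vector. For a $d$-dimensional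 complex $X$, $f_i(X)$ is the number of $i$-dimensional faces ($-1\le i\le d$), and $g_j(X)=\sum_{i=-1}^{j-1}(-1)^{j-i-1}\binom{d-i+1}{j-i-1}f_i(X)$ for $0\le j\le d+1$. Homology manifolds (over $\mathbb{F}$). A homology $d$-manifold is a pure $d$-dimensional simplicial complex $\Delta$ in which the link of each non-empty face $\alpha$ has the $\mathbb{F}$-homology either of a sphere of dimension $d-\#(\alpha)$ (where $\{\emptyset\}$ counts as the $(-1)$-sphere) or of a point; its boundary $\partial\Delta$ consists of $\emptyset$ and the faces whose links have the homology of a point. It is closed if $\partial\Delta=\{\emptyset\}$; otherwise $\partial\Delta$ is required to be a closed homology $(d-1)$-manifold. A homology $d$-sphere is a closed homology $d$-manifold with the $\mathbb{F}$-homology of the $d$-sphere. A homology $d$-ball is a homology $d$-manifold with the $\mathbb{F}$-homology of a point whose boundary is a homology $(d-1)$-sphere. Stackedness. $\mathrm{Skel}_k(X)$ is the subcomplex of faces of $X$ of dimension $\le k$. A homology $d$-sphere $S$ is $k$-stacked ($0\le k\le d$) if there is a homology $(d+1)$-ball $\Delta$ with $\partial\Delta=S$ and $\mathrm{Skel}_{d-k}(\Delta)=\mathrm{Skel}_{d-k}(S)$. *)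

theory Defs
  imports Complex_Main "HOL-Library.Function_Algebras"
begin

section \<open>Finite abstract simplicial complexes\<close>

definition simplicial_complex :: "'v set set \<Rightarrow> bool" where
  "simplicial_complex X \<longleftrightarrow>
     finite X \<and> {} \<in> X \<and> (\<forall>\<sigma>\<in>X. finite \<sigma> \<and> (\<forall>\<tau>. \<tau> \<subseteq> \<sigma> \<longrightarrow> \<tau> \<in> X))"

text \<open>Dimensions are integers, since the empty face has dimension $-1$.\<close>

definition face_dim :: "'v set \<Rightarrow> int" where
  "face_dim \<sigma> = int (card \<sigma>) - 1"

definition complex_dim :: "'v set set \<Rightarrow> int" where
  "complex_dim X = Max (face_dim ` X)"

definition pure_complex :: "int \<Rightarrow> 'v set set \<Rightarrow> bool" where
  "pure_complex d X \<longleftrightarrow> simplicial_complex X \<and> complex_dim X = d \<and>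
     (\<forall>\<sigma>\<in>X. \<exists>\<tau>\<in>X. \<sigma> \<subseteq> \<tau> \<and> face_dim \<tau> = d)"

definition induced :: "'v set set \<Rightarrow> 'v set \<Rightarrow> 'v set set" where
  "induced X A = {\<alpha> \<in> X. \<alpha> \<subseteq> A}"

definition link :: "'v set \<Rightarrow> 'v set set \<Rightarrow> 'v set set" where
  "link \<alpha> X = {\<tau> \<in> X. \<tau> \<inter> \<alpha> = {} \<and> \<tau> \<union> \<alpha> \<in> X}"

definition skeleton :: "int \<Rightarrow> 'v set set \<Rightarrow> 'v set set" where
  "skeleton k X = {\<sigma> \<in> X. face_dim \<sigma> \<le> k}"

definition full_simplex :: "'v set \<Rightarrow> 'v set set" where
  "full_simplex \<alpha> = {\<sigma>. \<sigma> \<subseteq> \<alpha>}"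

definition simplex_bdry :: "'v set \<Rightarrow> 'v set set" where
  "simplex_bdry \<alpha> = {\<sigma>. \<sigma> \<subset> \<alpha>}"

definition join :: "'v set set \<Rightarrow> 'v set set \<Rightarrow> 'v set set" where
  "join X Y = {\<sigma> \<union> \<tau> | \<sigma> \<tau>. \<sigma> \<in> X \<and> \<tau> \<in> Y \<and> \<sigma> \<inter> \<tau> = {}}"


section \<open>Bistellar moves and tame spheres\<close>

definition admits_bistellar_move :: "int \<Rightarrow> 'v set \<Rightarrow> 'v set \<Rightarrow> 'v set set \<Rightarrow> bool" where
  "admits_bistellar_move d \<alpha> \<beta> X \<longleftrightarrow>
     finite \<alpha> \<and> finite \<beta> \<and> \<alpha> \<noteq> {} \<and> \<beta> \<noteq> {} \<and> \<alpha> \<inter> \<beta> = {} \<and>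
     int (card \<alpha>) + int (card \<beta>) = d + 2 \<and>
     simplicial_complex X \<and> complex_dim X = d \<and>
     induced X (\<alpha> \<union> \<beta>) = join (full_simplex \<alpha>) (simplex_bdry \<beta>)"

definition bistellar_move :: "'v set \<Rightarrow> 'v set \<Rightarrow> 'v set set \<Rightarrow> 'v set set" where
  "bistellar_move \<alpha> \<beta> X =
     (X - join (full_simplex \<alpha>) (simplex_bdry \<beta>)) \<union> join (full_simplex \<beta>) (simplex_bdry \<alpha>)"

definition move_index :: "'v set \<Rightarrow> int" where
  "move_index \<beta> = int (card \<beta>) - 1"

inductive tame_sphere :: "int \<Rightarrow> 'v set set \<Rightarrow> bool" for d :: int where
  standard: "\<lbrakk>finite \<alpha>; \<alpha> \<noteq> {}; int (card \<alpha>) = d + 2\<rbrakk> \<Longrightarrow> tame_sphere d (simplex_bdry \<alpha>)"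
| move: "\<lbrakk>tame_sphere d X; admits_bistellar_move d \<alpha> \<beta> X; real_of_int (move_index \<beta>) < real_of_int d / 2\<rbrakk>
    \<Longrightarrow> tame_sphere d (bistellar_move \<alpha> \<beta> X)"


section \<open>Face numbers\<close>

definition f_vec :: "int \<Rightarrow> 'v set set \<Rightarrow> nat" where
  "f_vec i X = card {\<sigma> \<in> X. face_dim \<sigma> = i}"

definition g_vec :: "int \<Rightarrow> int \<Rightarrow> 'v set set \<Rightarrow> int" where
  "g_vec d j X = (\<Sum>i\<in>{-1..j - 1}.
     (-1) ^ nat (j - i - 1) * int (nat (d - i + 1) choose nat (j - i - 1)) * int (f_vec i X))"


section \<open>Simplicial homology over a field\<close>

text \<open>
  A chain is a function from faces to the field; a face stands for the oriented simplex obtained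
  by listing its vertices increasingly. The empty face, of dimension $-1$, takes part in the chain
  complex, so the homology is reduced. Homology is only ever compared between non-empty complexes
  (those containing the empty face), where agreement of reduced and of unreduced Betti numbers
  amount to the same thing.
\<close>

definition oriented_bdry :: "'v::linorder set \<Rightarrow> ('v set \<Rightarrow> 'f::field)" where
  "oriented_bdry \<sigma> = (\<lambda>\<tau>. \<Sum>v\<in>\<sigma>. if \<tau> = \<sigma> - {v} then (-1) ^ card {w \<in> \<sigma>. w < v} else 0)"

definition chains :: "int \<Rightarrow> 'v set set \<Rightarrow> ('v set \<Rightarrow> 'f::field) set" where
  "chains k X = {c. \<forall>\<sigma>. c \<sigma> \<noteq> 0 \<longrightarrow> \<sigma> \<in> X \<and> face_dim \<sigma> = k}"

definition chain_bdry :: "'v::linorder set set \<Rightarrow> ('v set \<Rightarrow> 'f::field) \<Rightarrow> ('v set \<Rightarrow> 'f)" where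
  "chain_bdry X c = (\<lambda>\<tau>. \<Sum>\<sigma>\<in>X. c \<sigma> * oriented_bdry \<sigma> \<tau>)"

definition cycles :: "int \<Rightarrow> 'v::linorder set set \<Rightarrow> ('v set \<Rightarrow> 'f::field) set" where
  "cycles k X = {c \<in> chains k X. chain_bdry X c = 0}"

definition boundaries :: "int \<Rightarrow> 'v::linorder set set \<Rightarrow> ('v set \<Rightarrow> 'f::field) set" where
  "boundaries k X = chain_bdry X ` chains (k + 1) X"

definition chain_scale :: "'f::field \<Rightarrow> ('v set \<Rightarrow> 'f) \<Rightarrow> ('v set \<Rightarrow> 'f)" where
  "chain_scale a c = (\<lambda>\<sigma>. a * c \<sigma>)"

lemma vector_space_chain_scale: "vector_space chain_scale"
  by unfold_locales (auto simp: chain_scale_def fun_eq_iff algebra_simps)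

text \<open>The dimension of the homology space $Z_k / B_k$.\<close>

definition betti :: "'f::field itself \<Rightarrow> int \<Rightarrow> 'v::linorder set set \<Rightarrow> int" where
  "betti F k X =
     int (vector_space.dim chain_scale (cycles k X :: ('v set \<Rightarrow> 'f) set)) -
     int (vector_space.dim chain_scale (boundaries k X :: ('v set \<Rightarrow> 'f) set))"

text \<open>Equality of Betti numbers expresses isomorphism of the homology spaces, these being
  finite-dimensional.\<close>

definition same_homology ::
    "'f::field itself \<Rightarrow> 'v::linorder set set \<Rightarrow> 'w::linorder set set \<Rightarrow> bool" where
  "same_homology F X Y \<longleftrightarrow> (\<forall>k. betti F k X = betti F k Y)"

text \<open>The model of the $n$-sphere is the boundary of a simplex with $n+2$ vertices; for $n = -1$
  it is the complex whose only face is the empty set.\<close>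

definition has_sphere_homology :: "'f::field itself \<Rightarrow> int \<Rightarrow> 'v::linorder set set \<Rightarrow> bool" where
  "has_sphere_homology F n X \<longleftrightarrow> same_homology F X (simplex_bdry {..<nat (n + 2)})"

definition has_point_homology :: "'f::field itself \<Rightarrow> 'v::linorder set set \<Rightarrow> bool" where
  "has_point_homology F X \<longleftrightarrow> same_homology F X (full_simplex {0::nat})"


section \<open>Homology manifolds\<close>

definition manifold_bdry :: "'f::field itself \<Rightarrow> 'v::linorder set set \<Rightarrow> 'v set set" where
  "manifold_bdry F \<Delta> = insert {} {\<alpha> \<in> \<Delta>. \<alpha> \<noteq> {} \<and> has_point_homology F (link \<alpha> \<Delta>)}"

definition manifold_links :: "'f::field itself \<Rightarrow> int \<Rightarrow> 'v::linorder set set \<Rightarrow> bool" where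
  "manifold_links F d \<Delta> \<longleftrightarrow> pure_complex d \<Delta> \<and>
     (\<forall>\<alpha>\<in>\<Delta>. \<alpha> \<noteq> {} \<longrightarrow>
        has_sphere_homology F (d - int (card \<alpha>)) (link \<alpha> \<Delta>) \<or> has_point_homology F (link \<alpha> \<Delta>))"

definition closed_homology_manifold :: "'f::field itself \<Rightarrow> int \<Rightarrow> 'v::linorder set set \<Rightarrow> bool" where
  "closed_homology_manifold F d \<Delta> \<longleftrightarrow> manifold_links F d \<Delta> \<and> manifold_bdry F \<Delta> = {{}}"

definition homology_manifold :: "'f::field itself \<Rightarrow> int \<Rightarrow> 'v::linorder set set \<Rightarrow> bool" where
  "homology_manifold F d \<Delta> \<longleftrightarrow> manifold_links F d \<Delta> \<and>
     (manifold_bdry F \<Delta> = {{}} \<or> closed_homology_manifold F (d - 1) (manifold_bdry F \<Delta>))"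

definition homology_sphere :: "'f::field itself \<Rightarrow> int \<Rightarrow> 'v::linorder set set \<Rightarrow> bool" where
  "homology_sphere F d S \<longleftrightarrow> closed_homology_manifold F d S \<and> has_sphere_homology F d S"

definition homology_ball :: "'f::field itself \<Rightarrow> int \<Rightarrow> 'v::linorder set set \<Rightarrow> bool" where
  "homology_ball F d \<Delta> \<longleftrightarrow> homology_manifold F d \<Delta> \<and> has_point_homology F \<Delta> \<and>
     homology_sphere F (d - 1) (manifold_bdry F \<Delta>)"

definition k_stacked :: "'f::field itself \<Rightarrow> int \<Rightarrow> int \<Rightarrow> 'v::linorder set set \<Rightarrow> bool" where
  "k_stacked F d k S \<longleftrightarrow> homology_sphere F d S \<and> 0 \<le> k \<and> k \<le> d \<and>
     (\<exists>\<Delta>. homology_ball F (d + 1) \<Delta> \<and> manifold_bdry F \<Delta> = S \<and>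
          skeleton (d - k) \<Delta> = skeleton (d - k) S)"

end

theory Submission
  imports Defs "HOL-Computational_Algebra.Polynomial"
begin

text \<open>
Let \<open>S\<close> be a tame \<open>d\<close>-sphere, and \<open>N = d + 2\<close>. The \<open>g\<close>-numbers are the coefficients of the polynomial
\<open>G\<^sub>S(x)\<close>, the sum over the faces \<open>\<sigma>\<close> of \<open>x\<^sup>s (1 - x)\<^sup>N\<^sup>-\<^sup>s\<close>, where \<open>s\<close> is the number of vertices of \<open>\<sigma>\<close>. A
bistellar move \<open>\<alpha> \<mapsto> \<beta>\<close> of index \<open>t\<close> changes it by \<open>x\<^sup>t\<^sup>+\<^sup>1 - x\<^sup>d\<^sup>+\<^sup>1\<^sup>-\<^sup>t\<close> (\<open>face_poly_bistellar_move\<close>). As all indices are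
below \<open>d/2\<close>, the number \<open>g\<^sub>l\<^sub>+\<^sub>1(S)\<close> counts the moves of index \<open>l\<close>; in particular it is non-negative.

Suppose that it vanishes. The standard sphere bounds a simplex, and the move \<open>\<alpha> \<mapsto> \<beta>\<close> is realised by gluing
the simplex on \<open>\<alpha> \<union> \<beta>\<close> to the ball constructed so far. The new ball is again a homology ball with the
right boundary (\<open>homology_filling_glue_simplex\<close>): the faces added to the ball and to its interior form
Boolean intervals, which are acyclic unless they are single faces, so long exact sequences of pairs
control all links. The homology of the boundary is read off from the interior, relative to the acyclic
ball. One point needs care: a move must produce a simplicial complex, that is, the link of \<open>\<alpha>\<close> must be
no larger than \<open>\<partial>\<beta>\<close>. This holds because the fundamental cycle of that link involves all its facets
(\<open>boundary_link_rigid\<close>). As long as the indices are less than \<open>l\<close>, the interior faces have at least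
\<open>d - l + 2\<close> vertices, which is \<open>l\<close>-stackedness, and the missing faces of the ball have at most \<open>l + 1\<close>
vertices. By this last property a move of index greater than \<open>l\<close> never becomes possible: its \<open>\<beta>\<close> would
already be a face (\<open>missing_face_of_move_in_filling\<close>).

Conversely, let \<open>S\<close> be \<open>l\<close>-stacked, with an arbitrary homology ball \<open>\<Delta>\<close>. The Euler characteristics of the
links of \<open>\<Delta>\<close> give the Dehn-Sommerville relations: the polynomial \<open>G\<close> of the interior is the reversal of
the one of \<open>\<Delta>\<close> (\<open>face_poly_interior\<close>). All interior faces are large, so the coefficient of \<open>x\<^sup>l\<^sup>+\<^sup>1\<close> vanishes for
both, and hence for their difference \<open>G\<^sub>S\<close> (\<open>g_vec_zero_if_k_stacked\<close>).
\<close>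


section \<open>Relative chain complexes\<close>

lemma oriented_bdry_nonzeroD:
  assumes "oriented_bdry \<sigma> \<tau> \<noteq> (0::'f::field)"
  shows "\<exists>v\<in>\<sigma>. \<tau> = \<sigma> - {v}"
proof (rule ccontr)
  assume "\<not> ?thesis"
  then have "oriented_bdry \<sigma> \<tau> = (0::'f)"
    unfolding oriented_bdry_def by (intro sum.neutral) auto
  with assms show False by simp
qed

lemma oriented_bdry_facet:
  assumes "finite \<sigma>" "v \<in> \<sigma>"
  shows "oriented_bdry \<sigma> (\<sigma> - {v}) = ((-1) ^ card {w \<in> \<sigma>. w < v} :: 'f::field)"
proof -
  have "oriented_bdry \<sigma> (\<sigma> - {v}) = (\<Sum>u\<in>\<sigma>. if u = v then (-1) ^ card {w \<in> \<sigma>. w < u} else (0::'f))"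
    unfolding oriented_bdry_def by (intro sum.cong refl if_cong) (use assms in auto)
  then show ?thesis using assms by simp
qed

text \<open>
The differences of two simplicial complexes are convex in this sense. They carry the relative chain
complexes, and treating them alike gives links, interiors of balls and their pieces one common theory.
\<close>

definition convex_family :: "'v set set \<Rightarrow> bool" where
  "convex_family P \<longleftrightarrow> finite P \<and> (\<forall>\<sigma>\<in>P. finite \<sigma>) \<and>
     (\<forall>\<sigma>\<in>P. \<forall>\<rho>\<in>P. \<forall>\<tau>. \<sigma> \<subseteq> \<tau> \<longrightarrow> \<tau> \<subseteq> \<rho> \<longrightarrow> \<tau> \<in> P)"

lemma convex_familyD:
  assumes "convex_family P"
  shows "finite P" "\<sigma> \<in> P \<Longrightarrow> finite \<sigma>"
    "\<sigma> \<in> P \<Longrightarrow> \<rho> \<in> P \<Longrightarrow> \<sigma> \<subseteq> \<tau> \<Longrightarrow> \<tau> \<subseteq> \<rho> \<Longrightarrow> \<tau> \<in> P"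
  using assms unfolding convex_family_def by blast+

text \<open>
The boundary operator of the relative chain complex of a pair. Chains of all degrees are taken
together; since the operator lowers the degree by one, the grading is recovered from homogeneous
components when Betti numbers are computed.
\<close>

definition rel_bdry :: "'v::linorder set set \<Rightarrow> ('v set \<Rightarrow> 'f::field) \<Rightarrow> 'v set \<Rightarrow> 'f" where
  "rel_bdry P c = (\<lambda>\<tau>. if \<tau> \<in> P then \<Sum>\<sigma>\<in>P. c \<sigma> * oriented_bdry \<sigma> \<tau> else 0)"

definition supported :: "'v set set \<Rightarrow> ('v set \<Rightarrow> 'f::field) \<Rightarrow> bool" where
  "supported P c \<longleftrightarrow> (\<forall>\<sigma>. \<sigma> \<notin> P \<longrightarrow> c \<sigma> = 0)"

text \<open>
Between a face and a face with two vertices less there are exactly two intermediate faces, with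
opposite signs; convexity puts both of them into the family.
\<close>

lemma oriented_bdry_twice:
  assumes P: "convex_family P" and "\<rho> \<in> P" "\<tau> \<in> P"
  shows "(\<Sum>\<sigma>\<in>P. oriented_bdry \<rho> \<sigma> * oriented_bdry \<sigma> \<tau>) = (0::'f::field)"
proof (cases "\<exists>v\<in>\<rho>. \<exists>w\<in>\<rho>. v < w \<and> \<tau> = \<rho> - {v, w}")
  case True
  then obtain v w where vw: "v \<in> \<rho>" "w \<in> \<rho>" "v < w" "\<tau> = \<rho> - {v, w}" by blast
  have fin: "finite P" "finite \<rho>" using convex_familyD(1,2)[OF P] \<open>\<rho> \<in> P\<close> by blast+
  have inP: "\<rho> - {v} \<in> P" "\<rho> - {w} \<in> P"
    by (rule convex_familyD(3)[OF P \<open>\<tau> \<in> P\<close> \<open>\<rho> \<in> P\<close>], use vw(4) in blast, blast)+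
  have ne: "\<rho> - {v} \<noteq> \<rho> - {w}" using vw by auto
  have zero: "oriented_bdry \<rho> \<sigma> * oriented_bdry \<sigma> \<tau> = (0::'f)"
    if "\<sigma> \<in> P - {\<rho> - {v}, \<rho> - {w}}" for \<sigma>
  proof (rule ccontr)
    assume "\<not> ?thesis"
    then obtain x y where "x \<in> \<rho>" "\<sigma> = \<rho> - {x}" "y \<in> \<sigma>" "\<tau> = \<sigma> - {y}"
      using oriented_bdry_nonzeroD[where ?'f = 'f] by (metis mult_zero_left mult_zero_right)
    then show False using that vw by auto
  qed
  have c1: "card {x \<in> \<rho>. x < w} = Suc (card {x \<in> \<rho> - {v}. x < w})"
  proof -
    have "{x \<in> \<rho>. x < w} = insert v {x \<in> \<rho> - {v}. x < w}" using vw by auto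
    then show ?thesis using fin by simp
  qed
  have c2: "{x \<in> \<rho> - {w}. x < v} = {x \<in> \<rho>. x < v}" using vw by auto
  have t: "\<tau> = (\<rho> - {v}) - {w}" "\<tau> = (\<rho> - {w}) - {v}" using vw by auto
  have o1: "oriented_bdry (\<rho> - {v}) \<tau> = ((-1) ^ card {x \<in> \<rho> - {v}. x < w} :: 'f)"
    unfolding t(1) using fin vw by (intro oriented_bdry_facet) auto
  have o2: "oriented_bdry (\<rho> - {w}) \<tau> = ((-1) ^ card {x \<in> \<rho>. x < v} :: 'f)"
    unfolding t(2) using oriented_bdry_facet[of "\<rho> - {w}" v, where ?'f = 'f] fin vw c2 by simp
  have "(\<Sum>\<sigma>\<in>P. oriented_bdry \<rho> \<sigma> * oriented_bdry \<sigma> \<tau>) =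
        (\<Sum>\<sigma>\<in>{\<rho> - {v}, \<rho> - {w}}. oriented_bdry \<rho> \<sigma> * (oriented_bdry \<sigma> \<tau> :: 'f))"
    using fin inP zero by (intro sum.mono_neutral_right) auto
  also have "\<dots> = 0"
  proof -
    have "(\<Sum>\<sigma>\<in>{\<rho> - {v}, \<rho> - {w}}. oriented_bdry \<rho> \<sigma> * (oriented_bdry \<sigma> \<tau> :: 'f)) =
      oriented_bdry \<rho> (\<rho> - {v}) * oriented_bdry (\<rho> - {v}) \<tau> +
      oriented_bdry \<rho> (\<rho> - {w}) * oriented_bdry (\<rho> - {w}) \<tau>"
      using ne by simp
    also have "\<dots> = 0"
      unfolding o1 o2 oriented_bdry_facet[OF fin(2) vw(1)] oriented_bdry_facet[OF fin(2) vw(2)] c1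
      by simp
    finally show ?thesis .
  qed
  finally show ?thesis .
next
  case False
  show ?thesis
  proof (intro sum.neutral ballI, rule ccontr)
    fix \<sigma> assume "\<sigma> \<in> P" "oriented_bdry \<rho> \<sigma> * oriented_bdry \<sigma> \<tau> \<noteq> (0::'f)"
    then obtain x y where xy: "x \<in> \<rho>" "\<sigma> = \<rho> - {x}" "y \<in> \<sigma>" "\<tau> = \<sigma> - {y}"
      using oriented_bdry_nonzeroD[where ?'f = 'f] by (metis mult_zero_left mult_zero_right)
    then have "y \<in> \<rho>" "x \<noteq> y" "\<tau> = \<rho> - {x, y}" "\<tau> = \<rho> - {y, x}" by auto
    then show False using False xy(1) by (metis linorder_neqE)
  qed
qed

lemma rel_bdry_rel_bdry:
  fixes c :: "'v::linorder set \<Rightarrow> 'f::field"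
  assumes P: "convex_family P"
  shows "rel_bdry P (rel_bdry P c) = 0"
proof
  fix \<tau>
  show "rel_bdry P (rel_bdry P c) \<tau> = 0 \<tau>"
  proof (cases "\<tau> \<in> P")
    case True
    have "rel_bdry P (rel_bdry P c) \<tau> =
        (\<Sum>\<sigma>\<in>P. (\<Sum>\<rho>\<in>P. c \<rho> * oriented_bdry \<rho> \<sigma>) * oriented_bdry \<sigma> \<tau>)"
      using True by (auto simp: rel_bdry_def intro!: sum.cong)
    also have "\<dots> = (\<Sum>\<rho>\<in>P. c \<rho> * (\<Sum>\<sigma>\<in>P. oriented_bdry \<rho> \<sigma> * oriented_bdry \<sigma> \<tau>))"
      unfolding sum_distrib_left sum_distrib_right mult.assoc by (rule sum.swap)
    also have "\<dots> = 0" using oriented_bdry_twice[OF P _ True, where ?'f = 'f] by simp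
    finally show ?thesis by simp
  qed (simp add: rel_bdry_def)
qed

lemma rel_bdry_add: "rel_bdry P (b + c) = rel_bdry P b + rel_bdry P c"
  by (auto simp: rel_bdry_def fun_eq_iff sum.distrib algebra_simps)

lemma rel_bdry_diff: "rel_bdry P (b - c) = rel_bdry P b - rel_bdry P c"
  by (auto simp: rel_bdry_def fun_eq_iff sum_subtractf algebra_simps)

lemma rel_bdry_scale: "rel_bdry P (chain_scale a c) = chain_scale a (rel_bdry P c)"
  by (auto simp: rel_bdry_def chain_scale_def fun_eq_iff sum_distrib_left algebra_simps)

lemma rel_bdry_zero [simp]: "rel_bdry P 0 = 0"
  by (auto simp: rel_bdry_def fun_eq_iff)

lemma supported_add: "supported P b \<Longrightarrow> supported P c \<Longrightarrow> supported P (b + c)"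
  by (auto simp: supported_def)

lemma supported_diff: "supported P b \<Longrightarrow> supported P c \<Longrightarrow> supported P (b - c)"
  by (auto simp: supported_def)

lemma supported_scale: "supported P c \<Longrightarrow> supported P (chain_scale a c)"
  by (auto simp: supported_def chain_scale_def)

lemma supported_rel_bdry [simp]: "supported P (rel_bdry P c)"
  by (auto simp: supported_def rel_bdry_def)

lemma supported_mono: "supported P c \<Longrightarrow> P \<subseteq> Q \<Longrightarrow> supported Q c"
  by (auto simp: supported_def)

definition restrict_chain :: "'v set set \<Rightarrow> ('v set \<Rightarrow> 'f::field) \<Rightarrow> 'v set \<Rightarrow> 'f" where
  "restrict_chain P c = (\<lambda>\<sigma>. if \<sigma> \<in> P then c \<sigma> else 0)"

lemma supported_restrict [simp]: "supported P (restrict_chain P c)"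
  by (auto simp: supported_def restrict_chain_def)

lemma restrict_chain_add: "restrict_chain P (b + c) = restrict_chain P b + restrict_chain P c"
  by (auto simp: restrict_chain_def fun_eq_iff)

lemma restrict_chain_diff: "restrict_chain P (b - c) = restrict_chain P b - restrict_chain P c"
  by (auto simp: restrict_chain_def fun_eq_iff)

lemma restrict_chain_zero [simp]: "restrict_chain P 0 = 0"
  by (auto simp: restrict_chain_def fun_eq_iff)

lemma restrict_chain_scale:
  "restrict_chain P (chain_scale a c) = chain_scale a (restrict_chain P c)"
  by (auto simp: restrict_chain_def chain_scale_def fun_eq_iff)

lemma restrict_chain_id: "supported P c \<Longrightarrow> restrict_chain P c = c"
  by (auto simp: restrict_chain_def supported_def fun_eq_iff)


section \<open>Long exact sequences\<close>

text \<open>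
The short exact sequence \<open>0 \<rightarrow> C(Q) \<rightarrow> C(P) \<rightarrow> C(R) \<rightarrow> 0\<close> of relative chain complexes: \<open>Q\<close> is closed
under taking faces inside \<open>P\<close>.
\<close>

definition splits_as :: "'v set set \<Rightarrow> 'v set set \<Rightarrow> 'v set set \<Rightarrow> bool" where
  "splits_as P Q R \<longleftrightarrow> convex_family P \<and> P = Q \<union> R \<and> Q \<inter> R = {} \<and> (\<forall>\<sigma>\<in>Q. \<forall>\<tau>\<in>R. \<not> \<tau> \<subseteq> \<sigma>)"

lemma splits_asD:
  assumes "splits_as P Q R"
  shows "convex_family P" "convex_family Q" "convex_family R" "finite P" "P = Q \<union> R" "Q \<inter> R = {}"
proof -
  show *: "convex_family P" "P = Q \<union> R" "Q \<inter> R = {}" using assms by (auto simp: splits_as_def)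
  show "finite P" using convex_familyD(1)[OF *(1)] .
  have sep: "\<not> \<tau> \<subseteq> \<sigma>" if "\<sigma> \<in> Q" "\<tau> \<in> R" for \<sigma> \<tau>
    using assms that by (auto simp: splits_as_def)
  have between: "\<tau> \<in> Q \<or> \<tau> \<in> R" if "\<sigma> \<in> P" "\<rho> \<in> P" "\<sigma> \<subseteq> \<tau>" "\<tau> \<subseteq> \<rho>" for \<sigma> \<rho> \<tau>
  proof -
    have "\<tau> \<in> P" using convex_familyD(3)[OF *(1)] that by blast
    then show ?thesis using *(2) by blast
  qed
  have sub: "Q \<subseteq> P" "R \<subseteq> P" using *(2) by simp_all
  have fin: "finite Q" "finite R" "\<forall>\<sigma>\<in>Q. finite \<sigma>" "\<forall>\<sigma>\<in>R. finite \<sigma>"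
    using \<open>finite P\<close> finite_subset[OF sub(1)] finite_subset[OF sub(2)] convex_familyD(2)[OF *(1)] sub
    by blast+
  have "\<tau> \<in> Q" if "\<sigma> \<in> Q" "\<rho> \<in> Q" "\<sigma> \<subseteq> \<tau>" "\<tau> \<subseteq> \<rho>" for \<sigma> \<rho> \<tau>
    using between[of \<sigma> \<rho> \<tau>] sep[of \<rho> \<tau>] that sub by blast
  then show "convex_family Q"
    unfolding convex_family_def using fin by blast
  have "\<tau> \<in> R" if "\<sigma> \<in> R" "\<rho> \<in> R" "\<sigma> \<subseteq> \<tau>" "\<tau> \<subseteq> \<rho>" for \<sigma> \<rho> \<tau>
    using between[of \<sigma> \<rho> \<tau>] sep[of \<tau> \<sigma>] that sub by blast
  then show "convex_family R"
    unfolding convex_family_def using fin by blast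
qed

lemma rel_bdry_lower:
  assumes s: "splits_as P Q R" and c: "supported Q c"
  shows "rel_bdry P c = rel_bdry Q (c :: 'v::linorder set \<Rightarrow> 'f::field)"
proof
  fix \<tau>
  have eq: "(\<Sum>\<sigma>\<in>P. c \<sigma> * oriented_bdry \<sigma> \<tau>) = (\<Sum>\<sigma>\<in>Q. c \<sigma> * oriented_bdry \<sigma> \<tau>)"
    using splits_asD[OF s] c by (intro sum.mono_neutral_right) (auto simp: supported_def)
  have "(\<Sum>\<sigma>\<in>Q. c \<sigma> * oriented_bdry \<sigma> \<tau>) = 0" if "\<tau> \<in> R"
  proof (intro sum.neutral ballI)
    fix \<sigma> assume "\<sigma> \<in> Q"
    then have "\<not> \<tau> \<subseteq> \<sigma>" using s that by (auto simp: splits_as_def)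
    then show "c \<sigma> * oriented_bdry \<sigma> \<tau> = 0" using oriented_bdry_nonzeroD[of \<sigma> \<tau>, where ?'f = 'f] by auto
  qed
  moreover have "\<tau> \<in> P \<longleftrightarrow> \<tau> \<in> Q \<or> \<tau> \<in> R" using splits_asD(5)[OF s] by blast
  ultimately show "rel_bdry P c \<tau> = rel_bdry Q c \<tau>"
    by (auto simp: rel_bdry_def eq)
qed

lemma restrict_rel_bdry_upper:
  assumes s: "splits_as P Q R"
  shows "restrict_chain R (rel_bdry P c) = rel_bdry R (restrict_chain R (c :: 'v::linorder set \<Rightarrow> 'f::field))"
proof
  fix \<tau>
  have "(\<Sum>\<sigma>\<in>P. c \<sigma> * oriented_bdry \<sigma> \<tau>) = (\<Sum>\<sigma>\<in>R. restrict_chain R c \<sigma> * oriented_bdry \<sigma> \<tau>)" if t: "\<tau> \<in> R"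
  proof -
    have z: "c \<sigma> * oriented_bdry \<sigma> \<tau> = 0" if "\<sigma> \<in> P - R" for \<sigma>
    proof -
      have "\<not> \<tau> \<subseteq> \<sigma>" using s t that by (auto simp: splits_as_def)
      then show ?thesis using oriented_bdry_nonzeroD[of \<sigma> \<tau>, where ?'f = 'f] by auto
    qed
    have "(\<Sum>\<sigma>\<in>P. c \<sigma> * oriented_bdry \<sigma> \<tau>) = (\<Sum>\<sigma>\<in>R. c \<sigma> * oriented_bdry \<sigma> \<tau>)"
      using splits_asD[OF s] z by (intro sum.mono_neutral_right) auto
    then show ?thesis by (simp add: restrict_chain_def)
  qed
  then show "restrict_chain R (rel_bdry P c) \<tau> = rel_bdry R (restrict_chain R c) \<tau>"
    using splits_asD(5)[OF s] by (auto simp: rel_bdry_def restrict_chain_def)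
qed

lemma supported_lower_if_restrict_zero:
  assumes "splits_as P Q R" "supported P c" "restrict_chain R c = 0"
  shows "supported Q c"
  unfolding supported_def
proof (intro allI impI)
  fix \<sigma> assume "\<sigma> \<notin> Q"
  show "c \<sigma> = 0"
  proof (cases "\<sigma> \<in> R")
    case True
    then show ?thesis using fun_cong[OF assms(3), of \<sigma>] by (simp add: restrict_chain_def)
  next
    case False
    then show ?thesis using assms(2) splits_asD(5)[OF assms(1)] \<open>\<sigma> \<notin> Q\<close> by (auto simp: supported_def)
  qed
qed

definition acyclic_family :: "'f::field itself \<Rightarrow> 'v::linorder set set \<Rightarrow> bool" where
  "acyclic_family F P \<longleftrightarrow> (\<forall>c::'v set \<Rightarrow> 'f. supported P c \<and> rel_bdry P c = 0 \<longrightarrow>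
     (\<exists>e. supported P e \<and> rel_bdry P e = c))"

text \<open>
The family has the homology of a sphere: the homology is one-dimensional and generated by \<open>z\<close>. The
number \<open>m\<close> counts vertices, so the sphere has dimension \<open>m - 1\<close>.
\<close>

definition fundamental_cycle :: "nat \<Rightarrow> 'v::linorder set set \<Rightarrow> ('v set \<Rightarrow> 'f::field) \<Rightarrow> bool" where
  "fundamental_cycle m P z \<longleftrightarrow> supported P z \<and> (\<forall>\<sigma>. z \<sigma> \<noteq> 0 \<longrightarrow> card \<sigma> = m) \<and> rel_bdry P z = 0 \<and>
     (\<nexists>e. supported P e \<and> rel_bdry P e = z) \<and>
     (\<forall>c. supported P c \<and> rel_bdry P c = 0 \<longrightarrow>
        (\<exists>a e. supported P e \<and> c = chain_scale a z + rel_bdry P e))"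

lemma acyclic_familyD:
  fixes c :: "'v::linorder set \<Rightarrow> 'f::field"
  assumes "acyclic_family TYPE('f) P" "supported P c" "rel_bdry P c = 0"
  obtains e where "supported P e" "rel_bdry P e = c"
  using assms unfolding acyclic_family_def by blast

text \<open>
Part of the long exact sequence of the pair: a cycle is first corrected to vanish on \<open>R\<close>, and what
remains is a cycle of \<open>Q\<close>.
\<close>

lemma acyclic_family_extend:
  assumes s: "splits_as P Q R" and Q: "acyclic_family TYPE('f::field) Q" and R: "acyclic_family TYPE('f) R"
  shows "acyclic_family TYPE('f) (P :: 'v::linorder set set)"
  unfolding acyclic_family_def
proof (intro allI impI, elim conjE)
  fix c :: "'v set \<Rightarrow> 'f" assume c: "supported P c" "rel_bdry P c = 0"
  note sD = splits_asD[OF s]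
  have "rel_bdry R (restrict_chain R c) = 0"
    using restrict_rel_bdry_upper[OF s, of c] c by simp
  then obtain e where e: "supported R e" "rel_bdry R e = restrict_chain R c"
    using acyclic_familyD[OF R supported_restrict] by blast
  have eP: "supported P e" using e sD(5) supported_mono by blast
  define q where "q = c - rel_bdry P e"
  have "restrict_chain R q = 0"
    by (simp add: q_def restrict_chain_diff restrict_rel_bdry_upper[OF s] restrict_chain_id e)
  then have q: "supported Q q"
    using supported_lower_if_restrict_zero[OF s, of q] c eP by (simp add: q_def supported_diff)
  have "rel_bdry P q = 0" by (simp add: q_def rel_bdry_diff rel_bdry_rel_bdry sD(1) c)
  then have "rel_bdry Q q = 0" using rel_bdry_lower[OF s q] by simp
  then obtain e' where e': "supported Q e'" "rel_bdry Q e' = q" using acyclic_familyD[OF Q q] by blast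
  have "rel_bdry P (e + e') = c"
    by (simp add: rel_bdry_add rel_bdry_lower[OF s e'(1)] e' q_def)
  moreover have "supported P (e + e')"
    using eP e' sD(5) supported_mono[of Q e' P] by (simp add: supported_add)
  ultimately show "\<exists>e. supported P e \<and> rel_bdry P e = c" by blast
qed

lemma rel_bdry_component:
  "(\<lambda>\<tau>. if card \<tau> = m then rel_bdry P c \<tau> else 0) =
   rel_bdry P (\<lambda>\<sigma>. if card \<sigma> = Suc m then c \<sigma> else (0::'f::field))"
  if fin: "\<forall>\<sigma>\<in>P. finite \<sigma>"
proof
  fix \<tau>
  have "(\<Sum>\<sigma>\<in>P. (if card \<sigma> = Suc m then c \<sigma> else (0::'f)) * oriented_bdry \<sigma> \<tau>) =
     (if card \<tau> = m then \<Sum>\<sigma>\<in>P. c \<sigma> * oriented_bdry \<sigma> \<tau> else 0)"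
  proof -
    have *: "card \<sigma> = Suc (card \<tau>)" if \<sigma>: "\<sigma> \<in> P" and nz: "oriented_bdry \<sigma> \<tau> \<noteq> (0::'f)" for \<sigma>
    proof -
      obtain v where "v \<in> \<sigma>" "\<tau> = \<sigma> - {v}" using oriented_bdry_nonzeroD[OF nz] by blast
      then show ?thesis using card.remove[of \<sigma> v] fin \<sigma> by blast
    qed
    have "(\<Sum>\<sigma>\<in>P. (if card \<sigma> = Suc m then c \<sigma> else (0::'f)) * oriented_bdry \<sigma> \<tau>) =
      (\<Sum>\<sigma>\<in>P. if card \<tau> = m then c \<sigma> * oriented_bdry \<sigma> \<tau> else 0)"
    proof (rule sum.cong[OF refl])
      fix \<sigma> assume "\<sigma> \<in> P"
      then show "(if card \<sigma> = Suc m then c \<sigma> else 0) * oriented_bdry \<sigma> \<tau> =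
        (if card \<tau> = m then c \<sigma> * oriented_bdry \<sigma> \<tau> else 0)"
        using *[of \<sigma>] by (cases "oriented_bdry \<sigma> \<tau> = (0::'f)") auto
    qed
    also have "\<dots> = (if card \<tau> = m then \<Sum>\<sigma>\<in>P. c \<sigma> * oriented_bdry \<sigma> \<tau> else 0)"
      by simp
    finally show ?thesis .
  qed
  then show "(if card \<tau> = m then rel_bdry P c \<tau> else 0) =
    rel_bdry P (\<lambda>\<sigma>. if card \<sigma> = Suc m then c \<sigma> else 0) \<tau>"
    unfolding rel_bdry_def by presburger
qed

text \<open>
If \<open>Q\<close> is acyclic, then the long exact sequence identifies the homology of \<open>P\<close> with that of \<open>R\<close>. The
generator is lifted explicitly, because its coefficients on the facets matter later.
\<close>

lemma fundamental_cycle_extend: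
  fixes z :: "'v::linorder set \<Rightarrow> 'f::field"
  assumes s: "splits_as P Q R" and Q: "acyclic_family TYPE('f) Q" and R: "fundamental_cycle m R z"
  obtains q where "supported Q q" "fundamental_cycle m P (z + q)"
proof -
  note sD = splits_asD[OF s]
  have z: "supported R z" "\<And>\<sigma>. z \<sigma> \<noteq> 0 \<Longrightarrow> card \<sigma> = m" "rel_bdry R z = 0"
    "\<nexists>e. supported R e \<and> rel_bdry R e = z"
    "\<And>c. supported R c \<Longrightarrow> rel_bdry R c = 0 \<Longrightarrow> \<exists>a e. supported R e \<and> c = chain_scale a z + rel_bdry R e"
    using R unfolding fundamental_cycle_def by blast+
  have finP: "\<forall>\<sigma>\<in>P. finite \<sigma>" "\<forall>\<sigma>\<in>Q. finite \<sigma>"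
    using convex_familyD(2)[OF sD(1)] convex_familyD(2)[OF sD(2)] by blast+
  have zP: "supported P z" using z(1) sD(5) supported_mono by blast
  \<comment> \<open>The boundary of \<open>z\<close> is a cycle of the acyclic \<open>Q\<close>; subtracting a chain of \<open>Q\<close> that it bounds
    closes \<open>z\<close> up. Only the component in the degree of \<open>z\<close> is kept, so that the sum is homogeneous.\<close>
  define y where "y = rel_bdry P z"
  have "restrict_chain R y = 0"
    by (simp add: y_def restrict_rel_bdry_upper[OF s] restrict_chain_id z)
  then have y: "supported Q y"
    using supported_lower_if_restrict_zero[OF s, of y] by (simp add: y_def)
  have "rel_bdry Q y = 0" using rel_bdry_lower[OF s y] by (simp add: y_def rel_bdry_rel_bdry sD(1))
  then obtain p where p: "supported Q p" "rel_bdry Q p = y" using acyclic_familyD[OF Q y] by blast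
  define q where "q = - (\<lambda>\<sigma>. if card \<sigma> = m then p \<sigma> else 0)"
  have q: "supported Q q" using p by (auto simp: supported_def q_def)
  have qP: "supported P q" using q sD(5) supported_mono by blast
  have z_top: "z = (\<lambda>\<sigma>. if card \<sigma> = m then z \<sigma> else 0)" using z(2) by (auto simp: fun_eq_iff)
  have cyc: "rel_bdry P (z + q) = 0"
  proof (cases m)
    case (Suc k)
    have "y = (\<lambda>\<tau>. if card \<tau> = k then y \<tau> else 0)"
      unfolding y_def rel_bdry_component[OF finP(1)] by (simp add: Suc z_top[symmetric, unfolded Suc])
    also have "\<dots> = rel_bdry Q (- q)"
      unfolding p(2)[symmetric] rel_bdry_component[OF finP(2)] by (simp add: q_def Suc)
    also have "\<dots> = - rel_bdry P q"
      using rel_bdry_lower[OF s q] rel_bdry_diff[of Q 0 q] by simp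
    finally show ?thesis by (simp add: rel_bdry_add y_def)
  next
    case 0
    \<comment> \<open>In the lowest degree a chain lives on the empty face alone, whose boundary vanishes.\<close>
    have "rel_bdry P c = 0" if "\<And>\<sigma>. c \<sigma> \<noteq> 0 \<Longrightarrow> card \<sigma> = 0" for c :: "'v set \<Rightarrow> 'f"
    proof -
      have "c \<sigma> * oriented_bdry \<sigma> \<tau> = 0" if "\<sigma> \<in> P" for \<sigma> \<tau>
      proof (cases "c \<sigma> = 0")
        case False
        then have "card \<sigma> = 0" using \<open>\<And>\<sigma>. c \<sigma> \<noteq> 0 \<Longrightarrow> card \<sigma> = 0\<close> by blast
        then have "\<sigma> = {}" using finP that by simp
        then show ?thesis by (simp add: oriented_bdry_def)
      qed simp
      then have "(\<Sum>\<sigma>\<in>P. c \<sigma> * oriented_bdry \<sigma> \<tau>) = 0" for \<tau>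
        by (intro sum.neutral ballI)
      then show ?thesis by (simp add: rel_bdry_def fun_eq_iff)
    qed
    moreover have "card \<sigma> = 0" if "(z + q) \<sigma> \<noteq> 0" for \<sigma>
      using that z(2)[of \<sigma>] 0 by (cases "card \<sigma> = 0") (auto simp: q_def)
    ultimately show ?thesis by blast
  qed
  have resz: "restrict_chain R (z + q) = z"
    using q z(1) sD(6) by (auto simp: restrict_chain_def supported_def fun_eq_iff)
  have "fundamental_cycle m P (z + q)"
    unfolding fundamental_cycle_def
  proof (intro conjI allI impI notI, goal_cases)
    case 1 show ?case using zP qP by (rule supported_add)
  next
    case (2 \<sigma>) then show ?case using z(2)[of \<sigma>] by (auto simp: q_def split: if_splits)
  next
    case 3 show ?case by (rule cyc)
  next
    case 4
    then obtain e where "supported P e" "rel_bdry P e = z + q" by blast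
    then have "rel_bdry R (restrict_chain R e) = z"
      using restrict_rel_bdry_upper[OF s, of e] resz by simp
    then show False using z(4) supported_restrict by blast
  next
    case (5 c)
    then have "rel_bdry R (restrict_chain R c) = 0"
      using restrict_rel_bdry_upper[OF s, of c] by simp
    then obtain a e where e: "supported R e" "restrict_chain R c = chain_scale a z + rel_bdry R e"
      using z(5)[OF supported_restrict] by blast
    have eP: "supported P e" using e sD(5) supported_mono by blast
    define w where "w = c - (chain_scale a (z + q) + rel_bdry P e)"
    have "restrict_chain R (chain_scale a (z + q)) = chain_scale a z"
      by (simp only: restrict_chain_scale resz)
    then have "restrict_chain R w = 0"
      by (simp add: w_def restrict_chain_diff restrict_chain_add restrict_rel_bdry_upper[OF s]
          restrict_chain_id[OF e(1)] e(2))
    then have w: "supported Q w"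
      using supported_lower_if_restrict_zero[OF s, of w] 5 zP qP
      by (simp add: w_def supported_diff supported_add supported_scale)
    have "rel_bdry P w = 0"
      using 5 cyc by (simp add: w_def rel_bdry_diff rel_bdry_add rel_bdry_scale rel_bdry_rel_bdry sD(1))
        (simp add: rel_bdry_add[symmetric] chain_scale_def fun_eq_iff)
    then have "rel_bdry Q w = 0" using rel_bdry_lower[OF s w] by simp
    then obtain e' where e': "supported Q e'" "rel_bdry Q e' = w" using acyclic_familyD[OF Q w] by blast
    have "c = chain_scale a (z + q) + rel_bdry P (e + e')"
      by (simp add: rel_bdry_add rel_bdry_lower[OF s e'(1)] e' w_def)
    moreover have "supported P (e + e')"
      using eP e' sD(5) supported_mono[of Q e' P] by (simp add: supported_add)
    ultimately show ?case by blast
  qed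
  then show ?thesis using that q by blast
qed

text \<open>
If \<open>P\<close> is acyclic, then the connecting homomorphism is an isomorphism from the homology of \<open>R\<close> to
that of \<open>Q\<close>. Applied to a ball and its interior, this computes the homology of the boundary without
any appeal to duality.
\<close>

lemma fundamental_cycle_bdry:
  fixes z :: "'v::linorder set \<Rightarrow> 'f::field"
  assumes s: "splits_as P Q R" and P: "acyclic_family TYPE('f) P" and R: "fundamental_cycle (Suc m) R z"
  shows "fundamental_cycle m Q (rel_bdry P z)"
proof -
  note sD = splits_asD[OF s]
  have z: "supported R z" "\<And>\<sigma>. z \<sigma> \<noteq> 0 \<Longrightarrow> card \<sigma> = Suc m" "rel_bdry R z = 0"
    "\<nexists>e. supported R e \<and> rel_bdry R e = z"
    "\<And>c. supported R c \<Longrightarrow> rel_bdry R c = 0 \<Longrightarrow> \<exists>a e. supported R e \<and> c = chain_scale a z + rel_bdry R e"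
    using R unfolding fundamental_cycle_def by blast+
  have finP: "\<forall>\<sigma>\<in>P. finite \<sigma>" using convex_familyD(2)[OF sD(1)] by blast
  have zP: "supported P z" using z(1) sD(5) supported_mono by blast
  define y where "y = rel_bdry P z"
  have "restrict_chain R y = 0"
    by (simp add: y_def restrict_rel_bdry_upper[OF s] restrict_chain_id z)
  then have y: "supported Q y"
    using supported_lower_if_restrict_zero[OF s, of y] by (simp add: y_def)
  have z_top: "z = (\<lambda>\<sigma>. if card \<sigma> = Suc m then z \<sigma> else 0)" using z(2) by (auto simp: fun_eq_iff)
  have "fundamental_cycle m Q y"
    unfolding fundamental_cycle_def
  proof (intro conjI allI impI notI, goal_cases)
    case 1 show ?case by (rule y)
  next
    case (2 \<tau>)
    have "y = (\<lambda>\<tau>. if card \<tau> = m then y \<tau> else 0)"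
      unfolding y_def rel_bdry_component[OF finP] by (simp add: z_top[symmetric])
    then have "y \<tau> = (if card \<tau> = m then y \<tau> else 0)" by (rule fun_cong)
    then show ?case using 2 by (simp split: if_splits)
  next
    case 3 show ?case using rel_bdry_lower[OF s y] by (simp add: y_def rel_bdry_rel_bdry sD(1))
  next
    case 4
    then obtain q where q: "supported Q q" "rel_bdry Q q = y" by blast
    have "supported P (z - q)" using zP q sD(5) supported_mono[of Q q P] by (simp add: supported_diff)
    moreover have "rel_bdry P (z - q) = 0"
      by (simp add: rel_bdry_diff rel_bdry_lower[OF s q(1)] q y_def)
    ultimately obtain e where e: "supported P e" "rel_bdry P e = z - q" using acyclic_familyD[OF P] by blast
    have "restrict_chain R (z - q) = z"
      using q z(1) sD(6) by (auto simp: restrict_chain_def supported_def fun_eq_iff)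
    then have "rel_bdry R (restrict_chain R e) = z"
      using restrict_rel_bdry_upper[OF s, of e] e by simp
    then show False using z(4) supported_restrict by blast
  next
    case (5 c)
    then have cP: "supported P c" "rel_bdry P c = 0"
      using sD(5) supported_mono[of Q c P] rel_bdry_lower[OF s, of c] by auto
    then obtain e where e: "supported P e" "rel_bdry P e = c" using acyclic_familyD[OF P] by blast
    have "rel_bdry R (restrict_chain R e) = 0"
    proof -
      have "restrict_chain R c = 0"
        using 5 sD(6) by (auto simp: restrict_chain_def fun_eq_iff supported_def)
      then show ?thesis using restrict_rel_bdry_upper[OF s, of e] e by simp
    qed
    then obtain a e2 where e2: "supported R e2" "restrict_chain R e = chain_scale a z + rel_bdry R e2"
      using z(5)[OF supported_restrict] by blast
    define q where "q = e - (chain_scale a z + rel_bdry P e2)"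
    have "restrict_chain R (chain_scale a z) = chain_scale a z"
      using z(1) by (intro restrict_chain_id supported_scale)
    then have "restrict_chain R q = 0"
      by (simp add: q_def restrict_chain_diff restrict_chain_add restrict_rel_bdry_upper[OF s]
          restrict_chain_id[OF e2(1)] e2(2))
    then have q: "supported Q q"
      using supported_lower_if_restrict_zero[OF s, of q] e zP
      by (simp add: q_def supported_diff supported_add supported_scale)
    have "rel_bdry P q = c - chain_scale a y"
      by (simp add: q_def rel_bdry_diff rel_bdry_add rel_bdry_scale rel_bdry_rel_bdry sD(1) e y_def)
    then have "c = chain_scale a y + rel_bdry Q q" using rel_bdry_lower[OF s q] by simp
    then show ?case using q by blast
  qed
  then show ?thesis by (simp add: y_def)
qed

lemma fundamental_cycle_singleton:
  assumes "finite \<sigma>"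
  shows "fundamental_cycle (card \<sigma>) {\<sigma>} (\<lambda>\<tau>. if \<tau> = \<sigma> then 1 else (0::'f::field))"
proof -
  have o: "oriented_bdry \<sigma> \<sigma> = (0::'f)"
    using oriented_bdry_nonzeroD[of \<sigma> \<sigma>, where ?'f = 'f] by blast
  have b: "rel_bdry {\<sigma>} c = 0" for c :: "'a set \<Rightarrow> 'f"
    by (auto simp: rel_bdry_def fun_eq_iff o)
  show ?thesis
    unfolding fundamental_cycle_def b
    by (auto simp: supported_def fun_eq_iff chain_scale_def split: if_splits)
qed

text \<open>
A Boolean interval with more than one element is a cone. The induction cuts off one vertex and so
halves the interval until two faces are left.
\<close>

lemma acyclic_family_interval:
  assumes "finite b" "a \<subset> b"
  shows "acyclic_family TYPE('f::field) {\<sigma>. a \<subseteq> \<sigma> \<and> \<sigma> \<subseteq> (b :: 'v::linorder set)}"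
  using assms
proof (induction "card (b - a)" arbitrary: a b rule: less_induct)
  case (less a b)
  have conv: "convex_family {\<sigma>. a \<subseteq> \<sigma> \<and> \<sigma> \<subseteq> b}"
    unfolding convex_family_def
  proof (intro conjI ballI allI impI)
    show "finite {\<sigma>. a \<subseteq> \<sigma> \<and> \<sigma> \<subseteq> b}" using less.prems by simp
  qed (use less.prems in \<open>auto intro: finite_subset\<close>)
  obtain v where v: "v \<in> b" "v \<notin> a" using less.prems by blast
  show ?case
  proof (cases "b = insert v a")
    case True
    have P: "{\<sigma>. a \<subseteq> \<sigma> \<and> \<sigma> \<subseteq> b} = {a, b}" using True by auto
    have fin: "finite a" using less.prems finite_subset by blast
    have ba: "a = b - {v}" using True v by auto
    define s where "s = (oriented_bdry b a :: 'f)"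
    have s0: "s \<noteq> 0" unfolding s_def ba using oriented_bdry_facet[of b v, where ?'f = 'f] less.prems v by simp
    have zero: "oriented_bdry b b = (0::'f)" "oriented_bdry a a = (0::'f)" "oriented_bdry a b = (0::'f)"
      using oriented_bdry_nonzeroD[where ?'f = 'f] v by blast+
    have ne: "a \<noteq> b" using v by auto
    show ?thesis
      unfolding acyclic_family_def P
    proof (intro allI impI, elim conjE)
      fix c :: "'v set \<Rightarrow> 'f" assume c: "supported {a, b} c" "rel_bdry {a, b} c = 0"
      have "rel_bdry {a, b} c a = c b * s" using ne zero by (simp add: rel_bdry_def s_def)
      then have "c b = 0" using c s0 by simp
      define e where "e = (\<lambda>\<sigma>. if \<sigma> = b then c a / s else 0)"
      have "rel_bdry {a, b} e = c"
        using ne zero s0 c(1) \<open>c b = 0\<close> by (auto simp: rel_bdry_def e_def s_def fun_eq_iff supported_def)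
      moreover have "supported {a, b} e" by (simp add: supported_def e_def)
      ultimately show "\<exists>e. supported {a, b} e \<and> rel_bdry {a, b} e = c" by blast
    qed
  next
    case False
    let ?Q = "{\<sigma>. a \<subseteq> \<sigma> \<and> \<sigma> \<subseteq> b - {v}}" and ?R = "{\<sigma>. insert v a \<subseteq> \<sigma> \<and> \<sigma> \<subseteq> b}"
    have eq: "{\<sigma>. a \<subseteq> \<sigma> \<and> \<sigma> \<subseteq> b} = ?Q \<union> ?R" by blast
    have "splits_as {\<sigma>. a \<subseteq> \<sigma> \<and> \<sigma> \<subseteq> b} ?Q ?R"
      unfolding splits_as_def using conv eq by blast
    moreover have "acyclic_family TYPE('f) ?Q"
    proof (rule less.hyps)
      have "b - {v} - a = (b - a) - {v}" by blast
      then show "card (b - {v} - a) < card (b - a)"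
        using v less.prems card_Diff1_less[of "b - a" v] by (simp only:) blast
      show "a \<subset> b - {v}" using False less.prems v by blast
    qed (use less.prems in auto)
    moreover have "acyclic_family TYPE('f) ?R"
    proof (rule less.hyps)
      have "b - insert v a = (b - a) - {v}" by blast
      then show "card (b - insert v a) < card (b - a)"
        using v less.prems card_Diff1_less[of "b - a" v] by (simp only:) blast
      show "insert v a \<subset> b" using False less.prems v by blast
    qed (use less.prems in auto)
    ultimately show ?thesis using acyclic_family_extend by blast
  qed
qed


section \<open>Links\<close>

text \<open>
For a simplicial complex this is the link. The definition extends it to families such as the interior
of a ball, with which it commutes.
\<close>

definition local_link :: "'v set \<Rightarrow> 'v set set \<Rightarrow> 'v set set" where
  "local_link \<sigma> P = {\<tau>. \<tau> \<inter> \<sigma> = {} \<and> \<tau> \<union> \<sigma> \<in> P}"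

lemma local_link_iff [simp]: "\<tau> \<in> local_link \<sigma> P \<longleftrightarrow> \<tau> \<inter> \<sigma> = {} \<and> \<tau> \<union> \<sigma> \<in> P"
  by (simp add: local_link_def)

lemma simplicial_complexD:
  assumes "simplicial_complex X"
  shows "finite X" "{} \<in> X" "\<sigma> \<in> X \<Longrightarrow> finite \<sigma>" "\<sigma> \<in> X \<Longrightarrow> \<tau> \<subseteq> \<sigma> \<Longrightarrow> \<tau> \<in> X"
  using assms unfolding simplicial_complex_def by blast+

lemma link_eq_local_link:
  assumes "simplicial_complex X"
  shows "link \<sigma> X = local_link \<sigma> X"
  using simplicial_complexD(4)[OF assms] unfolding link_def local_link_def by blast

lemma convex_family_local_link:
  assumes P: "convex_family P"
  shows "convex_family (local_link \<sigma> P)"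
  unfolding convex_family_def
proof (intro conjI ballI allI impI)
  have "inj_on (\<lambda>\<tau>. \<tau> \<union> \<sigma>) (local_link \<sigma> P)"
    by (rule inj_onI) (auto simp: set_eq_iff disjoint_iff)
  moreover have "(\<lambda>\<tau>. \<tau> \<union> \<sigma>) ` local_link \<sigma> P \<subseteq> P" by auto
  ultimately show "finite (local_link \<sigma> P)"
    using convex_familyD(1)[OF P] by (metis finite_imageD finite_subset)
next
  fix \<tau> assume "\<tau> \<in> local_link \<sigma> P"
  then show "finite \<tau>" using convex_familyD(2)[OF P, of "\<tau> \<union> \<sigma>"] by simp
next
  fix \<tau> \<rho> \<kappa> assume *: "\<tau> \<in> local_link \<sigma> P" "\<rho> \<in> local_link \<sigma> P" "\<tau> \<subseteq> \<kappa>" "\<kappa> \<subseteq> \<rho>"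
  have "\<kappa> \<union> \<sigma> \<in> P"
    by (rule convex_familyD(3)[OF P, of "\<tau> \<union> \<sigma>" "\<rho> \<union> \<sigma>"]) (use * in auto)
  then show "\<kappa> \<in> local_link \<sigma> P" using * by auto
qed

lemma splits_as_local_link:
  assumes "splits_as P Q R"
  shows "splits_as (local_link \<sigma> P) (local_link \<sigma> Q) (local_link \<sigma> R)"
  unfolding splits_as_def
proof (intro conjI ballI)
  show "convex_family (local_link \<sigma> P)"
    using splits_asD(1)[OF assms] by (rule convex_family_local_link)
  show "local_link \<sigma> P = local_link \<sigma> Q \<union> local_link \<sigma> R"
    unfolding splits_asD(5)[OF assms] by auto
  show "local_link \<sigma> Q \<inter> local_link \<sigma> R = {}"
    using splits_asD(6)[OF assms] by auto
  fix \<rho> \<tau> assume "\<rho> \<in> local_link \<sigma> Q" "\<tau> \<in> local_link \<sigma> R"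
  then have "\<rho> \<union> \<sigma> \<in> Q" "\<tau> \<union> \<sigma> \<in> R" by simp_all
  then have "\<not> \<tau> \<union> \<sigma> \<subseteq> \<rho> \<union> \<sigma>" using assms unfolding splits_as_def by blast
  then show "\<not> \<tau> \<subseteq> \<rho>" by blast
qed

lemma local_link_interval:
  assumes "\<sigma> \<subseteq> b"
  shows "local_link \<sigma> {\<tau>. a \<subseteq> \<tau> \<and> \<tau> \<subseteq> b} = {\<tau>. a - \<sigma> \<subseteq> \<tau> \<and> \<tau> \<subseteq> b - \<sigma>}"
  using assms unfolding local_link_def by blast

lemma local_link_interval_empty:
  assumes "\<not> \<sigma> \<subseteq> b"
  shows "local_link \<sigma> {\<tau>. a \<subseteq> \<tau> \<and> \<tau> \<subseteq> b} = {}"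
  using assms unfolding local_link_def by blast

lemma local_link_Un: "local_link \<sigma> (P \<union> Q) = local_link \<sigma> P \<union> local_link \<sigma> Q"
  by (auto simp: local_link_def)

lemma local_link_empty_if: "(\<And>\<rho>. \<sigma> \<subseteq> \<rho> \<Longrightarrow> \<rho> \<notin> P) \<Longrightarrow> local_link \<sigma> P = {}"
  by (auto simp: local_link_def)

lemma convex_family_diff:
  assumes "simplicial_complex X" "simplicial_complex Y"
  shows "convex_family (X - Y)"
  unfolding convex_family_def
proof (intro conjI ballI allI impI)
  fix \<sigma> \<rho> \<tau> assume *: "\<sigma> \<in> X - Y" "\<rho> \<in> X - Y" "\<sigma> \<subseteq> \<tau>" "\<tau> \<subseteq> \<rho>"
  have "\<tau> \<in> X" using simplicial_complexD(4)[OF assms(1), of \<rho> \<tau>] * by simp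
  moreover have "\<tau> \<notin> Y" using simplicial_complexD(4)[OF assms(2), of \<tau> \<sigma>] * by auto
  ultimately show "\<tau> \<in> X - Y" by simp
qed (use simplicial_complexD(1,3)[OF assms(1)] in auto)

lemma convex_family_complex:
  assumes "simplicial_complex X"
  shows "convex_family X"
  unfolding convex_family_def
proof (intro conjI ballI allI impI)
  fix \<sigma> \<rho> \<tau> assume "\<rho> \<in> X" "\<tau> \<subseteq> \<rho>"
  then show "\<tau> \<in> X" by (rule simplicial_complexD(4)[OF assms])
qed (use simplicial_complexD(1,3)[OF assms] in auto)

lemma acyclic_family_empty: "acyclic_family TYPE('f::field) {}"
  unfolding acyclic_family_def
proof (intro allI impI, elim conjE)
  fix c :: "'a set \<Rightarrow> 'f" assume "supported {} c"
  then have "c = 0" by (auto simp: supported_def)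
  then show "\<exists>e. supported {} e \<and> rel_bdry {} e = c" by (intro exI[of _ 0]) (simp add: supported_def)
qed

lemma rel_bdry_coface_sum:
  fixes z :: "'v::linorder set \<Rightarrow> 'f::field"
  assumes "finite P" "\<tau> \<in> P" "K \<subseteq> P"
    and "\<And>v. v \<notin> \<tau> \<Longrightarrow> insert v \<tau> \<in> P \<Longrightarrow> insert v \<tau> \<notin> K \<Longrightarrow> z (insert v \<tau>) = 0"
  shows "rel_bdry P z \<tau> = (\<Sum>\<kappa>\<in>K. z \<kappa> * oriented_bdry \<kappa> \<tau>)"
proof -
  have "(\<Sum>\<kappa>\<in>P. z \<kappa> * oriented_bdry \<kappa> \<tau>) = (\<Sum>\<kappa>\<in>K. z \<kappa> * oriented_bdry \<kappa> \<tau>)"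
  proof (rule sum.mono_neutral_right)
    show "\<forall>\<kappa>\<in>P - K. z \<kappa> * oriented_bdry \<kappa> \<tau> = 0"
    proof
      fix \<kappa> assume \<kappa>: "\<kappa> \<in> P - K"
      show "z \<kappa> * oriented_bdry \<kappa> \<tau> = 0"
      proof (cases "oriented_bdry \<kappa> \<tau> = (0::'f)")
        case False
        then obtain v where "v \<in> \<kappa>" "\<tau> = \<kappa> - {v}" using oriented_bdry_nonzeroD by blast
        then have "v \<notin> \<tau>" "\<kappa> = insert v \<tau>" by auto
        then show ?thesis using assms(4) \<kappa> by simp
      qed simp
    qed
  qed (use assms in auto)
  then show ?thesis using assms(2) by (simp add: rel_bdry_def)
qed

lemma rel_bdry_outside: "\<tau> \<notin> P \<Longrightarrow> rel_bdry P z \<tau> = 0"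
  by (simp add: rel_bdry_def)

lemma rel_bdry_no_coface:
  fixes z :: "'v::linorder set \<Rightarrow> 'f::field"
  assumes "finite P" "\<And>v. v \<notin> \<tau> \<Longrightarrow> insert v \<tau> \<notin> P"
  shows "rel_bdry P z \<tau> = 0"
proof (cases "\<tau> \<in> P")
  case True
  have "rel_bdry P z \<tau> = (\<Sum>\<kappa>\<in>{}. z \<kappa> * oriented_bdry \<kappa> \<tau>)"
    using assms(1) True by (rule rel_bdry_coface_sum) (use assms(2) in blast)+
  then show ?thesis by simp
qed (simp add: rel_bdry_def)

lemma oriented_bdry_insert_nonzero:
  assumes "finite \<tau>" "v \<notin> \<tau>"
  shows "oriented_bdry (insert v \<tau>) \<tau> \<noteq> (0::'f::field)"
proof -
  have "insert v \<tau> - {v} = \<tau>" using assms by auto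
  then show ?thesis
    using oriented_bdry_facet[of "insert v \<tau>" v, where ?'f = 'f] assms by simp
qed


section \<open>Balls filling a sphere\<close>

text \<open>
A homology ball \<open>\<Delta>\<close> with facets of \<open>N\<close> vertices and with boundary \<open>X\<close>, in a form that survives gluing a
simplex. The first two link conditions say that \<open>\<Delta>\<close> is a manifold with boundary \<open>X\<close> (the empty face
gives the homology of \<open>\<Delta>\<close> itself). The last one describes the interior seen from a boundary face; by
\<open>fundamental_cycle_bdry\<close> it makes \<open>X\<close> a homology sphere, and the non-vanishing of the coefficients says
that no facet can be missing from a fundamental cycle.
\<close>

definition homology_filling :: "'f::field itself \<Rightarrow> nat \<Rightarrow> 'v::linorder set set \<Rightarrow> 'v set set \<Rightarrow> bool" where
  "homology_filling F N \<Delta> X \<longleftrightarrow>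
     simplicial_complex \<Delta> \<and> simplicial_complex X \<and> X \<subseteq> \<Delta> \<and>
     (\<forall>\<sigma>\<in>\<Delta>. \<exists>\<rho>\<in>\<Delta>. \<sigma> \<subseteq> \<rho> \<and> card \<rho> = N) \<and> (\<forall>\<sigma>\<in>\<Delta>. card \<sigma> \<le> N) \<and> (\<forall>\<sigma>\<in>X. card \<sigma> < N) \<and>
     (\<forall>\<sigma>\<in>X. acyclic_family F (local_link \<sigma> \<Delta>)) \<and>
     (\<forall>\<sigma>\<in>\<Delta> - X. \<exists>z::'v set \<Rightarrow> 'f. fundamental_cycle (N - card \<sigma>) (local_link \<sigma> \<Delta>) z) \<and>
     (\<forall>\<sigma>\<in>X. \<exists>z::'v set \<Rightarrow> 'f. fundamental_cycle (N - card \<sigma>) (local_link \<sigma> (\<Delta> - X)) z \<and>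
        (\<forall>\<tau>\<in>local_link \<sigma> \<Delta>. card \<tau> = N - card \<sigma> \<longrightarrow> z \<tau> \<noteq> 0))"

lemma homology_fillingD:
  fixes \<Delta> X :: "'v::linorder set set"
  assumes "homology_filling TYPE('f::field) N \<Delta> X"
  shows "simplicial_complex \<Delta>" "simplicial_complex X" "X \<subseteq> \<Delta>"
    "\<sigma> \<in> \<Delta> \<Longrightarrow> \<exists>\<rho>\<in>\<Delta>. \<sigma> \<subseteq> \<rho> \<and> card \<rho> = N" "\<sigma> \<in> \<Delta> \<Longrightarrow> card \<sigma> \<le> N" "\<sigma> \<in> X \<Longrightarrow> card \<sigma> < N"
    "\<sigma> \<in> X \<Longrightarrow> acyclic_family TYPE('f) (local_link \<sigma> \<Delta>)"
    "\<sigma> \<in> \<Delta> \<Longrightarrow> \<sigma> \<notin> X \<Longrightarrow> \<exists>z::'v set \<Rightarrow> 'f. fundamental_cycle (N - card \<sigma>) (local_link \<sigma> \<Delta>) z"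
    "\<sigma> \<in> X \<Longrightarrow> \<exists>z::'v set \<Rightarrow> 'f. fundamental_cycle (N - card \<sigma>) (local_link \<sigma> (\<Delta> - X)) z \<and>
        (\<forall>\<tau>\<in>local_link \<sigma> \<Delta>. card \<tau> = N - card \<sigma> \<longrightarrow> z \<tau> \<noteq> 0)"
  using assms unfolding homology_filling_def by blast+

lemma homology_fillingI:
  fixes \<Delta> X :: "'v::linorder set set"
  assumes "simplicial_complex \<Delta>" "simplicial_complex X" "X \<subseteq> \<Delta>"
    "\<And>\<sigma>. \<sigma> \<in> \<Delta> \<Longrightarrow> \<exists>\<rho>\<in>\<Delta>. \<sigma> \<subseteq> \<rho> \<and> card \<rho> = N" "\<And>\<sigma>. \<sigma> \<in> \<Delta> \<Longrightarrow> card \<sigma> \<le> N"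
    "\<And>\<sigma>. \<sigma> \<in> X \<Longrightarrow> card \<sigma> < N"
    "\<And>\<sigma>. \<sigma> \<in> X \<Longrightarrow> acyclic_family TYPE('f::field) (local_link \<sigma> \<Delta>)"
    "\<And>\<sigma>. \<sigma> \<in> \<Delta> - X \<Longrightarrow> \<exists>z::'v set \<Rightarrow> 'f. fundamental_cycle (N - card \<sigma>) (local_link \<sigma> \<Delta>) z"
    "\<And>\<sigma>. \<sigma> \<in> X \<Longrightarrow> \<exists>z::'v set \<Rightarrow> 'f. fundamental_cycle (N - card \<sigma>) (local_link \<sigma> (\<Delta> - X)) z \<and>
        (\<forall>\<tau>\<in>local_link \<sigma> \<Delta>. card \<tau> = N - card \<sigma> \<longrightarrow> z \<tau> \<noteq> 0)"
  shows "homology_filling TYPE('f::field) N \<Delta> X"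
  unfolding homology_filling_def by (intro conjI ballI assms)

lemma filling_splits:
  assumes "simplicial_complex \<Delta>" "simplicial_complex X" "X \<subseteq> \<Delta>"
  shows "splits_as \<Delta> X (\<Delta> - X)"
  unfolding splits_as_def
proof (intro conjI ballI notI)
  show "convex_family \<Delta>" using assms(1) by (rule convex_family_complex)
  fix \<sigma> \<tau> assume "\<sigma> \<in> X" "\<tau> \<in> \<Delta> - X" "\<tau> \<subseteq> \<sigma>"
  then show False using simplicial_complexD(4)[OF assms(2), of \<sigma> \<tau>] by simp
qed (use assms(3) in auto)

text \<open>
The link of a boundary ridge is acyclic and at most zero-dimensional, hence a point.
\<close>

lemma unique_facet_above_ridge:
  assumes fil: "homology_filling TYPE('f::field) N \<Delta> (X :: 'v::linorder set set)"
    and \<rho>: "\<rho> \<in> X" "Suc (card \<rho>) = N"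
  obtains u where "u \<notin> \<rho>" "insert u \<rho> \<in> \<Delta>" "\<And>w. w \<notin> \<rho> \<Longrightarrow> insert w \<rho> \<in> \<Delta> \<Longrightarrow> w = u"
proof -
  note D = homology_fillingD[OF fil]
  have fin: "finite \<rho>" using simplicial_complexD(3)[OF D(2)] \<rho> by blast
  obtain \<kappa> where \<kappa>: "\<kappa> \<in> \<Delta>" "\<rho> \<subseteq> \<kappa>" "card \<kappa> = N" using D(3,4) \<rho>(1) by blast
  have "card (\<kappa> - \<rho>) = 1" using \<kappa> \<rho>(2) fin by (simp add: card_Diff_subset)
  then obtain u where "\<kappa> - \<rho> = {u}" using card_1_singletonE by blast
  then have u: "u \<notin> \<rho>" "\<kappa> = insert u \<rho>" using \<kappa> by auto
  have "w = u" if w: "w \<notin> \<rho>" "insert w \<rho> \<in> \<Delta>" for w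
  proof (rule ccontr)
    assume ne: "w \<noteq> u"
    let ?L = "local_link \<rho> \<Delta>"
    have L: "convex_family ?L" by (intro convex_family_local_link convex_family_complex D(1))
    have inL: "{} \<in> ?L" "{u} \<in> ?L" "{w} \<in> ?L"
      using \<rho> D(3) u w \<kappa>(1) by auto
    have le1: "card \<tau> \<le> 1" if "\<tau> \<in> ?L" for \<tau>
    proof -
      have "card (\<tau> \<union> \<rho>) \<le> N" using D(5) that by simp
      then show ?thesis using that fin convex_familyD(2)[OF L that] \<rho>(2) by (simp add: card_Un_disjoint)
    qed
    \<comment> \<open>Two points in the link would make their difference a cycle that nothing bounds.\<close>
    define c where "c = (\<lambda>\<sigma>. if \<sigma> = {u} then 1 else if \<sigma> = {w} then - 1 else (0::'f))"
    have ob1: "oriented_bdry {x} {} = (1::'f)" for x :: 'v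
    proof -
      have "{w \<in> {x}. w < x} = {}" by auto
      then show ?thesis using oriented_bdry_facet[of "{x}" x, where ?'f = 'f] by (simp only:) simp
    qed
    have no_coface: "rel_bdry ?L e \<tau> = 0" if "\<tau> \<noteq> {}" for e :: "'v set \<Rightarrow> 'f" and \<tau>
    proof (cases "\<tau> \<in> ?L")
      case True
      have "insert v \<tau> \<notin> ?L" if "v \<notin> \<tau>" for v
      proof
        assume "insert v \<tau> \<in> ?L"
        then have "card (insert v \<tau>) \<le> 1" by (rule le1)
        then show False
          using that \<open>\<tau> \<noteq> {}\<close> convex_familyD(2)[OF L True] by simp
      qed
      then show ?thesis
        by (rule rel_bdry_no_coface[OF convex_familyD(1)[OF L]])
    qed (rule rel_bdry_outside)
    have "rel_bdry ?L c = 0"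
    proof
      fix \<tau>
      show "rel_bdry ?L c \<tau> = 0 \<tau>"
      proof (cases "\<tau> = {}")
        case True
        have "rel_bdry ?L c {} = (\<Sum>\<kappa>\<in>{{u}, {w}}. c \<kappa> * oriented_bdry \<kappa> {})"
          using convex_familyD(1)[OF L] inL by (intro rel_bdry_coface_sum) (auto simp: c_def)
        also have "\<dots> = 0" using ne by (simp add: c_def ob1)
        finally show ?thesis using True by simp
      qed (simp add: no_coface)
    qed
    moreover have "supported ?L c" using inL by (auto simp: supported_def c_def)
    ultimately obtain e where "rel_bdry ?L e = c" using acyclic_familyD[OF D(7)[OF \<rho>(1)]] by blast
    then have "c {u} = 0" using no_coface[of "{u}" e] by simp
    then show False by (simp add: c_def)
  qed
  then show ?thesis using that u \<kappa>(1) by blast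
qed

text \<open>
The boundary of the fundamental cycle of the interior generates the homology of the link in \<open>X\<close>. Its
coefficients do not vanish because each ridge of \<open>X\<close> lies in a single facet of \<open>\<Delta>\<close>, so that nothing
cancels.
\<close>

lemma boundary_link_cycle:
  fixes \<Delta> X :: "'v::linorder set set"
  assumes fil: "homology_filling TYPE('f::field) N \<Delta> X"
    and \<sigma>: "\<sigma> \<in> X"
  obtains x :: "'v set \<Rightarrow> 'f::field" where
    "fundamental_cycle (N - 1 - card \<sigma>) (local_link \<sigma> X) x"
    "\<And>\<tau>. \<tau> \<in> local_link \<sigma> X \<Longrightarrow> card \<tau> = N - 1 - card \<sigma> \<Longrightarrow> x \<tau> \<noteq> 0"
proof -
  note D = homology_fillingD[OF fil]
  have less: "card \<sigma> < N" and fin: "finite \<sigma>" using D(6) simplicial_complexD(3)[OF D(2)] \<sigma> by blast+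
  then have N: "N - card \<sigma> = Suc (N - 1 - card \<sigma>)" by simp
  obtain z :: "'v set \<Rightarrow> 'f" where z: "fundamental_cycle (Suc (N - 1 - card \<sigma>)) (local_link \<sigma> (\<Delta> - X)) z"
    and full: "\<And>\<tau>. \<tau> \<in> local_link \<sigma> \<Delta> \<Longrightarrow> card \<tau> = N - card \<sigma> \<Longrightarrow> z \<tau> \<noteq> 0"
    using D(9)[OF \<sigma>] unfolding N by blast
  let ?L = "local_link \<sigma> \<Delta>"
  have L: "convex_family ?L" by (intro convex_family_local_link convex_family_complex D(1))
  have "fundamental_cycle (N - 1 - card \<sigma>) (local_link \<sigma> X) (rel_bdry ?L z)"
    using splits_as_local_link[OF filling_splits[OF D(1-3)]] D(7)[OF \<sigma>] z by (rule fundamental_cycle_bdry)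
  moreover have "rel_bdry ?L z \<tau> \<noteq> 0" if \<tau>: "\<tau> \<in> local_link \<sigma> X" "card \<tau> = N - 1 - card \<sigma>" for \<tau>
  proof -
    have \<tau>L: "\<tau> \<in> ?L" using \<tau>(1) D(3) by auto
    have fint: "finite \<tau>" using convex_familyD(2)[OF L \<tau>L] .
    have "\<tau> \<union> \<sigma> \<in> X" "Suc (card (\<tau> \<union> \<sigma>)) = N"
      using \<tau> less fin fint by (auto simp: card_Un_disjoint)
    then obtain u where u: "u \<notin> \<tau> \<union> \<sigma>" "insert u (\<tau> \<union> \<sigma>) \<in> \<Delta>"
      "\<And>w. w \<notin> \<tau> \<union> \<sigma> \<Longrightarrow> insert w (\<tau> \<union> \<sigma>) \<in> \<Delta> \<Longrightarrow> w = u"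
      using unique_facet_above_ridge[OF fil] by metis
    have uL: "insert u \<tau> \<in> ?L" using u(1,2) \<tau>(1) by auto
    have "rel_bdry ?L z \<tau> = (\<Sum>\<kappa>\<in>{insert u \<tau>}. z \<kappa> * oriented_bdry \<kappa> \<tau>)"
      using convex_familyD(1)[OF L] \<tau>L uL
    proof (rule rel_bdry_coface_sum[OF _ _ insert_subsetI[OF _ empty_subsetI]])
      fix v assume v: "v \<notin> \<tau>" "insert v \<tau> \<in> ?L" "insert v \<tau> \<notin> {insert u \<tau>}"
      then have "v = u" using u(3)[of v] by auto
      then show "z (insert v \<tau>) = 0" using v by simp
    qed
    moreover have "z (insert u \<tau>) \<noteq> 0"
      using full[OF uL] u(1) fint \<tau>(2) N by simp
    ultimately show ?thesis using oriented_bdry_insert_nonzero[OF fint, of u] u(1) by simp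
  qed
  ultimately show ?thesis using that by blast
qed

lemma fundamental_cycle_supportD:
  assumes "fundamental_cycle m P z"
  shows "\<exists>\<sigma>\<in>P. card \<sigma> = m"
proof (rule ccontr)
  assume "\<not> ?thesis"
  then have "z = 0" using assms unfolding fundamental_cycle_def supported_def fun_eq_iff by fastforce
  moreover have "rel_bdry P 0 = (0 :: 'a set \<Rightarrow> 'b)" "supported P (0 :: 'a set \<Rightarrow> 'b)"
    by (auto simp: supported_def)
  ultimately show False using assms unfolding fundamental_cycle_def by blast
qed

text \<open>
A complex with the homology of a sphere of some dimension has a face of that dimension.
\<close>

lemma boundary_pure:
  assumes fil: "homology_filling TYPE('f::field) N \<Delta> (X :: 'v::linorder set set)"
    and \<sigma>: "\<sigma> \<in> X"
  obtains \<rho> where "\<rho> \<in> X" "\<sigma> \<subseteq> \<rho>" "card \<rho> = N - 1"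
proof -
  note D = homology_fillingD[OF fil]
  obtain x :: "'v set \<Rightarrow> 'f" where "fundamental_cycle (N - 1 - card \<sigma>) (local_link \<sigma> X) x"
    using boundary_link_cycle[OF fil \<sigma>] by blast
  then obtain \<tau> where \<tau>: "\<tau> \<in> local_link \<sigma> X" "card \<tau> = N - 1 - card \<sigma>"
    using fundamental_cycle_supportD by blast
  have "finite \<tau>" "finite \<sigma>" "card \<sigma> < N"
    using simplicial_complexD(3)[OF D(2), of "\<tau> \<union> \<sigma>"] \<tau> D(6)[OF \<sigma>] by auto
  then have "card (\<tau> \<union> \<sigma>) = N - 1" using \<tau> by (simp add: card_Un_disjoint)
  then show ?thesis using that[of "\<tau> \<union> \<sigma>"] \<tau> by auto
qed

lemma fundamental_cycle_simplex_bdry: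
  fixes b :: "'v::linorder set"
  assumes "finite b" "b \<noteq> {}"
  obtains w :: "'v set \<Rightarrow> 'f::field" where
    "fundamental_cycle (card b - 1) {\<tau>. \<tau> \<subset> b} w"
proof -
  have P: "convex_family {\<tau>. \<tau> \<subseteq> b}"
    by (rule convex_family_complex) (use assms in \<open>auto simp: simplicial_complex_def intro: finite_subset\<close>)
  have "splits_as {\<tau>. \<tau> \<subseteq> b} {\<tau>. \<tau> \<subset> b} {b}"
    unfolding splits_as_def using P by blast
  moreover have "acyclic_family TYPE('f) {\<tau>. \<tau> \<subseteq> b}"
    using acyclic_family_interval[of b "{}", where ?'f = 'f] assms by auto
  moreover have "fundamental_cycle (Suc (card b - 1)) {b} (\<lambda>\<tau>. if \<tau> = b then 1 else (0::'f))"
    using fundamental_cycle_singleton[OF assms(1), where ?'f = 'f] assms by (simp add: card_gt_0_iff)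
  ultimately show ?thesis using fundamental_cycle_bdry that by blast
qed

text \<open>
The link of \<open>\<alpha>\<close> in \<open>X\<close> contains the sphere \<open>\<partial>\<beta>\<close> of its own dimension. The fundamental cycle of \<open>\<partial>\<beta>\<close> is a
non-zero multiple of the one of the link, and the latter involves every facet; so the link equals \<open>\<partial>\<beta>\<close>.
This is what makes the result of a bistellar move a simplicial complex.
\<close>

lemma boundary_link_rigid:
  assumes fil: "homology_filling TYPE('f::field) N \<Delta> (X :: 'v::linorder set set)"
    and fin: "finite \<alpha>" "finite \<beta>" "\<beta> \<noteq> {}" "\<alpha> \<inter> \<beta> = {}" "card \<alpha> + card \<beta> = N"
    and ind: "\<And>\<sigma>. \<sigma> \<subseteq> \<alpha> \<union> \<beta> \<Longrightarrow> \<sigma> \<in> X \<longleftrightarrow> \<not> \<beta> \<subseteq> \<sigma>"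
    and \<sigma>: "\<sigma> \<in> X" "\<alpha> \<subseteq> \<sigma>"
  shows "\<sigma> \<subseteq> \<alpha> \<union> \<beta>"
proof -
  note D = homology_fillingD[OF fil]
  let ?L = "local_link \<alpha> X"
  have L: "convex_family ?L" by (intro convex_family_local_link convex_family_complex D(2))
  have \<alpha>X: "\<alpha> \<in> X" using ind[of \<alpha>] fin by blast
  have m: "N - 1 - card \<alpha> = card \<beta> - 1" using fin by simp
  obtain x :: "'v set \<Rightarrow> 'f" where x: "fundamental_cycle (card \<beta> - 1) ?L x"
    and full: "\<And>\<tau>. \<tau> \<in> ?L \<Longrightarrow> card \<tau> = card \<beta> - 1 \<Longrightarrow> x \<tau> \<noteq> 0"
    using boundary_link_cycle[OF fil \<alpha>X] unfolding m by blast
  obtain w :: "'v set \<Rightarrow> 'f" where w: "fundamental_cycle (card \<beta> - 1) {\<tau>. \<tau> \<subset> \<beta>} w"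
    using fundamental_cycle_simplex_bdry fin by blast
  have sub: "{\<tau>. \<tau> \<subset> \<beta>} \<subseteq> ?L"
  proof
    fix \<tau> assume "\<tau> \<in> {\<tau>. \<tau> \<subset> \<beta>}"
    then have \<tau>: "\<tau> \<subset> \<beta>" by simp
    then have "\<tau> \<inter> \<alpha> = {}" "\<tau> \<union> \<alpha> \<subseteq> \<alpha> \<union> \<beta>" "\<not> \<beta> \<subseteq> \<tau> \<union> \<alpha>" using fin(4) by blast+
    then show "\<tau> \<in> ?L" using ind[of "\<tau> \<union> \<alpha>"] by simp
  qed
  have spl: "splits_as ?L {\<tau>. \<tau> \<subset> \<beta>} (?L - {\<tau>. \<tau> \<subset> \<beta>})"
    unfolding splits_as_def using L sub by blast
  have wsup: "supported {\<tau>. \<tau> \<subset> \<beta>} w" and wtop: "\<And>\<sigma>. w \<sigma> \<noteq> 0 \<Longrightarrow> card \<sigma> = card \<beta> - 1"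
    and wcyc: "rel_bdry {\<tau>. \<tau> \<subset> \<beta>} w = 0"
    and wne: "\<nexists>e. supported {\<tau>. \<tau> \<subset> \<beta>} e \<and> rel_bdry {\<tau>. \<tau> \<subset> \<beta>} e = w"
    using w unfolding fundamental_cycle_def by blast+
  have "rel_bdry ?L w = 0" using rel_bdry_lower[OF spl wsup] wcyc by simp
  moreover have "supported ?L w" using supported_mono[OF wsup sub] .
  ultimately obtain a e where ae: "w = chain_scale a x + rel_bdry ?L e"
    using x unfolding fundamental_cycle_def by blast
  have small: "card \<tau> \<le> card \<beta> - 1" if "\<tau> \<in> ?L" for \<tau>
  proof -
    have "card (\<tau> \<union> \<alpha>) < N" using D(6) that by simp
    then show ?thesis using that fin convex_familyD(2)[OF L that] by (simp add: card_Un_disjoint)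
  qed
  \<comment> \<open>In the top degree there are no boundaries, so the relation between \<open>w\<close> and \<open>x\<close> is exact there.\<close>
  have top: "w \<tau> = a * x \<tau>" if \<tau>: "card \<tau> = card \<beta> - 1" for \<tau>
  proof -
    have "rel_bdry ?L e \<tau> = 0"
    proof (cases "\<tau> \<in> ?L")
      case True
      have "insert v \<tau> \<notin> ?L" if "v \<notin> \<tau>" for v
      proof
        assume "insert v \<tau> \<in> ?L"
        then have "card (insert v \<tau>) \<le> card \<beta> - 1" by (rule small)
        then show False
          using that \<tau> convex_familyD(2)[OF L True] by simp
      qed
      then show ?thesis
        by (rule rel_bdry_no_coface[OF convex_familyD(1)[OF L]])
    qed (rule rel_bdry_outside)
    then show ?thesis using fun_cong[OF ae, of \<tau>] by (simp add: chain_scale_def)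
  qed
  have "a \<noteq> 0"
  proof
    assume "a = 0"
    then have "w \<tau> = 0" for \<tau> using top[of \<tau>] wtop[of \<tau>] by (cases "w \<tau> = 0") simp_all
    then have "w = 0" by (simp add: fun_eq_iff)
    moreover have "supported {\<tau>. \<tau> \<subset> \<beta>} (0 :: 'v set \<Rightarrow> 'f)" by (simp add: supported_def)
    ultimately show False using wne rel_bdry_zero by blast
  qed
  obtain \<rho> where \<rho>: "\<rho> \<in> X" "\<sigma> \<subseteq> \<rho>" "card \<rho> = N - 1" using boundary_pure[OF fil \<sigma>(1)] by blast
  define \<tau> where "\<tau> = \<rho> - \<alpha>"
  have "\<tau> \<union> \<alpha> = \<rho>" using \<rho> \<sigma> by (auto simp: \<tau>_def)
  then have \<tau>L: "\<tau> \<in> ?L" using \<rho> by (auto simp: \<tau>_def)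
  have "card \<tau> = card \<beta> - 1" using \<rho> \<sigma> fin by (simp add: \<tau>_def card_Diff_subset)
  then have "w \<tau> \<noteq> 0" using top full \<tau>L \<open>a \<noteq> 0\<close> by simp
  then have "\<tau> \<subset> \<beta>" using wsup by (auto simp: supported_def)
  then show ?thesis using \<rho>(2) by (auto simp: \<tau>_def)
qed


section \<open>Gluing a simplex to a ball\<close>

lemma homology_filling_simplex:
  fixes b :: "'v::linorder set"
  assumes fin: "finite b" and ne: "b \<noteq> {}"
  shows "homology_filling TYPE('f::field) (card b) {\<sigma>. \<sigma> \<subseteq> b} {\<sigma>. \<sigma> \<subset> b}"
proof (rule homology_fillingI)
  show "simplicial_complex {\<sigma>. \<sigma> \<subseteq> b}"
    using fin by (auto simp: simplicial_complex_def intro: finite_subset)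
  have "finite {\<sigma>. \<sigma> \<subset> b}" using fin by (auto intro: finite_subset[of _ "Pow b"])
  then show "simplicial_complex {\<sigma>. \<sigma> \<subset> b}"
    using fin ne by (auto simp: simplicial_complex_def intro: finite_subset)
  have eq: "{\<sigma>. \<sigma> \<subseteq> b} - {\<sigma>. \<sigma> \<subset> b} = {b}" by auto
  have ll: "local_link \<sigma> {\<sigma>. \<sigma> \<subseteq> b} = {\<tau>. {} \<subseteq> \<tau> \<and> \<tau> \<subseteq> b - \<sigma>}" if "\<sigma> \<subseteq> b" for \<sigma>
    using local_link_interval[OF that, of "{}"] by simp
  have llb: "local_link \<sigma> {b} = {b - \<sigma>}" if "\<sigma> \<subseteq> b" for \<sigma>
    using that unfolding local_link_def by blast
  show "acyclic_family TYPE('f) (local_link \<sigma> {\<sigma>. \<sigma> \<subseteq> b})" if "\<sigma> \<in> {\<sigma>. \<sigma> \<subset> b}" for \<sigma>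
  proof -
    have "\<sigma> \<subseteq> b" "{} \<subset> b - \<sigma>" using that by auto
    then show ?thesis using acyclic_family_interval[of "b - \<sigma>" "{}", where ?'f = 'f] fin ll by simp
  qed
  show "\<exists>z::'v set \<Rightarrow> 'f. fundamental_cycle (card b - card \<sigma>) (local_link \<sigma> {\<sigma>. \<sigma> \<subseteq> b}) z"
    if "\<sigma> \<in> {\<sigma>. \<sigma> \<subseteq> b} - {\<sigma>. \<sigma> \<subset> b}" for \<sigma>
  proof -
    have "\<sigma> = b" using that by auto
    then have "local_link \<sigma> {\<sigma>. \<sigma> \<subseteq> b} = {{}}" using ll by auto
    then show ?thesis
      using fundamental_cycle_singleton[of "{} :: 'v set", where ?'f = 'f] \<open>\<sigma> = b\<close> by auto
  qed
  show "\<exists>z::'v set \<Rightarrow> 'f. fundamental_cycle (card b - card \<sigma>) (local_link \<sigma> ({\<sigma>. \<sigma> \<subseteq> b} - {\<sigma>. \<sigma> \<subset> b})) z \<and>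
      (\<forall>\<tau>\<in>local_link \<sigma> {\<sigma>. \<sigma> \<subseteq> b}. card \<tau> = card b - card \<sigma> \<longrightarrow> z \<tau> \<noteq> 0)"
    if "\<sigma> \<in> {\<sigma>. \<sigma> \<subset> b}" for \<sigma>
  proof -
    have sub: "\<sigma> \<subseteq> b" using that by auto
    have c: "card (b - \<sigma>) = card b - card \<sigma>" using fin sub by (simp add: card_Diff_subset finite_subset)
    have "fundamental_cycle (card b - card \<sigma>) {b - \<sigma>} (\<lambda>\<tau>. if \<tau> = b - \<sigma> then 1 else (0::'f))"
      using fundamental_cycle_singleton[of "b - \<sigma>", where ?'f = 'f] fin c by simp
    moreover have "\<tau> = b - \<sigma>" if "\<tau> \<in> local_link \<sigma> {\<sigma>. \<sigma> \<subseteq> b}" "card \<tau> = card b - card \<sigma>" for \<tau>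
    proof (rule card_subset_eq)
      show "\<tau> \<subseteq> b - \<sigma>" using that by auto
    qed (use that c fin in auto)
    ultimately show ?thesis
      unfolding eq llb[OF sub] by (intro exI[of _ "\<lambda>\<tau>. if \<tau> = b - \<sigma> then 1 else 0"]) simp
  qed
qed (use fin in \<open>auto intro: card_mono psubset_card_mono\<close>)

text \<open>
The bistellar move \<open>\<alpha> \<mapsto> \<beta>\<close> on the boundary is the effect of gluing the simplex on \<open>\<alpha> \<union> \<beta>\<close> to the ball.
The ball grows by the interval from \<open>\<beta>\<close> to \<open>\<alpha> \<union> \<beta>\<close> and its interior by the interval from \<open>\<alpha>\<close> to
\<open>\<alpha> \<union> \<beta>\<close>. In every link such an interval is empty, a single face or acyclic, so the long exact sequences
above determine all the new homology.
\<close>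

lemma homology_filling_glue_simplex:
  fixes \<Delta> X :: "'v::linorder set set" and \<alpha> \<beta> :: "'v set"
  assumes fil: "homology_filling TYPE('f::field) N \<Delta> X"
    and fin: "finite \<alpha>" "finite \<beta>" "\<alpha> \<noteq> {}" "\<beta> \<noteq> {}" "\<alpha> \<inter> \<beta> = {}" "card \<alpha> + card \<beta> = N"
    and ind: "\<And>\<sigma>. \<sigma> \<subseteq> \<alpha> \<union> \<beta> \<Longrightarrow> \<sigma> \<in> X \<longleftrightarrow> \<not> \<beta> \<subseteq> \<sigma>"
    and new: "\<beta> \<notin> \<Delta>"
  shows "homology_filling TYPE('f) N (\<Delta> \<union> {\<sigma>. \<beta> \<subseteq> \<sigma> \<and> \<sigma> \<subseteq> \<alpha> \<union> \<beta>})
     ((X - {\<sigma>. \<alpha> \<subseteq> \<sigma> \<and> \<sigma> \<subseteq> \<alpha> \<union> \<beta>}) \<union> {\<sigma>. \<beta> \<subseteq> \<sigma> \<and> \<sigma> \<subset> \<alpha> \<union> \<beta>})"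
proof -
  note D = homology_fillingD[OF fil]
  define C A B where CAB: "C = \<alpha> \<union> \<beta>" "A = {\<sigma>. \<alpha> \<subseteq> \<sigma> \<and> \<sigma> \<subseteq> C}" "B = {\<sigma>. \<beta> \<subseteq> \<sigma> \<and> \<sigma> \<subseteq> C}"
  define \<Delta>' Y where \<Delta>'Y: "\<Delta>' = \<Delta> \<union> B" "Y = {\<sigma> \<in> X. \<not> \<alpha> \<subseteq> \<sigma>} \<union> (B - {C})"
  have rigid: "\<sigma> \<subseteq> \<alpha> \<union> \<beta>" if "\<sigma> \<in> X" "\<alpha> \<subseteq> \<sigma>" for \<sigma>
    by (rule boundary_link_rigid[OF fil fin(1,2,4,5,6) _ that]) (rule ind)
  \<comment> \<open>Rigidity: every face of the boundary above \<open>\<alpha>\<close> lies in the glued simplex, so all of them disappear.\<close>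
  have Yeq: "(X - {\<sigma>. \<alpha> \<subseteq> \<sigma> \<and> \<sigma> \<subseteq> \<alpha> \<union> \<beta>}) \<union> {\<sigma>. \<beta> \<subseteq> \<sigma> \<and> \<sigma> \<subset> \<alpha> \<union> \<beta>} = Y"
  proof -
    have "X - {\<sigma>. \<alpha> \<subseteq> \<sigma> \<and> \<sigma> \<subseteq> \<alpha> \<union> \<beta>} = {\<sigma> \<in> X. \<not> \<alpha> \<subseteq> \<sigma>}" using rigid by blast
    moreover have "{\<sigma>. \<beta> \<subseteq> \<sigma> \<and> \<sigma> \<subset> \<alpha> \<union> \<beta>} = B - {C}" by (auto simp: CAB)
    ultimately show ?thesis by (simp add: \<Delta>'Y)
  qed
  have finC: "finite C" and cardC: "card C = N" using fin by (auto simp: CAB card_Un_disjoint)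
  have finB: "finite B" using finC by (simp add: CAB)
  have \<beta>sub: "\<not> \<beta> \<subseteq> \<sigma>" if "\<sigma> \<in> \<Delta>" for \<sigma>
    using that new simplicial_complexD(4)[OF D(1)] by blast
  have B_new: "\<sigma> \<notin> \<Delta>" if "\<sigma> \<in> B" for \<sigma> using that \<beta>sub by (auto simp: CAB)
  have in_X: "\<sigma> \<in> X" if "\<sigma> \<subseteq> C" "\<not> \<beta> \<subseteq> \<sigma>" for \<sigma> using ind that by (simp add: CAB)
  have CB: "C \<in> B" "C \<in> A" "C \<notin> \<Delta>" using B_new[of C] by (auto simp: CAB)
  have Delta': "simplicial_complex \<Delta>'"
    unfolding simplicial_complex_def
  proof (intro conjI ballI allI impI)
    show "finite \<Delta>'" using simplicial_complexD(1)[OF D(1)] finB by (simp add: \<Delta>'Y)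
    show "{} \<in> \<Delta>'" using simplicial_complexD(2)[OF D(1)] by (simp add: \<Delta>'Y)
    fix \<sigma> assume \<sigma>: "\<sigma> \<in> \<Delta>'"
    then show "finite \<sigma>"
      using simplicial_complexD(3)[OF D(1)] finC finite_subset[of \<sigma> C] by (auto simp: \<Delta>'Y CAB(3))
    fix \<tau> assume \<tau>: "\<tau> \<subseteq> \<sigma>"
    show "\<tau> \<in> \<Delta>'"
    proof (cases "\<sigma> \<in> \<Delta>")
      case True
      then show ?thesis using simplicial_complexD(4)[OF D(1) True \<tau>] by (simp add: \<Delta>'Y)
    next
      case False
      then have "\<tau> \<subseteq> C" using \<sigma> \<tau> by (auto simp: \<Delta>'Y CAB)
      then have "\<tau> \<in> X \<or> \<tau> \<in> B" using in_X by (auto simp: CAB(3))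
      then show ?thesis using D(3) by (auto simp: \<Delta>'Y)
    qed
  qed
  have Y: "simplicial_complex Y"
    unfolding simplicial_complex_def
  proof (intro conjI ballI allI impI)
    show "finite Y" using simplicial_complexD(1)[OF D(2)] finB by (simp add: \<Delta>'Y)
    show "{} \<in> Y" using simplicial_complexD(2)[OF D(2)] fin(3) by (simp add: \<Delta>'Y)
    fix \<sigma> assume \<sigma>: "\<sigma> \<in> Y"
    then show "finite \<sigma>"
      using simplicial_complexD(3)[OF D(2)] finC finite_subset[of \<sigma> C] by (auto simp: \<Delta>'Y CAB(3))
    fix \<tau> assume \<tau>: "\<tau> \<subseteq> \<sigma>"
    show "\<tau> \<in> Y"
    proof (cases "\<sigma> \<in> B - {C}")
      case False
      then have "\<sigma> \<in> X" "\<not> \<alpha> \<subseteq> \<sigma>" using \<sigma> by (auto simp: \<Delta>'Y)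
      then have "\<tau> \<in> X" "\<not> \<alpha> \<subseteq> \<tau>" using simplicial_complexD(4)[OF D(2) _ \<tau>] \<tau> by blast+
      then show ?thesis by (simp add: \<Delta>'Y)
    next
      case True
      then have s: "\<beta> \<subseteq> \<sigma>" "\<sigma> \<subset> C" by (auto simp: CAB)
      show ?thesis
      proof (cases "\<beta> \<subseteq> \<tau>")
        case True
        then show ?thesis using s \<tau> by (auto simp: \<Delta>'Y CAB(3))
      next
        case False
        then have "\<tau> \<in> X" using s \<tau> in_X by blast
        moreover have "\<not> \<alpha> \<subseteq> \<tau>" using s \<tau> by (auto simp: CAB(1))
        ultimately show ?thesis by (simp add: \<Delta>'Y)
      qed
    qed
  qed
  have YD: "Y \<subseteq> \<Delta>'" using D(3) by (auto simp: \<Delta>'Y)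
  have Int': "\<Delta>' - Y = A \<union> (\<Delta> - X)"
  proof (intro set_eqI iffI)
    fix \<sigma> assume \<sigma>: "\<sigma> \<in> \<Delta>' - Y"
    show "\<sigma> \<in> A \<union> (\<Delta> - X)"
    proof (cases "\<sigma> \<in> X")
      case True
      then have "\<alpha> \<subseteq> \<sigma>" using \<sigma> by (auto simp: \<Delta>'Y)
      then show ?thesis using rigid[OF True] by (simp add: CAB)
    next
      case False
      then show ?thesis using \<sigma> CB by (auto simp: \<Delta>'Y)
    qed
  next
    fix \<sigma> assume \<sigma>: "\<sigma> \<in> A \<union> (\<Delta> - X)"
    show "\<sigma> \<in> \<Delta>' - Y"
    proof (cases "\<sigma> \<in> A")
      case True
      then have s: "\<alpha> \<subseteq> \<sigma>" "\<sigma> \<subseteq> C" by (auto simp: CAB)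
      show ?thesis
      proof (cases "\<beta> \<subseteq> \<sigma>")
        case True
        then have "\<sigma> = C" using s by (auto simp: CAB(1))
        then show ?thesis using CB D(3) by (auto simp: \<Delta>'Y)
      next
        case False
        then have "\<sigma> \<in> X" using s in_X by blast
        then show ?thesis using s D(3) False by (auto simp: \<Delta>'Y CAB(3))
      qed
    next
      case False
      then have "\<sigma> \<in> \<Delta>" "\<sigma> \<notin> X" using \<sigma> by auto
      then show ?thesis using B_new[of \<sigma>] by (auto simp: \<Delta>'Y)
    qed
  qed
  have A_sep: "\<not> \<tau> \<subseteq> \<sigma>" if "\<sigma> \<subseteq> C" "\<tau> \<in> \<Delta> - X" for \<sigma> \<tau>
  proof
    assume "\<tau> \<subseteq> \<sigma>"
    then have "\<tau> \<subseteq> C" "\<not> \<beta> \<subseteq> \<tau>" using that \<beta>sub by auto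
    then show False using in_X that by blast
  qed
  \<comment> \<open>In the new ball the old one is a lower part; in the new interior, however, the old interior is
    the upper part, since the simplex is attached from outside.\<close>
  have split1: "splits_as \<Delta>' \<Delta> B"
    unfolding splits_as_def
  proof (intro conjI ballI)
    show "convex_family \<Delta>'" using Delta' by (rule convex_family_complex)
    show "\<Delta>' = \<Delta> \<union> B" by (simp add: \<Delta>'Y)
    show "\<Delta> \<inter> B = {}" using B_new by auto
    fix \<sigma> \<tau> assume "\<sigma> \<in> \<Delta>" "\<tau> \<in> B"
    then show "\<not> \<tau> \<subseteq> \<sigma>" using \<beta>sub[of \<sigma>] by (auto simp: CAB(3))
  qed
  have split2: "splits_as (\<Delta>' - Y) A (\<Delta> - X)"
    unfolding splits_as_def
  proof (intro conjI ballI)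
    show "convex_family (\<Delta>' - Y)" using Delta' Y by (rule convex_family_diff)
    show "\<Delta>' - Y = A \<union> (\<Delta> - X)" by (rule Int')
    have "\<sigma> \<subseteq> C" if "\<sigma> \<in> A" for \<sigma> using that by (simp add: CAB)
    then show "A \<inter> (\<Delta> - X) = {}" "\<And>\<sigma> \<tau>. \<sigma> \<in> A \<Longrightarrow> \<tau> \<in> \<Delta> - X \<Longrightarrow> \<not> \<tau> \<subseteq> \<sigma>"
      using A_sep by blast+
  qed
  have linkB: "local_link \<sigma> B = {\<tau>. \<beta> - \<sigma> \<subseteq> \<tau> \<and> \<tau> \<subseteq> C - \<sigma>}" if "\<sigma> \<subseteq> C" for \<sigma>
    using local_link_interval[OF that, of \<beta>] by (simp add: CAB(3))
  have linkA: "local_link \<sigma> A = {\<tau>. \<alpha> - \<sigma> \<subseteq> \<tau> \<and> \<tau> \<subseteq> C - \<sigma>}" if "\<sigma> \<subseteq> C" for \<sigma>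
    using local_link_interval[OF that, of \<alpha>] by (simp add: CAB(2))
  have linkB0: "local_link \<sigma> B = {}" and linkA0: "local_link \<sigma> A = {}" if "\<not> \<sigma> \<subseteq> C" for \<sigma>
    using local_link_interval_empty[OF that] by (simp_all add: CAB(2,3))
  have link_new: "local_link \<sigma> P = {}" if "\<beta> \<subseteq> \<sigma>" "P \<subseteq> \<Delta>" for \<sigma> P
  proof (rule local_link_empty_if)
    fix \<rho> assume "\<sigma> \<subseteq> \<rho>"
    then have "\<beta> \<subseteq> \<rho>" using that(1) by blast
    then show "\<rho> \<notin> P" using \<beta>sub[of \<rho>] that(2) by blast
  qed
  have cardC': "card (C - \<sigma>) = N - card \<sigma>" if "\<sigma> \<subseteq> C" for \<sigma>
    using that finC cardC by (simp add: card_Diff_subset finite_subset)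
  have "homology_filling TYPE('f) N \<Delta>' Y"
  proof (rule homology_fillingI)
    show "simplicial_complex \<Delta>'" by (rule Delta')
    show "simplicial_complex Y" by (rule Y)
    show "Y \<subseteq> \<Delta>'" by (rule YD)
    show "\<exists>\<rho>\<in>\<Delta>'. \<sigma> \<subseteq> \<rho> \<and> card \<rho> = N" if "\<sigma> \<in> \<Delta>'" for \<sigma>
    proof (cases "\<sigma> \<in> \<Delta>")
      case True
      then show ?thesis using D(4)[OF True] by (auto simp: \<Delta>'Y)
    next
      case False
      then have "\<sigma> \<subseteq> C" using that by (auto simp: \<Delta>'Y CAB(3))
      then show ?thesis using CB cardC by (auto simp: \<Delta>'Y)
    qed
    show "card \<sigma> \<le> N" if "\<sigma> \<in> \<Delta>'" for \<sigma>
    proof (cases "\<sigma> \<in> \<Delta>")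
      case False
      then have "\<sigma> \<subseteq> C" using that by (auto simp: \<Delta>'Y CAB(3))
      then show ?thesis using finC cardC card_mono by blast
    qed (rule D(5))
    show "card \<sigma> < N" if "\<sigma> \<in> Y" for \<sigma>
    proof (cases "\<sigma> \<in> X")
      case False
      then have "\<sigma> \<subset> C" using that by (auto simp: \<Delta>'Y CAB(3))
      then show ?thesis using finC cardC psubset_card_mono by blast
    qed (rule D(6))
    show "acyclic_family TYPE('f) (local_link \<sigma> \<Delta>')" if \<sigma>: "\<sigma> \<in> Y" for \<sigma>
    proof (rule acyclic_family_extend[OF splits_as_local_link[OF split1]])
      show "acyclic_family TYPE('f) (local_link \<sigma> \<Delta>)"
      proof (cases "\<sigma> \<in> X")
        case False
        then have "\<beta> \<subseteq> \<sigma>" using \<sigma> by (auto simp: \<Delta>'Y CAB(3))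
        then show ?thesis using link_new by (simp add: acyclic_family_empty)
      qed (rule D(7))
      show "acyclic_family TYPE('f) (local_link \<sigma> B)"
      proof (cases "\<sigma> \<subseteq> C")
        case True
        have "\<not> \<alpha> \<subseteq> \<sigma>" using \<sigma> by (auto simp: \<Delta>'Y CAB)
        then have "\<beta> - \<sigma> \<subset> C - \<sigma>" using fin(5) by (auto simp: CAB(1))
        then show ?thesis unfolding linkB[OF True] using finC by (intro acyclic_family_interval) auto
      qed (simp add: linkB0 acyclic_family_empty)
    qed
    show "\<exists>z::'v set \<Rightarrow> 'f. fundamental_cycle (N - card \<sigma>) (local_link \<sigma> \<Delta>') z"
      if "\<sigma> \<in> \<Delta>' - Y" for \<sigma>
    proof (cases "\<sigma> \<in> A")
      case True
      then have s: "\<alpha> \<subseteq> \<sigma>" "\<sigma> \<subseteq> C" by (auto simp: CAB)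
      have "acyclic_family TYPE('f) (local_link \<sigma> \<Delta>)"
      proof (cases "\<beta> \<subseteq> \<sigma>")
        case True
        then show ?thesis using link_new by (simp add: acyclic_family_empty)
      next
        case False
        then show ?thesis using D(7) in_X s by blast
      qed
      moreover have "\<beta> - \<sigma> = C - \<sigma>" using s by (auto simp: CAB(1))
      then have "local_link \<sigma> B = {C - \<sigma>}" unfolding linkB[OF s(2)] by auto
      then have "fundamental_cycle (N - card \<sigma>) (local_link \<sigma> B) (\<lambda>\<tau>. if \<tau> = C - \<sigma> then 1 else (0::'f))"
        using fundamental_cycle_singleton[of "C - \<sigma>", where ?'f = 'f] finC cardC'[OF s(2)] by simp
      ultimately show ?thesis
        using fundamental_cycle_extend[OF splits_as_local_link[OF split1]] by metis
    next
      case False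
      then have "\<sigma> \<in> \<Delta> - X" using that Int' by blast
      moreover have "local_link \<sigma> B = {}" using A_sep \<open>\<sigma> \<in> \<Delta> - X\<close> linkB0 by blast
      then have "local_link \<sigma> \<Delta>' = local_link \<sigma> \<Delta>" by (simp add: \<Delta>'Y local_link_Un)
      ultimately show ?thesis using D(8)[of \<sigma>] by simp
    qed
    show "\<exists>z::'v set \<Rightarrow> 'f. fundamental_cycle (N - card \<sigma>) (local_link \<sigma> (\<Delta>' - Y)) z \<and>
        (\<forall>\<tau>\<in>local_link \<sigma> \<Delta>'. card \<tau> = N - card \<sigma> \<longrightarrow> z \<tau> \<noteq> 0)" if \<sigma>: "\<sigma> \<in> Y" for \<sigma>
    proof -
      have link_int: "local_link \<sigma> (\<Delta>' - Y) = local_link \<sigma> A \<union> local_link \<sigma> (\<Delta> - X)"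
        unfolding Int' local_link_Un ..
      have link': "local_link \<sigma> \<Delta>' = local_link \<sigma> \<Delta> \<union> local_link \<sigma> B"
        by (simp add: \<Delta>'Y local_link_Un)
      consider (far) "\<not> \<sigma> \<subseteq> C" | (old) "\<sigma> \<subseteq> C" "\<not> \<beta> \<subseteq> \<sigma>" | (new) "\<sigma> \<subseteq> C" "\<beta> \<subseteq> \<sigma>" by blast
      then show ?thesis
      proof cases
        case far
        then have "\<sigma> \<in> X" using \<sigma> by (auto simp: \<Delta>'Y CAB(3))
        then show ?thesis using D(9) unfolding link_int link' linkA0[OF far] linkB0[OF far] by simp
      next
        case new
        have "local_link \<sigma> (\<Delta> - X) = {}" "local_link \<sigma> \<Delta> = {}" using link_new[OF new(2)] by auto
        moreover have "\<alpha> - \<sigma> = C - \<sigma>" "\<beta> - \<sigma> = {}" using new by (auto simp: CAB(1))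
        moreover from this have "local_link \<sigma> A = {C - \<sigma>}" unfolding linkA[OF new(1)] by auto
        moreover have "fundamental_cycle (N - card \<sigma>) {C - \<sigma>} (\<lambda>\<tau>. if \<tau> = C - \<sigma> then 1 else (0::'f))"
          using fundamental_cycle_singleton[of "C - \<sigma>", where ?'f = 'f] finC cardC'[OF new(1)] by simp
        moreover have "\<tau> = C - \<sigma>" if "\<tau> \<in> local_link \<sigma> B" "card \<tau> = N - card \<sigma>" for \<tau>
          using that finC cardC'[OF new(1)] card_subset_eq[of "C - \<sigma>" \<tau>]
          unfolding linkB[OF new(1)] by simp
        ultimately show ?thesis
          unfolding link_int link' by (intro exI[of _ "\<lambda>\<tau>. if \<tau> = C - \<sigma> then 1 else 0"]) simp
      next
        case old
        have \<sigma>X: "\<sigma> \<in> X" using in_X old by blast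
        have n\<alpha>: "\<not> \<alpha> \<subseteq> \<sigma>" using \<sigma> old by (auto simp: \<Delta>'Y CAB)
        obtain z :: "'v set \<Rightarrow> 'f" where z: "fundamental_cycle (N - card \<sigma>) (local_link \<sigma> (\<Delta> - X)) z"
          and full: "\<And>\<tau>. \<tau> \<in> local_link \<sigma> \<Delta> \<Longrightarrow> card \<tau> = N - card \<sigma> \<Longrightarrow> z \<tau> \<noteq> 0"
          using D(9)[OF \<sigma>X] by blast
        obtain v where v: "v \<in> \<beta>" "v \<notin> \<sigma>" using old by blast
        then have v': "v \<in> C" "v \<notin> \<alpha>" using fin(5) by (auto simp: CAB(1))
        have "\<alpha> \<subseteq> C" by (simp add: CAB(1))
        then have "\<alpha> - \<sigma> \<subset> C - \<sigma>" using v(2) v' by blast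
        then have "acyclic_family TYPE('f) (local_link \<sigma> A)"
          unfolding linkA[OF old(1)] using finC by (intro acyclic_family_interval) auto
        then obtain q where q: "supported (local_link \<sigma> A) q"
          and zq: "fundamental_cycle (N - card \<sigma>) (local_link \<sigma> (\<Delta>' - Y)) (z + q)"
          using fundamental_cycle_extend[OF splits_as_local_link[OF split2] _ z] by metis
        have z_sup: "supported (local_link \<sigma> (\<Delta> - X)) z" using z by (simp add: fundamental_cycle_def)
        have disj: "local_link \<sigma> A \<inter> local_link \<sigma> (\<Delta> - X) = {}"
          using splits_asD(6)[OF splits_as_local_link[OF split2]] .
        \<comment> \<open>The coefficient on the new simplex is forced by a ridge \<open>\<kappa>\<close> through which the simplex meets
          the old ball: there the boundary vanishes and the only other facet has a non-zero coefficient.\<close>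
        have "(z + q) \<tau> \<noteq> 0" if \<tau>: "\<tau> \<in> local_link \<sigma> \<Delta>'" "card \<tau> = N - card \<sigma>" for \<tau>
        proof (cases "\<tau> \<in> local_link \<sigma> \<Delta>")
          case True
          then have "z \<tau> \<noteq> 0" using full \<tau> by blast
          then have "\<tau> \<in> local_link \<sigma> (\<Delta> - X)" using z_sup unfolding supported_def by blast
          then have "q \<tau> = 0" using q disj unfolding supported_def by blast
          then show ?thesis using \<open>z \<tau> \<noteq> 0\<close> by simp
        next
          case False
          then have "\<tau> \<in> local_link \<sigma> B" using \<tau> link' by blast
          then have \<tau>eq: "\<tau> = C - \<sigma>"
            using \<tau>(2) finC cardC'[OF old(1)] card_subset_eq[of "C - \<sigma>" \<tau>]
            unfolding linkB[OF old(1)] by simp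
          define \<kappa> where "\<kappa> = C - \<sigma> - {v}"
          have ins: "insert v \<kappa> = C - \<sigma>" and v\<kappa>: "v \<notin> \<kappa>" using v v' by (auto simp: \<kappa>_def)
          have \<kappa>\<sigma>: "\<kappa> \<union> \<sigma> = C - {v}" using v old(1) by (auto simp: \<kappa>_def)
          have ridge: "\<kappa> \<union> \<sigma> \<in> X" "Suc (card (\<kappa> \<union> \<sigma>)) = N"
            unfolding \<kappa>\<sigma> using in_X[of "C - {v}"] v(1) card_Suc_Diff1[OF finC v'(1)] cardC by auto
          obtain u where u: "u \<notin> \<kappa> \<union> \<sigma>" "insert u (\<kappa> \<union> \<sigma>) \<in> \<Delta>"
            "\<And>w. w \<notin> \<kappa> \<union> \<sigma> \<Longrightarrow> insert w (\<kappa> \<union> \<sigma>) \<in> \<Delta> \<Longrightarrow> w = u"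
            using unique_facet_above_ridge[OF fil ridge] by metis
          let ?P = "local_link \<sigma> (\<Delta>' - Y)"
          have \<kappa>A: "\<kappa> \<in> local_link \<sigma> A" unfolding linkA[OF old(1)] using v' by (auto simp: \<kappa>_def CAB(1))
          have \<kappa>P: "\<kappa> \<in> ?P" using \<kappa>A link_int by blast
          have CP: "C - \<sigma> \<in> ?P"
            unfolding link_int linkA[OF old(1)] by (auto simp: CAB(1))
          have uv: "u \<noteq> v"
          proof
            assume "u = v"
            then have "insert u (\<kappa> \<union> \<sigma>) = C" using \<kappa>\<sigma> v' by auto
            then show False using u CB by simp
          qed
          have fin\<kappa>: "finite \<kappa>" using finC by (simp add: \<kappa>_def)
          have u\<Delta>: "insert u \<kappa> \<in> local_link \<sigma> \<Delta>" using u(1,2) by (auto simp: \<kappa>_def)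
          have cu: "card (insert u \<kappa>) = N - card \<sigma>"
            using u(1) v\<kappa> fin\<kappa> ins cardC'[OF old(1)] by (metis UnI1 card_insert_disjoint)
          have zu: "z (insert u \<kappa>) \<noteq> 0" using full[OF u\<Delta> cu] .
          then have uR: "insert u \<kappa> \<in> local_link \<sigma> (\<Delta> - X)" using z_sup unfolding supported_def by blast
          then have uP: "insert u \<kappa> \<in> ?P" using link_int by blast
          have qu: "q (insert u \<kappa>) = 0" using uR q disj unfolding supported_def by blast
          have ne: "insert u \<kappa> \<noteq> C - \<sigma>" using uv ins u(1) v\<kappa> by auto
          have convP: "convex_family ?P"
            by (intro convex_family_local_link convex_family_diff Delta' Y)
          have "rel_bdry ?P (z + q) \<kappa> =
            (\<Sum>\<rho>\<in>{C - \<sigma>, insert u \<kappa>}. (z + q) \<rho> * oriented_bdry \<rho> \<kappa>)"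
          proof (rule rel_bdry_coface_sum)
            show "finite ?P" using convex_familyD(1)[OF convP] .
            show "\<kappa> \<in> ?P" by (rule \<kappa>P)
            show "{C - \<sigma>, insert u \<kappa>} \<subseteq> ?P" using CP uP by simp
            fix w assume w: "w \<notin> \<kappa>" "insert w \<kappa> \<in> ?P" "insert w \<kappa> \<notin> {C - \<sigma>, insert u \<kappa>}"
            have w\<sigma>: "w \<notin> \<sigma>" using w(2) by auto
            have "insert w (\<kappa> \<union> \<sigma>) \<in> \<Delta>'" using w(2) by auto
            moreover have "insert w (\<kappa> \<union> \<sigma>) \<notin> \<Delta>" using u(3)[of w] w w\<sigma> by auto
            ultimately have "insert w (\<kappa> \<union> \<sigma>) \<in> B" by (simp add: \<Delta>'Y)
            then have "w \<in> C" by (auto simp: CAB(3))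
            then have "w = v" using w(1) w\<sigma> by (auto simp: \<kappa>_def)
            then show "(z + q) (insert w \<kappa>) = 0" using w(3) ins by simp
          qed
          moreover have "rel_bdry ?P (z + q) \<kappa> = 0"
            using zq unfolding fundamental_cycle_def by simp
          ultimately have "(z + q) (C - \<sigma>) * oriented_bdry (C - \<sigma>) \<kappa> +
              z (insert u \<kappa>) * oriented_bdry (insert u \<kappa>) \<kappa> = 0"
            using ne qu by simp
          moreover have "z (insert u \<kappa>) * oriented_bdry (insert u \<kappa>) \<kappa> \<noteq> 0"
            using zu oriented_bdry_insert_nonzero[OF fin\<kappa>, of u, where ?'f = 'f] u(1) by simp
          ultimately show ?thesis using \<tau>eq by auto
        qed
        then show ?thesis using zq by blast
      qed
    qed
  qed
  then show ?thesis unfolding Yeq by (simp add: \<Delta>'Y(1) CAB(1,3))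
qed


section \<open>The g-vector under bistellar moves\<close>

text \<open>
Up to a factor \<open>1 - x\<close> this is the \<open>h\<close>-polynomial; its coefficients are the \<open>g\<close>-numbers, by
\<open>g_vec_eq_coeff\<close>. It is additive over arbitrary families of faces, which makes it easy to follow
through a bistellar move.
\<close>

definition face_poly :: "nat \<Rightarrow> 'v set set \<Rightarrow> int poly" where
  "face_poly N P = (\<Sum>\<sigma>\<in>P. monom 1 (card \<sigma>) * [:1, -1:] ^ (N - card \<sigma>))"

lemma coeff_face_term:
  assumes "s \<le> N" "j \<le> N"
  shows "coeff (monom 1 s * [:1, -1:] ^ (N - s)) j =
    (if s \<le> j then (-1) ^ (j - s) * int ((N - s) choose (j - s)) else 0)"
  using assms by (auto simp: coeff_monom_mult coeff_linear_poly_power)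

lemma g_vec_eq_coeff:
  fixes X :: "'v set set"
  assumes fin: "finite X" and d: "0 \<le> d + 2" and j: "j \<le> nat (d + 2)"
    and card: "\<And>\<sigma>. \<sigma> \<in> X \<Longrightarrow> card \<sigma> \<le> nat (d + 2)"
  shows "g_vec d (int j) X = coeff (face_poly (nat (d + 2)) X) j"
proof -
  define N where "N = nat (d + 2)"
  define a where "a s = (-1) ^ (j - s) * int ((N - s) choose (j - s))" for s
  have dN: "d = int N - 2" using d by (simp add: N_def)
  have "g_vec d (int j) X = (\<Sum>s\<in>{..j}. a s * int (card {\<sigma> \<in> X. card \<sigma> = s}))"
    unfolding g_vec_def
  proof (rule sum.reindex_bij_witness[where i = "\<lambda>s. int s - 1" and j = "\<lambda>i. nat (i + 1)"])
    fix i assume i: "i \<in> {-1..int j - 1}"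
    define s where "s = nat (i + 1)"
    have i': "i = int s - 1" "s \<le> j" using i by (auto simp: s_def)
    have "nat (int j - i - 1) = j - s" "nat (d - i + 1) = N - s"
      using i' by (simp_all add: dN nat_diff_distrib)
    moreover have "f_vec i X = card {\<sigma> \<in> X. card \<sigma> = s}"
      unfolding f_vec_def face_dim_def i' by simp
    ultimately show "a (nat (i + 1)) * int (card {\<sigma> \<in> X. card \<sigma> = nat (i + 1)}) =
        (-1) ^ nat (int j - i - 1) * int (nat (d - i + 1) choose nat (int j - i - 1)) * int (f_vec i X)"
      by (simp add: a_def s_def[symmetric])
  qed auto
  also have "\<dots> = (\<Sum>s\<in>{..j}. \<Sum>\<sigma> | \<sigma> \<in> {\<sigma> \<in> X. card \<sigma> \<le> j} \<and> card \<sigma> = s. a (card \<sigma>))"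
  proof (rule sum.cong[OF refl])
    fix s assume "s \<in> {..j}"
    then have "{\<sigma>. \<sigma> \<in> {\<sigma> \<in> X. card \<sigma> \<le> j} \<and> card \<sigma> = s} = {\<sigma> \<in> X. card \<sigma> = s}" by auto
    then show "a s * int (card {\<sigma> \<in> X. card \<sigma> = s}) =
      (\<Sum>\<sigma> | \<sigma> \<in> {\<sigma> \<in> X. card \<sigma> \<le> j} \<and> card \<sigma> = s. a (card \<sigma>))" by simp
  qed
  also have "\<dots> = (\<Sum>\<sigma> | \<sigma> \<in> X \<and> card \<sigma> \<le> j. a (card \<sigma>))"
    by (rule sum.group) (use fin in auto)
  also have "\<dots> = (\<Sum>\<sigma>\<in>X. if card \<sigma> \<le> j then a (card \<sigma>) else 0)"
    using fin by (simp add: sum.inter_filter)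
  also have "\<dots> = coeff (face_poly N X) j"
    unfolding face_poly_def coeff_sum
  proof (rule sum.cong[OF refl])
    fix \<sigma> assume "\<sigma> \<in> X"
    then show "(if card \<sigma> \<le> j then a (card \<sigma>) else 0) =
        coeff (monom 1 (card \<sigma>) * [:1, -1:] ^ (N - card \<sigma>)) j"
      using coeff_face_term[of "card \<sigma>" N j] card j by (simp add: a_def N_def)
  qed
  finally show ?thesis by (simp add: N_def)
qed

lemma face_poly_Un:
  "finite P \<Longrightarrow> finite Q \<Longrightarrow> P \<inter> Q = {} \<Longrightarrow> face_poly N (P \<union> Q) = face_poly N P + face_poly N Q"
  unfolding face_poly_def by (rule sum.union_disjoint)

lemma sum_Pow_binomial:
  fixes y z :: "'a::comm_semiring_1"
  assumes "finite D"
  shows "(\<Sum>\<gamma>\<in>Pow D. y ^ card \<gamma> * z ^ (card D - card \<gamma>)) = (y + z) ^ card D"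
proof -
  have "(y + z) ^ card D = (\<Prod>x\<in>D. y + z)" by simp
  also have "\<dots> = (\<Sum>\<gamma>\<in>Pow D. (\<Prod>x\<in>\<gamma>. y) * (\<Prod>x\<in>D - \<gamma>. z))" by (rule prod_add[OF assms])
  also have "\<dots> = (\<Sum>\<gamma>\<in>Pow D. y ^ card \<gamma> * z ^ (card D - card \<gamma>))"
    using assms by (intro sum.cong refl) (auto simp: card_Diff_subset finite_subset)
  finally show ?thesis by simp
qed

text \<open>
The binomial theorem for \<open>x + (1 - x) = 1\<close>.
\<close>

lemma face_poly_interval:
  fixes b C :: "'v set"
  assumes "finite C" "b \<subseteq> C"
  shows "face_poly (card C) {\<sigma>. b \<subseteq> \<sigma> \<and> \<sigma> \<subseteq> C} = monom 1 (card b)"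
proof -
  let ?D = "C - b"
  have fin: "finite ?D" "finite b" using assms finite_subset by auto
  have cD: "card ?D = card C - card b" using assms fin by (simp add: card_Diff_subset)
  have bC: "card b \<le> card C" using assms by (simp add: card_mono)
  have "face_poly (card C) {\<sigma>. b \<subseteq> \<sigma> \<and> \<sigma> \<subseteq> C} =
      (\<Sum>\<gamma>\<in>Pow ?D. monom 1 (card b) * (monom 1 1 ^ card \<gamma> * [:1, -1:] ^ (card ?D - card \<gamma>)))"
    unfolding face_poly_def
  proof (rule sum.reindex_bij_witness[where i = "\<lambda>\<gamma>. \<gamma> \<union> b" and j = "\<lambda>\<sigma>. \<sigma> - b"])
    fix \<sigma> assume \<sigma>: "\<sigma> \<in> {\<sigma>. b \<subseteq> \<sigma> \<and> \<sigma> \<subseteq> C}"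
    then have fs: "finite \<sigma>" using assms finite_subset by auto
    then have c: "card \<sigma> = card b + card (\<sigma> - b)"
      using \<sigma> fin card_mono[of \<sigma> b] by (simp add: card_Diff_subset)
    have "monom (1::int) (card \<sigma>) = monom 1 (card b) * monom 1 1 ^ card (\<sigma> - b)"
      by (simp add: c mult_monom monom_power)
    moreover have "card C - card \<sigma> = card ?D - card (\<sigma> - b)" using c cD by simp
    ultimately show "monom 1 (card b) * (monom 1 1 ^ card (\<sigma> - b) * [:1, -1:] ^ (card ?D - card (\<sigma> - b))) =
        monom (1::int) (card \<sigma>) * [:1, -1:] ^ (card C - card \<sigma>)" by (simp add: mult.assoc)
  qed (use assms in auto)
  also have "\<dots> = monom 1 (card b) * (monom 1 1 + [:1, -1:]) ^ card ?D"
    unfolding sum_distrib_left[symmetric] sum_Pow_binomial[OF fin(1)] ..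
  also have "monom 1 1 + [:1, -1:] = (1 :: int poly)"
    by (simp add: monom_altdef one_pCons)
  finally show ?thesis by simp
qed

lemma join_full_bdry:
  assumes "\<alpha> \<inter> \<beta> = {}"
  shows "join (full_simplex \<alpha>) (simplex_bdry \<beta>) = {\<sigma>. \<sigma> \<subseteq> \<alpha> \<union> \<beta> \<and> \<not> \<beta> \<subseteq> \<sigma>}"
proof (intro set_eqI iffI)
  fix \<sigma> assume "\<sigma> \<in> join (full_simplex \<alpha>) (simplex_bdry \<beta>)"
  then obtain \<gamma> \<delta> where "\<sigma> = \<gamma> \<union> \<delta>" "\<gamma> \<subseteq> \<alpha>" "\<delta> \<subset> \<beta>"
    by (auto simp: join_def full_simplex_def simplex_bdry_def)
  then show "\<sigma> \<in> {\<sigma>. \<sigma> \<subseteq> \<alpha> \<union> \<beta> \<and> \<not> \<beta> \<subseteq> \<sigma>}" using assms by blast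
next
  fix \<sigma> assume "\<sigma> \<in> {\<sigma>. \<sigma> \<subseteq> \<alpha> \<union> \<beta> \<and> \<not> \<beta> \<subseteq> \<sigma>}"
  then have "\<sigma> = (\<sigma> \<inter> \<alpha>) \<union> (\<sigma> \<inter> \<beta>)" "\<sigma> \<inter> \<alpha> \<subseteq> \<alpha>" "\<sigma> \<inter> \<beta> \<subset> \<beta>" "(\<sigma> \<inter> \<alpha>) \<inter> (\<sigma> \<inter> \<beta>) = {}"
    using assms by blast+
  then show "\<sigma> \<in> join (full_simplex \<alpha>) (simplex_bdry \<beta>)"
    unfolding join_def full_simplex_def simplex_bdry_def by blast
qed

lemma admits_bistellar_moveD:
  assumes "admits_bistellar_move d \<alpha> \<beta> X"
  shows "finite \<alpha>" "finite \<beta>" "\<alpha> \<noteq> {}" "\<beta> \<noteq> {}" "\<alpha> \<inter> \<beta> = {}" "int (card \<alpha>) + int (card \<beta>) = d + 2"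
    "simplicial_complex X" "\<sigma> \<subseteq> \<alpha> \<union> \<beta> \<Longrightarrow> \<sigma> \<in> X \<longleftrightarrow> \<not> \<beta> \<subseteq> \<sigma>"
    "bistellar_move \<alpha> \<beta> X = {\<sigma> \<in> X. \<not> \<sigma> \<subseteq> \<alpha> \<union> \<beta>} \<union> {\<sigma>. \<sigma> \<subseteq> \<alpha> \<union> \<beta> \<and> \<not> \<alpha> \<subseteq> \<sigma>}"
proof -
  show *: "finite \<alpha>" "finite \<beta>" "\<alpha> \<noteq> {}" "\<beta> \<noteq> {}" "\<alpha> \<inter> \<beta> = {}" "int (card \<alpha>) + int (card \<beta>) = d + 2"
    "simplicial_complex X"
    using assms unfolding admits_bistellar_move_def by blast+
  have "induced X (\<alpha> \<union> \<beta>) = {\<sigma>. \<sigma> \<subseteq> \<alpha> \<union> \<beta> \<and> \<not> \<beta> \<subseteq> \<sigma>}"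
    using assms join_full_bdry[OF *(5)] by (simp add: admits_bistellar_move_def)
  then have ind: "\<sigma> \<in> X \<longleftrightarrow> \<not> \<beta> \<subseteq> \<sigma>" if "\<sigma> \<subseteq> \<alpha> \<union> \<beta>" for \<sigma>
    using that unfolding induced_def by blast
  then show "\<sigma> \<subseteq> \<alpha> \<union> \<beta> \<Longrightarrow> \<sigma> \<in> X \<longleftrightarrow> \<not> \<beta> \<subseteq> \<sigma>" .
  have "join (full_simplex \<beta>) (simplex_bdry \<alpha>) = {\<sigma>. \<sigma> \<subseteq> \<alpha> \<union> \<beta> \<and> \<not> \<alpha> \<subseteq> \<sigma>}"
    using join_full_bdry[of \<beta> \<alpha>] *(5) by (simp add: Int_commute Un_commute)
  then show "bistellar_move \<alpha> \<beta> X = {\<sigma> \<in> X. \<not> \<sigma> \<subseteq> \<alpha> \<union> \<beta>} \<union> {\<sigma>. \<sigma> \<subseteq> \<alpha> \<union> \<beta> \<and> \<not> \<alpha> \<subseteq> \<sigma>}"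
    unfolding bistellar_move_def join_full_bdry[OF *(5)] using ind by auto
qed

lemma face_poly_not_above:
  assumes "finite C" "a \<subseteq> C" "a \<noteq> {}"
  shows "face_poly (card C) {\<sigma>. \<sigma> \<subseteq> C \<and> \<not> a \<subseteq> \<sigma>} = 1 - monom 1 (card a)"
proof -
  let ?P = "{\<sigma>. \<sigma> \<subseteq> C \<and> \<not> a \<subseteq> \<sigma>}" and ?Q = "{\<sigma>. a \<subseteq> \<sigma> \<and> \<sigma> \<subseteq> C}"
  have "{\<sigma>. {} \<subseteq> \<sigma> \<and> \<sigma> \<subseteq> C} = ?P \<union> ?Q" by auto
  then have "face_poly (card C) (?P \<union> ?Q) = monom 1 (card ({} :: 'a set))"
    using face_poly_interval[OF assms(1), of "{}"] by simp
  moreover have "face_poly (card C) (?P \<union> ?Q) = face_poly (card C) ?P + face_poly (card C) ?Q"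
    using assms(1) by (intro face_poly_Un) auto
  ultimately show ?thesis using face_poly_interval[OF assms(1,2)] by (simp add: algebra_simps)
qed

text \<open>
The part of the complex inside \<open>\<alpha> \<union> \<beta>\<close> changes from all subsets except those above \<open>\<beta>\<close> to all subsets
except those above \<open>\<alpha>\<close>, and an interval contributes a single monomial.
\<close>

lemma face_poly_bistellar_move:
  assumes "admits_bistellar_move d \<alpha> \<beta> X"
  shows "face_poly (nat (d + 2)) (bistellar_move \<alpha> \<beta> X) =
    face_poly (nat (d + 2)) X + monom 1 (card \<beta>) - monom 1 (card \<alpha>)"
proof -
  note D = admits_bistellar_moveD[OF assms]
  define C where "C = \<alpha> \<union> \<beta>"
  have C: "finite C" "\<alpha> \<subseteq> C" "\<beta> \<subseteq> C" using D by (auto simp: C_def)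
  have cC: "nat (d + 2) = card C" using D(6) card_Un_disjoint[OF D(1,2,5)] by (simp add: C_def)
  let ?O = "{\<sigma> \<in> X. \<not> \<sigma> \<subseteq> C}"
  have finO: "finite ?O" using simplicial_complexD(1)[OF D(7)] by simp
  have "X = ?O \<union> {\<sigma>. \<sigma> \<subseteq> C \<and> \<not> \<beta> \<subseteq> \<sigma>}"
    using D(8) unfolding C_def by blast
  then have "face_poly (card C) X = face_poly (card C) (?O \<union> {\<sigma>. \<sigma> \<subseteq> C \<and> \<not> \<beta> \<subseteq> \<sigma>})" by simp
  also have "\<dots> = face_poly (card C) ?O + face_poly (card C) {\<sigma>. \<sigma> \<subseteq> C \<and> \<not> \<beta> \<subseteq> \<sigma>}"
    using finO C(1) by (intro face_poly_Un) auto
  finally have 1: "face_poly (card C) X = face_poly (card C) ?O + (1 - monom 1 (card \<beta>))"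
    using face_poly_not_above[OF C(1,3) D(4)] by simp
  have "face_poly (card C) (bistellar_move \<alpha> \<beta> X) =
      face_poly (card C) ?O + face_poly (card C) {\<sigma>. \<sigma> \<subseteq> C \<and> \<not> \<alpha> \<subseteq> \<sigma>}"
    unfolding D(9) C_def[symmetric] using finO C(1) by (intro face_poly_Un) auto
  then show ?thesis using 1 face_poly_not_above[OF C(1,2) D(3)] unfolding cC by simp
qed

lemma tame_sphere_finite:
  assumes "tame_sphere d S"
  shows "finite S \<and> 0 \<le> d + 2 \<and> (\<forall>\<sigma>\<in>S. card \<sigma> \<le> nat (d + 2))"
  using assms
proof induction
  case (standard \<alpha>)
  then have "finite (simplex_bdry \<alpha>)"
    unfolding simplex_bdry_def by (auto intro: finite_subset[of _ "Pow \<alpha>"])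
  moreover have "card \<sigma> \<le> card \<alpha>" if "\<sigma> \<in> simplex_bdry \<alpha>" for \<sigma>
    using that standard(1) unfolding simplex_bdry_def by (auto intro: card_mono)
  moreover have "card \<alpha> = nat (d + 2)" "0 \<le> d + 2" using standard(3) by auto
  ultimately show ?case by auto
next
  case (move X \<alpha> \<beta>)
  note D = admits_bistellar_moveD[OF move.hyps(2)]
  have "finite (\<alpha> \<union> \<beta>)" "card (\<alpha> \<union> \<beta>) = nat (d + 2)"
    using D(1,2,6) card_Un_disjoint[OF D(1,2,5)] by auto
  then have "card \<sigma> \<le> nat (d + 2)" if "\<sigma> \<subseteq> \<alpha> \<union> \<beta>" for \<sigma> using that card_mono by metis
  then show ?case unfolding D(9) using move.IH \<open>finite (\<alpha> \<union> \<beta>)\<close> by auto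
qed

lemma less_half_iff: "real_of_int t < real_of_int d / 2 \<longleftrightarrow> 2 * t < d"
proof -
  have "real_of_int t < real_of_int d / 2 \<longleftrightarrow> real_of_int (2 * t) < real_of_int d" by auto
  then show ?thesis by (simp only: of_int_less_iff)
qed

text \<open>
Since \<open>\<alpha>\<close> has more than \<open>d/2 + 1\<close> vertices, its monomial does not show in degree \<open>l + 1\<close>.
\<close>

lemma g_vec_bistellar_move:
  assumes "tame_sphere d X" "admits_bistellar_move d \<alpha> \<beta> X" "real_of_int (move_index \<beta>) < real_of_int d / 2"
    and l: "2 * int l \<le> d"
  shows "g_vec d (int (l + 1)) (bistellar_move \<alpha> \<beta> X) =
    g_vec d (int (l + 1)) X + (if card \<beta> = l + 1 then 1 else 0)"
proof -
  note D = admits_bistellar_moveD[OF assms(2)]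
  have Y: "tame_sphere d (bistellar_move \<alpha> \<beta> X)" using assms tame_sphere.move by blast
  note fX = tame_sphere_finite[OF assms(1)] and fY = tame_sphere_finite[OF Y]
  have le: "l + 1 \<le> nat (d + 2)" using l by linarith
  have "2 * (int (card \<beta>) - 1) < d"
    using less_half_iff[of "move_index \<beta>" d] assms(3) by (simp add: move_index_def)
  then have "int l + 1 < int (card \<alpha>)" using D(6) l by arith
  then have "l + 1 < card \<alpha>" by simp
  then show ?thesis
    using g_vec_eq_coeff[of X d "l + 1"] g_vec_eq_coeff[of "bistellar_move \<alpha> \<beta> X" d "l + 1"] fX fY le
      face_poly_bistellar_move[OF assms(2)] by (simp add: coeff_monom)
qed

lemma g_vec_standard_sphere:
  assumes "finite \<alpha>" "\<alpha> \<noteq> {}" "int (card \<alpha>) = d + 2" and l: "2 * int l \<le> d"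
  shows "g_vec d (int (l + 1)) (simplex_bdry \<alpha>) = 0"
proof -
  have t: "tame_sphere d (simplex_bdry \<alpha>)" using assms(1-3) by (rule tame_sphere.standard)
  have N: "nat (d + 2) = card \<alpha>" "l + 1 < card \<alpha>" using assms(3) l by auto
  have "simplex_bdry \<alpha> = {\<sigma>. \<sigma> \<subseteq> \<alpha> \<and> \<not> \<alpha> \<subseteq> \<sigma>}" unfolding simplex_bdry_def by blast
  then have "face_poly (card \<alpha>) (simplex_bdry \<alpha>) = 1 - monom 1 (card \<alpha>)"
    using face_poly_not_above[OF assms(1) _ assms(2)] by simp
  then show ?thesis
    using g_vec_eq_coeff[of "simplex_bdry \<alpha>" d "l + 1"] tame_sphere_finite[OF t] N
    by (simp add: coeff_monom)
qed


section \<open>Fillings of tame spheres\<close>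

text \<open>
The last condition says that the missing faces of \<open>\<Delta>\<close> have at most \<open>l + 1\<close> vertices. It is carried along
to exclude moves of index greater than \<open>l\<close>.
\<close>

definition stacked_filling :: "'f::field itself \<Rightarrow> nat \<Rightarrow> nat \<Rightarrow> 'v::linorder set set \<Rightarrow> 'v set set \<Rightarrow> bool" where
  "stacked_filling F N l \<Delta> X \<longleftrightarrow> homology_filling F N \<Delta> X \<and>
     (\<forall>\<sigma>\<in>\<Delta>. card \<sigma> + l < N \<longrightarrow> \<sigma> \<in> X) \<and>
     (\<forall>\<sigma>. finite \<sigma> \<and> l + 2 \<le> card \<sigma> \<and> (\<forall>\<tau>. \<tau> \<subset> \<sigma> \<longrightarrow> \<tau> \<in> \<Delta>) \<longrightarrow> \<sigma> \<in> \<Delta>)"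

lemma stacked_fillingI:
  assumes "homology_filling F N \<Delta> X"
    "\<And>\<sigma>. \<sigma> \<in> \<Delta> \<Longrightarrow> card \<sigma> + l < N \<Longrightarrow> \<sigma> \<in> X"
    "\<And>\<sigma>. finite \<sigma> \<Longrightarrow> l + 2 \<le> card \<sigma> \<Longrightarrow> (\<And>\<tau>. \<tau> \<subset> \<sigma> \<Longrightarrow> \<tau> \<in> \<Delta>) \<Longrightarrow> \<sigma> \<in> \<Delta>"
  shows "stacked_filling F N l \<Delta> X"
  unfolding stacked_filling_def using assms(1)
  by (intro conjI ballI allI impI) (use assms(2,3) in auto)

text \<open>
A move of index less than \<open>l\<close> creates no missing face with more than \<open>l + 1\<close> vertices: a face that is
missing only now would consist of \<open>\<beta>\<close> and one further vertex.
\<close>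

lemma stacked_filling_move:
  fixes X \<Delta> :: "'v::linorder set set"
  assumes fil: "stacked_filling TYPE('f::field) N l \<Delta> X"
    and mv: "admits_bistellar_move d \<alpha> \<beta> X" and N: "N = nat (d + 2)"
    and \<beta>l: "card \<beta> \<le> l" "2 * int l \<le> d"
  shows "stacked_filling TYPE('f) N l (\<Delta> \<union> {\<sigma>. \<beta> \<subseteq> \<sigma> \<and> \<sigma> \<subseteq> \<alpha> \<union> \<beta>}) (bistellar_move \<alpha> \<beta> X)"
proof -
  note M = admits_bistellar_moveD[OF mv]
  have hf: "homology_filling TYPE('f) N \<Delta> X"
    and low: "\<And>\<sigma>. \<sigma> \<in> \<Delta> \<Longrightarrow> card \<sigma> + l < N \<Longrightarrow> \<sigma> \<in> X"
    and miss: "\<And>\<sigma>. finite \<sigma> \<Longrightarrow> l + 2 \<le> card \<sigma> \<Longrightarrow> (\<And>\<tau>. \<tau> \<subset> \<sigma> \<Longrightarrow> \<tau> \<in> \<Delta>) \<Longrightarrow> \<sigma> \<in> \<Delta>"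
    using fil unfolding stacked_filling_def by blast+
  note D = homology_fillingD[OF hf]
  let ?C = "\<alpha> \<union> \<beta>"
  let ?B = "{\<sigma>. \<beta> \<subseteq> \<sigma> \<and> \<sigma> \<subseteq> ?C}"
  have cN: "card \<alpha> + card \<beta> = N" using M(6) N by simp
  have finC: "finite ?C" using M(1,2) by simp
  have \<beta>new: "\<beta> \<notin> \<Delta>"
  proof
    assume "\<beta> \<in> \<Delta>"
    then have "\<beta> \<in> X" using low \<beta>l N by simp
    then show False using M(8)[of \<beta>] by simp
  qed
  have \<beta>sub: "\<not> \<beta> \<subseteq> \<sigma>" if "\<sigma> \<in> \<Delta>" for \<sigma>
    using that \<beta>new simplicial_complexD(4)[OF D(1)] by blast
  have Yeq: "bistellar_move \<alpha> \<beta> X = (X - {\<sigma>. \<alpha> \<subseteq> \<sigma> \<and> \<sigma> \<subseteq> ?C}) \<union> {\<sigma>. \<beta> \<subseteq> \<sigma> \<and> \<sigma> \<subset> ?C}"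
  proof (intro set_eqI)
    fix \<sigma>
    show "\<sigma> \<in> bistellar_move \<alpha> \<beta> X \<longleftrightarrow>
      \<sigma> \<in> (X - {\<sigma>. \<alpha> \<subseteq> \<sigma> \<and> \<sigma> \<subseteq> ?C}) \<union> {\<sigma>. \<beta> \<subseteq> \<sigma> \<and> \<sigma> \<subset> ?C}"
    proof (cases "\<sigma> \<subseteq> ?C")
      case True
      have "\<sigma> \<subset> ?C \<longleftrightarrow> \<not> \<alpha> \<subseteq> \<sigma>" if "\<beta> \<subseteq> \<sigma>" using True that by blast
      then show ?thesis unfolding M(9) using True M(8)[OF True] by blast
    next
      case False
      then show ?thesis unfolding M(9) by blast
    qed
  qed
  have "homology_filling TYPE('f) N (\<Delta> \<union> ?B) (bistellar_move \<alpha> \<beta> X)"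
    unfolding Yeq using hf M(1-5) cN M(8) \<beta>new by (rule homology_filling_glue_simplex)
  moreover have "\<sigma> \<in> bistellar_move \<alpha> \<beta> X" if "\<sigma> \<in> \<Delta> \<union> ?B" "card \<sigma> + l < N" for \<sigma>
  proof -
    \<comment> \<open>The faces that become interior contain \<open>\<alpha>\<close>, and \<open>\<alpha>\<close> has at least \<open>N - l\<close> vertices.\<close>
    have "\<not> \<alpha> \<subseteq> \<sigma>"
    proof
      assume "\<alpha> \<subseteq> \<sigma>"
      moreover have "finite \<sigma>" using that(1) simplicial_complexD(3)[OF D(1)] finite_subset[OF _ finC] by blast
      ultimately have "card \<alpha> \<le> card \<sigma>" using card_mono by blast
      then show False using that(2) cN \<beta>l by simp
    qed
    then show ?thesis
    proof (cases "\<sigma> \<subseteq> ?C")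
      case False
      then have "\<sigma> \<in> \<Delta>" using that by blast
      then show ?thesis using low that(2) False unfolding M(9) by blast
    qed (simp add: M(9))
  qed
  moreover have "\<sigma> \<in> \<Delta> \<union> ?B"
    if \<sigma>: "finite \<sigma>" "l + 2 \<le> card \<sigma>" "\<And>\<tau>. \<tau> \<subset> \<sigma> \<Longrightarrow> \<tau> \<in> \<Delta> \<union> ?B" for \<sigma>
  proof (cases "\<forall>\<tau>. \<tau> \<subset> \<sigma> \<longrightarrow> \<tau> \<in> \<Delta>")
    case True
    then show ?thesis using miss \<sigma> by blast
  next
    case False
    then obtain \<tau> where \<tau>: "\<tau> \<subset> \<sigma>" "\<tau> \<in> ?B" using \<sigma>(3) by blast
    show ?thesis
    proof (rule ccontr)
      assume "\<sigma> \<notin> \<Delta> \<union> ?B"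
      then obtain v where v: "v \<in> \<sigma>" "v \<notin> ?C" using \<tau> by blast
      have "insert v \<beta> \<subseteq> \<sigma>" using v \<tau> by blast
      moreover have "card (insert v \<beta>) \<le> l + 1" using \<beta>l card_insert_le_m1[of "Suc l" \<beta> v] by simp
      then have "insert v \<beta> \<noteq> \<sigma>" using \<sigma>(2) by auto
      ultimately have "insert v \<beta> \<in> \<Delta> \<union> ?B" using \<sigma>(3) by blast
      then show False using \<beta>sub[of "insert v \<beta>"] v by blast
    qed
  qed
  ultimately show ?thesis by (rule stacked_fillingI)
qed

lemma stacked_filling_standard:
  fixes \<alpha> :: "'v::linorder set"
  assumes "finite \<alpha>" "\<alpha> \<noteq> {}"
  shows "stacked_filling TYPE('f::field) (card \<alpha>) l {\<sigma>. \<sigma> \<subseteq> \<alpha>} (simplex_bdry \<alpha>)"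
  unfolding stacked_filling_def
proof (intro conjI ballI allI impI)
  show "homology_filling TYPE('f) (card \<alpha>) {\<sigma>. \<sigma> \<subseteq> \<alpha>} (simplex_bdry \<alpha>)"
    unfolding simplex_bdry_def using assms by (rule homology_filling_simplex)
  show "\<sigma> \<in> simplex_bdry \<alpha>" if "\<sigma> \<in> {\<sigma>. \<sigma> \<subseteq> \<alpha>}" "card \<sigma> + l < card \<alpha>" for \<sigma>
    using that unfolding simplex_bdry_def by auto
  fix \<sigma> assume \<sigma>: "finite \<sigma> \<and> l + 2 \<le> card \<sigma> \<and> (\<forall>\<tau>. \<tau> \<subset> \<sigma> \<longrightarrow> \<tau> \<in> {\<sigma>. \<sigma> \<subseteq> \<alpha>})"
  have "x \<in> \<alpha>" if "x \<in> \<sigma>" for x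
  proof -
    have "{x} \<noteq> \<sigma>" using \<sigma> by auto
    then have "{x} \<subset> \<sigma>" using that by blast
    then show ?thesis using \<sigma> by blast
  qed
  then show "\<sigma> \<in> {\<sigma>. \<sigma> \<subseteq> \<alpha>}" by blast
qed

text \<open>
All proper faces of \<open>\<beta>\<close> belong to \<open>X\<close>. If it had more than \<open>l + 1\<close> vertices, \<open>\<beta>\<close> would
therefore be a face of \<open>\<Delta>\<close>, and a
small enough one to lie in \<open>X\<close> already, against the admissibility of the move.
\<close>

lemma missing_face_of_move_in_filling:
  fixes X \<Delta> :: "'v::linorder set set"
  assumes fil: "stacked_filling TYPE('f::field) N l \<Delta> X"
    and mv: "admits_bistellar_move d \<alpha> \<beta> X" and N: "N = nat (d + 2)"
    and small: "2 * int (card \<beta>) < d + 2" "2 * int l \<le> d"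
  shows "card \<beta> \<le> l + 1"
proof (rule ccontr)
  assume big: "\<not> card \<beta> \<le> l + 1"
  note M = admits_bistellar_moveD[OF mv]
  have hf: "homology_filling TYPE('f) N \<Delta> X" using fil by (simp add: stacked_filling_def)
  have "\<tau> \<in> \<Delta>" if "\<tau> \<subset> \<beta>" for \<tau>
    using M(8)[of \<tau>] that homology_fillingD(3)[OF hf] by blast
  then have "\<beta> \<in> \<Delta>" using fil big M(2) unfolding stacked_filling_def by auto
  moreover have "card \<beta> + l < N" using small N by linarith
  ultimately have "\<beta> \<in> X" using fil unfolding stacked_filling_def by blast
  then show False using M(8)[of \<beta>] by simp
qed

text \<open>
The entry \<open>g\<^sub>l\<^sub>+\<^sub>1\<close> counts the moves of index \<open>l\<close>. If there are none, then the first move of larger index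
cannot occur either, and the moves of smaller index build up the filling.
\<close>

lemma tame_sphere_g_vec_filling:
  fixes S :: "'v::linorder set set"
  assumes "tame_sphere d S" and l: "2 * int l \<le> d"
  shows "0 \<le> g_vec d (int (l + 1)) S \<and>
    (g_vec d (int (l + 1)) S = 0 \<longrightarrow> (\<exists>\<Delta>. stacked_filling TYPE('f::field) (nat (d + 2)) l \<Delta> S))"
  using assms(1)
proof induction
  case (standard \<alpha>)
  have "stacked_filling TYPE('f) (nat (d + 2)) l {\<sigma>. \<sigma> \<subseteq> \<alpha>} (simplex_bdry \<alpha>)"
    using stacked_filling_standard[OF standard(1,2), where ?'f = 'f] standard(3) by (metis nat_int)
  then show ?case using g_vec_standard_sphere[OF standard l] by auto
next
  case (move X \<alpha> \<beta>)
  note g = g_vec_bistellar_move[OF move.hyps l]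
  show ?case
  proof (intro conjI impI)
    show "0 \<le> g_vec d (int (l + 1)) (bistellar_move \<alpha> \<beta> X)" using g move.IH by (simp split: if_splits)
    \<comment> \<open>A move of index \<open>l\<close> would raise the entry from a non-negative value to a positive one.\<close>
    assume zero: "g_vec d (int (l + 1)) (bistellar_move \<alpha> \<beta> X) = 0"
    have gX: "g_vec d (int (l + 1)) X = 0" and \<beta>: "card \<beta> \<noteq> l + 1"
      using g zero move.IH by (auto split: if_splits)
    obtain \<Delta> where \<Delta>: "stacked_filling TYPE('f) (nat (d + 2)) l \<Delta> X" using move.IH gX by blast
    have "2 * int (card \<beta>) < d + 2" using less_half_iff[of "move_index \<beta>" d] move.hyps(3)
      by (simp add: move_index_def)
    then have "card \<beta> \<le> l"
      using missing_face_of_move_in_filling[OF \<Delta> move.hyps(2) refl _ l] \<beta> by simp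
    then show "\<exists>\<Delta>. stacked_filling TYPE('f) (nat (d + 2)) l \<Delta> (bistellar_move \<alpha> \<beta> X)"
      using stacked_filling_move[OF \<Delta> move.hyps(2) refl _ l] by blast
  qed
qed


section \<open>Betti numbers\<close>

lemma dim_kernel_plus_dim_image:
  assumes lin: "Vector_Spaces.linear s1 s2 f"
    and V: "module.subspace s1 V" "V \<subseteq> module.span s1 T" "finite T"
  shows "vector_space.dim s1 V = vector_space.dim s1 {x \<in> V. f x = 0} + vector_space.dim s2 (f ` V)"
proof -
  interpret L: Vector_Spaces.linear s1 s2 f by (rule lin)
  let ?K = "{x \<in> V. f x = 0}"
  obtain B where B: "B \<subseteq> ?K" "L.vs1.independent B" "?K \<subseteq> L.vs1.span B" "card B = L.vs1.dim ?K"
    using L.vs1.basis_exists by blast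
  have "B \<subseteq> V" using B(1) by blast
  then obtain C where C: "B \<subseteq> C" "C \<subseteq> V" "L.vs1.independent C" "V \<subseteq> L.vs1.span C"
    using L.vs1.maximal_independent_subset_extend[OF _ B(2)] by blast
  have finC: "finite C"
    using L.vs1.independent_span_bound[OF V(3) C(3)] C(2) V(2) by blast
  \<comment> \<open>Basis vectors outside the kernel stay independent: a relation among their images is an element
    of the kernel, hence a relation with \<open>B\<close>.\<close>
  have ind: "L.vs2.independent (f ` E) \<and> inj_on f E" if "finite E" "E \<subseteq> C - B" for E
    using that
  proof (induction E rule: finite_induct)
    case empty
    then show ?case by (simp add: L.vs2.independent_empty)
  next
    case (insert e E)
    have "f e \<notin> L.vs2.span (f ` E)"
    proof
      assume "f e \<in> L.vs2.span (f ` E)"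
      then obtain y where y: "y \<in> L.vs1.span E" "f e = f y" using L.span_image[of E] by auto
      have "E \<subseteq> V" "e \<in> V" using insert.prems C(2) by auto
      then have "y \<in> V" using y(1) L.vs1.span_minimal[OF _ V(1)] by blast
      then have "e - y \<in> ?K" using \<open>e \<in> V\<close> y(2) L.vs1.subspace_diff[OF V(1)] by (simp add: L.diff)
      then have "e - y \<in> L.vs1.span (C - {e})"
        using B(3) insert.prems C(1) L.vs1.span_mono[of B "C - {e}"] by blast
      moreover have "y \<in> L.vs1.span (C - {e})"
        using y(1) insert L.vs1.span_mono[of E "C - {e}"] by blast
      ultimately have "e \<in> L.vs1.span (C - {e})" using L.vs1.span_add by fastforce
      moreover have "e \<in> C" using insert.prems by blast
      ultimately show False using C(3) L.vs1.dependent_def by blast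
    qed
    moreover have "f e \<notin> f ` E" using calculation L.vs2.span_superset by blast
    ultimately show ?case using insert L.vs2.independent_insertI by auto
  qed
  have ind: "L.vs2.independent (f ` (C - B))" "inj_on f (C - B)"
    using ind[of "C - B"] finC by auto
  have "f ` V \<subseteq> L.vs2.span (f ` (C - B))"
  proof -
    have "f ` V \<subseteq> L.vs2.span (f ` C)" using C(4) L.span_image by blast
    also have "\<dots> \<subseteq> L.vs2.span (insert 0 (f ` (C - B)))"
      using B(1) by (intro L.vs2.span_mono) auto
    finally show ?thesis by simp
  qed
  moreover have "f ` (C - B) \<subseteq> f ` V" using C(2) by blast
  ultimately have "L.vs2.dim (f ` V) = card (C - B)"
    using L.vs2.dim_unique[OF _ _ ind(1)] card_image[OF ind(2)] by blast
  moreover have "L.vs1.dim V = card C" using L.vs1.dim_unique[OF C(2,4,3)] by simp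
  moreover have "card C = card B + card (C - B)"
    using finC C(1) by (simp add: card_Diff_subset finite_subset card_mono)
  ultimately show ?thesis using B(4) by simp
qed

lemma chain_bdry_eq_rel_bdry:
  fixes c :: "'v::linorder set \<Rightarrow> 'f::field"
  assumes X: "simplicial_complex X"
  shows "chain_bdry X c = rel_bdry X c"
proof
  fix \<tau>
  have "(\<Sum>\<sigma>\<in>X. c \<sigma> * oriented_bdry \<sigma> \<tau>) = 0" if "\<tau> \<notin> X"
  proof (intro sum.neutral ballI)
    fix \<sigma> assume \<sigma>: "\<sigma> \<in> X"
    have "oriented_bdry \<sigma> \<tau> = (0::'f)"
    proof (rule ccontr)
      assume "oriented_bdry \<sigma> \<tau> \<noteq> (0::'f)"
      then obtain v where "\<tau> = \<sigma> - {v}" using oriented_bdry_nonzeroD by blast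
      then show False using simplicial_complexD(4)[OF X \<sigma>, of \<tau>] that by blast
    qed
    then show "c \<sigma> * oriented_bdry \<sigma> \<tau> = 0" by simp
  qed
  then show "chain_bdry X c \<tau> = rel_bdry X c \<tau>" by (simp add: chain_bdry_def rel_bdry_def)
qed

lemma linear_chain_bdry: "Vector_Spaces.linear chain_scale chain_scale (chain_bdry X)"
proof -
  interpret V: vector_space "chain_scale :: 'f::field \<Rightarrow> ('v::linorder set \<Rightarrow> 'f) \<Rightarrow> _"
    by (rule vector_space_chain_scale)
  show ?thesis
    by unfold_locales
      (auto simp: chain_bdry_def chain_scale_def fun_eq_iff sum.distrib sum_distrib_left algebra_simps)
qed

lemma chains_iff: "c \<in> chains k X \<longleftrightarrow> supported X c \<and> (\<forall>\<sigma>. c \<sigma> \<noteq> 0 \<longrightarrow> face_dim \<sigma> = k)"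
  unfolding chains_def supported_def by blast

lemma zero_in_chains [simp]: "0 \<in> chains k X"
  by (simp add: chains_def)

lemma chains_closed:
  "b \<in> chains k X \<Longrightarrow> c \<in> chains k X \<Longrightarrow> b + c \<in> chains k X"
  "c \<in> chains k X \<Longrightarrow> chain_scale a c \<in> chains k X"
proof -
  assume b: "b \<in> chains k X" and c: "c \<in> chains k X"
  show "b + c \<in> chains k X" unfolding chains_def
  proof (intro CollectI allI impI)
    fix \<sigma> assume "(b + c) \<sigma> \<noteq> 0"
    then have "b \<sigma> \<noteq> 0 \<or> c \<sigma> \<noteq> 0" by auto
    then show "\<sigma> \<in> X \<and> face_dim \<sigma> = k" using b c unfolding chains_def by blast
  qed
qed (simp add: chains_def chain_scale_def)

lemma subspace_chains: "module.subspace chain_scale (chains k X)"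
proof -
  interpret V: vector_space "chain_scale :: 'f::field \<Rightarrow> ('v set \<Rightarrow> 'f) \<Rightarrow> _"
    by (rule vector_space_chain_scale)
  show ?thesis unfolding V.subspace_def using chains_closed zero_in_chains by blast
qed

lemma dim_chains:
  fixes X :: "'v set set"
  assumes fin: "finite X"
  shows "vector_space.dim chain_scale (chains k X :: ('v set \<Rightarrow> 'f::field) set) = f_vec k X"
    and "\<exists>T. finite T \<and> (chains k X :: ('v set \<Rightarrow> 'f) set) \<subseteq> module.span chain_scale T"
proof -
  interpret V: vector_space "chain_scale :: 'f \<Rightarrow> ('v set \<Rightarrow> 'f) \<Rightarrow> _"
    by (rule vector_space_chain_scale)
  define \<delta> where "\<delta> \<sigma> = (\<lambda>\<tau>. if \<tau> = \<sigma> then 1 else (0::'f))" for \<sigma> :: "'v set"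
  define S where "S = {\<sigma> \<in> X. face_dim \<sigma> = k}"
  have finS: "finite S" using fin by (simp add: S_def)
  have inj: "inj_on \<delta> S" unfolding \<delta>_def by (rule inj_onI) (metis one_neq_zero)
  have val: "(\<Sum>\<sigma>\<in>A. chain_scale (u \<sigma>) (\<delta> \<sigma>)) \<tau> = (if \<tau> \<in> A then u \<tau> else 0)"
    if "finite A" for A u \<tau>
  proof -
    have "(\<Sum>\<sigma>\<in>A. chain_scale (u \<sigma>) (\<delta> \<sigma>)) \<tau> = (\<Sum>\<sigma>\<in>A. chain_scale (u \<sigma>) (\<delta> \<sigma>) \<tau>)"
      using that by (induction A rule: finite_induct) auto
    also have "\<dots> = (\<Sum>\<sigma>\<in>A. if \<sigma> = \<tau> then u \<tau> else 0)"
      by (rule sum.cong) (auto simp: chain_scale_def \<delta>_def)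
    finally show ?thesis using that by simp
  qed
  have sub: "\<delta> ` S \<subseteq> chains k X" by (auto simp: S_def \<delta>_def chains_def split: if_splits)
  have span: "chains k X \<subseteq> V.span (\<delta> ` S)"
  proof
    fix c :: "'v set \<Rightarrow> 'f" assume c: "c \<in> chains k X"
    have "c \<tau> = (if \<tau> \<in> S then c \<tau> else 0)" for \<tau>
      using c by (auto simp: chains_def S_def)
    then have "c = (\<Sum>\<sigma>\<in>S. chain_scale (c \<sigma>) (\<delta> \<sigma>))"
      by (intro ext) (simp only: val[OF finS])
    also have "\<dots> \<in> V.span (\<delta> ` S)"
      by (intro V.span_sum V.span_scale V.span_base imageI)
    finally show "c \<in> V.span (\<delta> ` S)" .
  qed
  have "V.independent (\<delta> ` S)"
  proof (rule V.independent_if_scalars_zero)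
    show "finite (\<delta> ` S)" using finS by simp
    fix u x assume *: "(\<Sum>x\<in>\<delta> ` S. chain_scale (u x) x) = 0" "x \<in> \<delta> ` S"
    then obtain \<sigma> where \<sigma>: "\<sigma> \<in> S" "x = \<delta> \<sigma>" by blast
    have "(\<Sum>\<sigma>\<in>S. chain_scale (u (\<delta> \<sigma>)) (\<delta> \<sigma>)) = 0"
      using *(1) by (simp add: sum.reindex[OF inj] o_def)
    then have "(\<Sum>\<sigma>\<in>S. chain_scale (u (\<delta> \<sigma>)) (\<delta> \<sigma>)) \<sigma> = 0" by simp
    then show "u x = 0" using val[OF finS, of "\<lambda>\<sigma>. u (\<delta> \<sigma>)" \<sigma>] \<sigma> by simp
  qed
  then show "V.dim (chains k X :: ('v set \<Rightarrow> 'f) set) = f_vec k X"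
    using V.dim_unique[OF sub span] card_image[OF inj] by (simp add: f_vec_def S_def)
  show "\<exists>T. finite T \<and> (chains k X :: ('v set \<Rightarrow> 'f) set) \<subseteq> V.span T"
    using span finS by blast
qed

lemma f_vec_eq_cycles_plus_boundaries:
  fixes X :: "'v::linorder set set"
  assumes "finite X"
  shows "f_vec k X = vector_space.dim chain_scale (cycles k X :: ('v set \<Rightarrow> 'f::field) set) +
    vector_space.dim chain_scale (boundaries (k - 1) X :: ('v set \<Rightarrow> 'f) set)"
proof -
  obtain T where T: "finite T" "(chains k X :: ('v set \<Rightarrow> 'f) set) \<subseteq> module.span chain_scale T"
    using dim_chains(2)[OF assms] by blast
  show ?thesis
    using dim_kernel_plus_dim_image[OF linear_chain_bdry subspace_chains T(2,1), of X] dim_chains(1)[OF assms, of k, where ?'f = 'f]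
    by (simp add: cycles_def boundaries_def)
qed

lemma rel_bdry_in_chains:
  fixes c :: "'v::linorder set \<Rightarrow> 'f::field"
  assumes "simplicial_complex X" "c \<in> chains (k + 1) X"
  shows "rel_bdry X c \<in> chains k X"
  unfolding chains_iff
proof (intro conjI allI impI)
  fix \<tau> assume nz: "rel_bdry X c \<tau> \<noteq> 0"
  then have "(\<Sum>\<sigma>\<in>X. c \<sigma> * oriented_bdry \<sigma> \<tau>) \<noteq> 0" by (auto simp: rel_bdry_def split: if_splits)
  then obtain \<sigma> where \<sigma>: "\<sigma> \<in> X" "c \<sigma> * oriented_bdry \<sigma> \<tau> \<noteq> 0"
    by (rule sum.not_neutral_contains_not_neutral)
  then have "oriented_bdry \<sigma> \<tau> \<noteq> (0::'f)" by auto
  then obtain v where v: "v \<in> \<sigma>" "\<tau> = \<sigma> - {v}" using oriented_bdry_nonzeroD by blast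
  have "face_dim \<sigma> = k + 1" using assms(2) \<sigma>(2) by (auto simp: chains_iff)
  moreover have "card \<sigma> = Suc (card \<tau>)"
    using card.remove[of \<sigma> v] v simplicial_complexD(3)[OF assms(1) \<sigma>(1)] by blast
  ultimately show "face_dim \<tau> = k" by (simp add: face_dim_def)
qed simp

lemma cycles_iff:
  fixes c :: "'v::linorder set \<Rightarrow> 'f::field"
  assumes "simplicial_complex X"
  shows "c \<in> cycles k X \<longleftrightarrow> c \<in> chains k X \<and> rel_bdry X c = 0"
  by (simp add: cycles_def chain_bdry_eq_rel_bdry[OF assms])

text \<open>
A homogeneous chain that bounds anything at all bounds a homogeneous chain.
\<close>

lemma boundaries_iff:
  fixes c :: "'v::linorder set \<Rightarrow> 'f::field"
  assumes X: "simplicial_complex X"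
  shows "c \<in> boundaries k X \<longleftrightarrow> c \<in> chains k X \<and> (\<exists>e. supported X e \<and> rel_bdry X e = c)"
proof
  assume "c \<in> boundaries k X"
  then obtain e where "e \<in> chains (k + 1) X" "c = rel_bdry X e"
    by (auto simp: boundaries_def chain_bdry_eq_rel_bdry[OF X])
  then show "c \<in> chains k X \<and> (\<exists>e. supported X e \<and> rel_bdry X e = c)"
    using rel_bdry_in_chains[OF X] chains_iff by blast
next
  assume "c \<in> chains k X \<and> (\<exists>e. supported X e \<and> rel_bdry X e = c)"
  then obtain e where c: "c \<in> chains k X" and e: "supported X e" "rel_bdry X e = c" by blast
  have "\<exists>e'\<in>chains (k + 1) X. rel_bdry X e' = c"
  proof (cases "k \<ge> -1")
    case True
    define m where "m = nat (k + 1)"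
    define e' where "e' = (\<lambda>\<sigma>. if card \<sigma> = Suc m then e \<sigma> else 0)"
    have "c = (\<lambda>\<tau>. if card \<tau> = m then c \<tau> else 0)"
      using c by (auto simp: chains_iff fun_eq_iff face_dim_def m_def)
    also have "\<dots> = rel_bdry X e'"
      unfolding e(2)[symmetric] e'_def
      by (rule rel_bdry_component) (use simplicial_complexD(3)[OF X] in blast)
    finally have "rel_bdry X e' = c" by simp
    moreover have "e' \<in> chains (k + 1) X"
      using e(1) True by (auto simp: chains_iff supported_def e'_def face_dim_def m_def split: if_splits)
    ultimately show ?thesis by blast
  next
    case False
    then have "c \<sigma> = 0" for \<sigma> using c by (auto simp: chains_iff face_dim_def)
    then have "c = 0" by (simp add: fun_eq_iff)
    then show ?thesis by (intro bexI[of _ 0]) auto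
  qed
  then show "c \<in> boundaries k X" by (auto simp: boundaries_def chain_bdry_eq_rel_bdry[OF X])
qed

lemma betti_acyclic:
  fixes X :: "'v::linorder set set"
  assumes X: "simplicial_complex X" and ac: "acyclic_family TYPE('f::field) X"
  shows "betti TYPE('f) k X = 0"
proof -
  have "c \<in> cycles k X \<longleftrightarrow> c \<in> boundaries k X" for c :: "'v set \<Rightarrow> 'f"
    unfolding cycles_iff[OF X] boundaries_iff[OF X]
    using ac rel_bdry_rel_bdry[OF convex_family_complex[OF X]] chains_iff[of c k X]
    unfolding acyclic_family_def by blast
  then have "(cycles k X :: ('v set \<Rightarrow> 'f) set) = boundaries k X" by blast
  then show ?thesis by (simp add: betti_def)
qed

lemma betti_fundamental_cycle:
  fixes X :: "'v::linorder set set" and z :: "'v set \<Rightarrow> 'f::field"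
  assumes X: "simplicial_complex X" and fc: "fundamental_cycle m X z"
  shows "betti TYPE('f) k X = (if k = int m - 1 then 1 else 0)"
proof -
  have z: "supported X z" "\<And>\<sigma>. z \<sigma> \<noteq> 0 \<Longrightarrow> card \<sigma> = m" "rel_bdry X z = 0"
    "\<nexists>e. supported X e \<and> rel_bdry X e = z"
    "\<And>c. supported X c \<Longrightarrow> rel_bdry X c = 0 \<Longrightarrow> \<exists>a e. supported X e \<and> c = chain_scale a z + rel_bdry X e"
    using fc unfolding fundamental_cycle_def by blast+
  have bz: "boundaries k X \<subseteq> (cycles k X :: ('v set \<Rightarrow> 'f) set)"
    unfolding subset_iff cycles_iff[OF X] boundaries_iff[OF X]
    using rel_bdry_rel_bdry[OF convex_family_complex[OF X]] by blast
  interpret V: vector_space "chain_scale :: 'f \<Rightarrow> ('v set \<Rightarrow> 'f) \<Rightarrow> _"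
    by (rule vector_space_chain_scale)
  have finX: "finite X" using simplicial_complexD(1)[OF X] .
  show ?thesis
  proof (cases "k = int m - 1")
    case False
    have "c \<in> boundaries k X" if "c \<in> cycles k X" for c :: "'v set \<Rightarrow> 'f"
    proof -
      have c: "c \<in> chains k X" "rel_bdry X c = 0" using that cycles_iff[OF X] by blast+
      then obtain a e where ae: "supported X e" "c = chain_scale a z + rel_bdry X e"
        using z(5) chains_iff by blast
      define e' where "e' = (\<lambda>\<sigma>. if card \<sigma> = Suc (nat (k + 1)) then e \<sigma> else 0)"
      have "(\<lambda>\<tau>. if card \<tau> = nat (k + 1) then rel_bdry X e \<tau> else 0) = rel_bdry X e'"
        unfolding e'_def by (rule rel_bdry_component) (use simplicial_complexD(3)[OF X] in blast)
      from fun_cong[OF this, symmetric]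
      have e': "rel_bdry X e' \<tau> = (if card \<tau> = nat (k + 1) then rel_bdry X e \<tau> else 0)" for \<tau> .
      show ?thesis
      proof (cases "k \<ge> -1")
        case True
        have "rel_bdry X e' \<tau> = c \<tau>" for \<tau>
        proof (cases "card \<tau> = nat (k + 1)")
          case t: True
          then have "card \<tau> \<noteq> m" using False True by auto
          then have "z \<tau> = 0" using z(2) by blast
          then show ?thesis using fun_cong[OF ae(2), of \<tau>] e'[of \<tau>] t by (simp add: chain_scale_def)
        next
          case f: False
          have "face_dim \<tau> \<noteq> k" using f by (auto simp: face_dim_def)
          then have "c \<tau> = 0" using c(1) unfolding chains_iff by blast
          then show ?thesis using e'[of \<tau>] f by simp
        qed
        then have "rel_bdry X e' = c" by (rule ext)
        moreover have "supported X e'" using ae(1) by (auto simp: supported_def e'_def)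
        ultimately show ?thesis using c(1) boundaries_iff[OF X] by blast
      next
        case neg: False
        have "c \<tau> = 0" for \<tau>
        proof (rule ccontr)
          assume "c \<tau> \<noteq> 0"
          then have "face_dim \<tau> = k" using c(1) unfolding chains_iff by blast
          then show False using neg by (simp add: face_dim_def)
        qed
        then have "c = 0" by (simp add: fun_eq_iff)
        moreover have "supported X (0 :: 'v set \<Rightarrow> 'f)" by (simp add: supported_def)
        ultimately show ?thesis using c(1) boundaries_iff[OF X] rel_bdry_zero by blast
      qed
    qed
    then have "(cycles k X :: ('v set \<Rightarrow> 'f) set) = boundaries k X" using bz by blast
    then show ?thesis using False by (simp add: betti_def)
  next
    case True
    let ?Z = "cycles k X :: ('v set \<Rightarrow> 'f) set" and ?B = "boundaries k X :: ('v set \<Rightarrow> 'f) set"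
    have zZ: "z \<in> ?Z"
      unfolding cycles_iff[OF X] chains_iff
      using z(1,3) True z(2) unfolding face_dim_def by simp
    have zB: "z \<notin> ?B" using z(4) boundaries_iff[OF X] by blast
    have subB: "V.subspace ?B"
      unfolding boundaries_def
      by (intro vector_space_pair.linear_subspace_image[OF _ linear_chain_bdry subspace_chains])
        (simp add: vector_space_pair_def vector_space_chain_scale)
    obtain B where B: "B \<subseteq> ?B" "V.independent B" "?B \<subseteq> V.span B" "card B = V.dim ?B"
      using V.basis_exists by blast
    obtain T where T: "finite T" "(chains k X :: ('v set \<Rightarrow> 'f) set) \<subseteq> V.span T"
      using dim_chains(2)[OF finX] by blast
    have "B \<subseteq> V.span T" using B(1) T(2) boundaries_iff[OF X] by blast
    then have finB: "finite B" using V.independent_span_bound[OF T(1) B(2)] by blast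
    have spanB: "V.span B = ?B" using B(1,3) V.span_minimal[OF B(1) subB] by blast
    have ind: "V.independent (insert z B)" using zB spanB B(2) V.independent_insertI by blast
    have sub: "insert z B \<subseteq> ?Z" using zZ B(1) bz by blast
    have span: "?Z \<subseteq> V.span (insert z B)"
    proof
      fix c assume "c \<in> ?Z"
      then have c: "c \<in> chains k X" "rel_bdry X c = 0" using cycles_iff[OF X] by blast+
      then obtain a e where ae: "supported X e" "c = chain_scale a z + rel_bdry X e"
        using z(5) chains_iff by blast
      have "z \<in> chains k X" using zZ cycles_iff[OF X] by blast
      then have "c - chain_scale a z \<in> chains k X"
        using c(1) V.subspace_diff[OF subspace_chains] chains_closed(2) by blast
      moreover have "rel_bdry X e = c - chain_scale a z" using ae(2) by simp
      ultimately have "c - chain_scale a z \<in> V.span B"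
        unfolding spanB boundaries_iff[OF X] using ae(1) by auto
      then show "c \<in> V.span (insert z B)" using V.span_insert by blast
    qed
    have "V.dim ?Z = card (insert z B)" using V.dim_unique[OF sub span ind] by simp
    moreover have "z \<notin> B" using B(1) zB by blast
    ultimately show ?thesis using True finB B(4) by (simp add: betti_def)
  qed
qed

lemma has_point_homology_iff: "has_point_homology TYPE('f::field) X \<longleftrightarrow> (\<forall>k. betti TYPE('f) k X = 0)"
proof -
  have "simplicial_complex (full_simplex {0::nat})"
    unfolding simplicial_complex_def full_simplex_def by (auto intro: finite_subset)
  moreover have "{\<sigma>. {} \<subseteq> \<sigma> \<and> \<sigma> \<subseteq> {0::nat}} = full_simplex {0}" by (auto simp: full_simplex_def)
  then have "acyclic_family TYPE('f) (full_simplex {0::nat})"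
    using acyclic_family_interval[of "{0::nat}" "{}", where ?'f = 'f] by auto
  ultimately show ?thesis
    by (simp add: has_point_homology_def same_homology_def betti_acyclic)
qed

lemma has_sphere_homology_iff:
  assumes "-1 \<le> n"
  shows "has_sphere_homology TYPE('f::field) n X \<longleftrightarrow>
    (\<forall>k. betti TYPE('f) k X = (if k = n then 1 else 0))"
proof -
  let ?b = "{..<nat (n + 2)}"
  have "0 \<in> ?b" using assms by simp
  then have b: "finite ?b" "?b \<noteq> {}" "int (card ?b - 1) - 1 = n" using assms by (blast, blast, simp)
  have "finite (simplex_bdry ?b)"
    unfolding simplex_bdry_def by (rule finite_subset[of _ "Pow ?b"]) auto
  then have "simplicial_complex (simplex_bdry ?b)"
    unfolding simplicial_complex_def
    using b(1,2) unfolding simplex_bdry_def by (auto intro: finite_subset)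
  moreover obtain w :: "nat set \<Rightarrow> 'f" where "fundamental_cycle (card ?b - 1) (simplex_bdry ?b) w"
    using fundamental_cycle_simplex_bdry[OF b(1,2)] unfolding simplex_bdry_def by blast
  ultimately have "betti TYPE('f) k (simplex_bdry ?b) = (if k = n then 1 else 0)" for k
    using betti_fundamental_cycle b(3) by metis
  then show ?thesis by (simp add: has_sphere_homology_def same_homology_def)
qed

text \<open>
The Euler-Poincare formula for reduced homology.
\<close>

lemma alternating_face_sum:
  fixes X :: "'v::linorder set set"
  assumes X: "simplicial_complex X" and M: "\<And>\<sigma>. \<sigma> \<in> X \<Longrightarrow> card \<sigma> \<le> M"
  shows "(\<Sum>\<sigma>\<in>X. (-1) ^ card \<sigma>) = (\<Sum>m\<le>M. (-1) ^ m * betti TYPE('f::field) (int m - 1) X)"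
proof -
  interpret V: vector_space "chain_scale :: 'f \<Rightarrow> ('v set \<Rightarrow> 'f) \<Rightarrow> _"
    by (rule vector_space_chain_scale)
  have finX: "finite X" using simplicial_complexD(1)[OF X] .
  define b where "b k = int (V.dim (boundaries k X :: ('v set \<Rightarrow> 'f) set))" for k
  have dim0: "V.dim {0 :: 'v set \<Rightarrow> 'f} = 0"
    by (rule V.dim_unique[of "{}"]) (auto simp: V.independent_empty)
  have bnd0: "b k = 0" if "\<And>\<tau>. \<tau> \<in> X \<Longrightarrow> face_dim \<tau> \<noteq> k + 1 \<or> face_dim \<tau> = -1" for k
  proof -
    have "c = 0" if c: "c \<in> boundaries k X" for c :: "'v set \<Rightarrow> 'f"
    proof -
      obtain e :: "'v set \<Rightarrow> 'f" where e: "e \<in> chains (k + 1) X" "c = chain_bdry X e"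
        using c unfolding boundaries_def by (rule imageE)
      have "e \<sigma> * oriented_bdry \<sigma> \<tau> = 0" for \<sigma> \<tau>
      proof (cases "e \<sigma> = 0")
        case False
        then have "\<sigma> \<in> X" "face_dim \<sigma> = k + 1" using e(1) by (auto simp: chains_def)
        then have "card \<sigma> = 0" using \<open>\<And>\<tau>. \<tau> \<in> X \<Longrightarrow> face_dim \<tau> \<noteq> k + 1 \<or> face_dim \<tau> = -1\<close>[of \<sigma>]
          by (simp add: face_dim_def)
        then have "\<sigma> = {}" using simplicial_complexD(3)[OF X \<open>\<sigma> \<in> X\<close>] by simp
        then show ?thesis by (simp add: oriented_bdry_def)
      qed simp
      then have "(\<Sum>\<sigma>\<in>X. e \<sigma> * oriented_bdry \<sigma> \<tau>) = 0" for \<tau> by (intro sum.neutral ballI)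
      then show ?thesis by (simp add: e(2) chain_bdry_def fun_eq_iff)
    qed
    moreover have "(0 :: 'v set \<Rightarrow> 'f) \<in> boundaries k X"
      unfolding boundaries_iff[OF X] by (auto simp: supported_def intro!: exI[of _ 0])
    ultimately have "boundaries k X = {0 :: 'v set \<Rightarrow> 'f}" by blast
    then show ?thesis by (simp add: b_def dim0)
  qed
  have f: "int (f_vec k X) = betti TYPE('f) k X + b k + b (k - 1)" for k
    unfolding betti_def b_def using f_vec_eq_cycles_plus_boundaries[OF finX, of k, where ?'f = 'f] by simp
  \<comment> \<open>Truncating the alternating sum leaves the boundaries in the last degree as error term.\<close>
  have partial: "(\<Sum>m\<le>n. (-1) ^ m * int (f_vec (int m - 1) X)) =
      (\<Sum>m\<le>n. (-1) ^ m * betti TYPE('f) (int m - 1) X) + (-1) ^ n * b (int n - 1)" for n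
  proof (induction n)
    case 0
    have "b (-2) = 0" by (rule bnd0) simp
    then show ?case using f[of "-1"] by simp
  next
    case (Suc n)
    then show ?case using f[of "int n"] by (simp add: algebra_simps)
  qed
  have "b (int M - 1) = 0" by (rule bnd0) (use M in \<open>force simp: face_dim_def\<close>)
  then have *: "(\<Sum>m\<le>M. (-1) ^ m * int (f_vec (int m - 1) X)) =
      (\<Sum>m\<le>M. (-1) ^ m * betti TYPE('f) (int m - 1) X)" using partial[of M] by simp
  have "(\<Sum>\<sigma>\<in>X. (-1) ^ card \<sigma>) = (\<Sum>m\<le>M. \<Sum>\<sigma> | \<sigma> \<in> X \<and> card \<sigma> = m. (-1 :: int) ^ card \<sigma>)"
    by (rule sum.group[symmetric]) (use finX M in auto)
  also have "\<dots> = (\<Sum>m\<le>M. (-1) ^ m * int (f_vec (int m - 1) X))"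
    by (rule sum.cong[OF refl]) (simp add: f_vec_def face_dim_def)
  finally show ?thesis using * by simp
qed


section \<open>Stackedness of filled spheres\<close>

lemma simplicial_complex_link:
  assumes X: "simplicial_complex X" and "\<sigma> \<in> X"
  shows "simplicial_complex (link \<sigma> X)"
  unfolding simplicial_complex_def
proof (intro conjI ballI allI impI)
  show "finite (link \<sigma> X)" using simplicial_complexD(1)[OF X] unfolding link_def by simp
  show "{} \<in> link \<sigma> X" using assms simplicial_complexD(2)[OF X] by (simp add: link_def)
  fix \<tau> assume \<tau>: "\<tau> \<in> link \<sigma> X"
  then show "finite \<tau>" using simplicial_complexD(3)[OF X] by (simp add: link_def)
  fix \<rho> assume "\<rho> \<subseteq> \<tau>"
  then have "\<rho> \<inter> \<sigma> = {}" "\<rho> \<subseteq> \<tau> \<union> \<sigma>" "\<rho> \<union> \<sigma> \<subseteq> \<tau> \<union> \<sigma>" "\<tau> \<union> \<sigma> \<in> X"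
    using \<tau> unfolding link_def by blast+
  then show "\<rho> \<in> link \<sigma> X" using simplicial_complexD(4)[OF X] unfolding link_def by blast
qed

lemma pure_complexI:
  assumes X: "simplicial_complex X" and top: "\<And>\<sigma>. \<sigma> \<in> X \<Longrightarrow> \<exists>\<rho>\<in>X. \<sigma> \<subseteq> \<rho> \<and> card \<rho> = n"
    and le: "\<And>\<sigma>. \<sigma> \<in> X \<Longrightarrow> card \<sigma> \<le> n"
  shows "pure_complex (int n - 1) X"
proof -
  obtain \<rho> where \<rho>: "\<rho> \<in> X" "card \<rho> = n" using top[OF simplicial_complexD(2)[OF X]] by blast
  have "complex_dim X = int n - 1"
    unfolding complex_dim_def
  proof (rule Max_eqI)
    show "finite (face_dim ` X)" using simplicial_complexD(1)[OF X] by simp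
    show "int n - 1 \<in> face_dim ` X" using \<rho> by (auto simp: face_dim_def)
    show "y \<le> int n - 1" if y: "y \<in> face_dim ` X" for y
      using y
    proof (rule imageE)
      fix \<sigma> assume "y = face_dim \<sigma>" "\<sigma> \<in> X"
      then show ?thesis using le[of \<sigma>] by (simp add: face_dim_def)
    qed
  qed
  then show ?thesis unfolding pure_complex_def face_dim_def using X top by simp
qed

lemma card_le_complex_dim:
  assumes "simplicial_complex X" "complex_dim X = int n - 1" "\<sigma> \<in> X"
  shows "card \<sigma> \<le> n"
proof -
  have "face_dim \<sigma> \<le> complex_dim X"
    unfolding complex_dim_def using simplicial_complexD(1)[OF assms(1)] assms(3) by (intro Max_ge) auto
  then show ?thesis using assms(2) by (simp add: face_dim_def)
qed

lemma not_point_if_sphere_homology: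
  assumes "has_sphere_homology TYPE('f::field) n X" "-1 \<le> n"
  shows "\<not> has_point_homology TYPE('f) X"
proof
  assume "has_point_homology TYPE('f) X"
  then have "betti TYPE('f) n X = 0" by (simp add: has_point_homology_iff)
  moreover have "betti TYPE('f) n X = 1" using assms by (simp add: has_sphere_homology_iff)
  ultimately show False by simp
qed

text \<open>
Everything about \<open>\<Delta>\<close> is contained in the filling; the links in \<open>S\<close> are spheres by
\<open>boundary_link_cycle\<close>.
\<close>

lemma k_stacked_if_stacked_filling:
  fixes S \<Delta> :: "'v::linorder set set"
  assumes fil: "stacked_filling TYPE('f::field) (nat (d + 2)) l \<Delta> S" and l: "2 * int l \<le> d"
  shows "k_stacked TYPE('f) d (int l) S"
proof -
  define N where "N = nat (d + 2)"
  have d: "0 \<le> d" "int N = d + 2" using l by (auto simp: N_def)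
  have hf: "homology_filling TYPE('f) N \<Delta> S"
    and low: "\<And>\<sigma>. \<sigma> \<in> \<Delta> \<Longrightarrow> card \<sigma> + l < N \<Longrightarrow> \<sigma> \<in> S"
    using fil unfolding stacked_filling_def N_def by blast+
  note D = homology_fillingD[OF hf]
  have emptyS: "{} \<in> S" using simplicial_complexD(2)[OF D(2)] .
  have point: "has_point_homology TYPE('f) (link \<sigma> \<Delta>)" if "\<sigma> \<in> S" for \<sigma>
  proof -
    have "\<sigma> \<in> \<Delta>" using that D(3) by blast
    then have "simplicial_complex (link \<sigma> \<Delta>)" by (rule simplicial_complex_link[OF D(1)])
    moreover have "acyclic_family TYPE('f) (link \<sigma> \<Delta>)"
      using D(7)[OF that] by (simp add: link_eq_local_link[OF D(1)])
    ultimately show ?thesis by (simp add: has_point_homology_iff betti_acyclic)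
  qed
  have sphere: "has_sphere_homology TYPE('f) (d + 1 - int (card \<sigma>)) (link \<sigma> \<Delta>)"
    and sphere_dim: "-1 \<le> d + 1 - int (card \<sigma>)" if \<sigma>: "\<sigma> \<in> \<Delta>" "\<sigma> \<notin> S" for \<sigma>
  proof -
    have le: "card \<sigma> \<le> N" using D(5)[OF \<sigma>(1)] .
    then show n: "-1 \<le> d + 1 - int (card \<sigma>)" using d by simp
    obtain z :: "'v set \<Rightarrow> 'f" where "fundamental_cycle (N - card \<sigma>) (link \<sigma> \<Delta>) z"
      using D(8)[OF \<sigma>] by (auto simp: link_eq_local_link[OF D(1)])
    from betti_fundamental_cycle[OF simplicial_complex_link[OF D(1) \<sigma>(1)] this]
    show "has_sphere_homology TYPE('f) (d + 1 - int (card \<sigma>)) (link \<sigma> \<Delta>)"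
      unfolding has_sphere_homology_iff[OF n] using le d by (simp add: of_nat_diff)
  qed
  have sphereS: "has_sphere_homology TYPE('f) (d - int (card \<sigma>)) (link \<sigma> S)"
    and sphereS_dim: "-1 \<le> d - int (card \<sigma>)" if \<sigma>: "\<sigma> \<in> S" for \<sigma>
  proof -
    have le: "card \<sigma> < N" using D(6)[OF \<sigma>] .
    then show n: "-1 \<le> d - int (card \<sigma>)" using d by simp
    obtain z :: "'v set \<Rightarrow> 'f" where "fundamental_cycle (N - 1 - card \<sigma>) (link \<sigma> S) z"
      using boundary_link_cycle[OF hf \<sigma>] link_eq_local_link[OF D(2)] by metis
    from betti_fundamental_cycle[OF simplicial_complex_link[OF D(2) \<sigma>] this]
    show "has_sphere_homology TYPE('f) (d - int (card \<sigma>)) (link \<sigma> S)"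
      unfolding has_sphere_homology_iff[OF n] using le d by (simp add: of_nat_diff)
  qed
  have pure_ball: "pure_complex (d + 1) \<Delta>"
    using pure_complexI[OF D(1,4,5)] d by (simp add: add.commute)
  have "pure_complex (int (N - 1) - 1) S"
  proof (rule pure_complexI[OF D(2)])
    show "\<exists>\<rho>\<in>S. \<sigma> \<subseteq> \<rho> \<and> card \<rho> = N - 1" if "\<sigma> \<in> S" for \<sigma>
      using boundary_pure[OF hf that] by metis
    show "card \<sigma> \<le> N - 1" if "\<sigma> \<in> S" for \<sigma> using D(6)[OF that] by simp
  qed
  moreover have "int (N - 1) - 1 = d" using d by simp
  ultimately have pure_sphere: "pure_complex d S" by simp
  have bdry: "manifold_bdry TYPE('f) \<Delta> = S"
  proof (intro set_eqI iffI)
    fix \<sigma> assume "\<sigma> \<in> manifold_bdry TYPE('f) \<Delta>"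
    then have "\<sigma> = {} \<or> \<sigma> \<in> \<Delta> \<and> has_point_homology TYPE('f) (link \<sigma> \<Delta>)"
      unfolding manifold_bdry_def by blast
    then show "\<sigma> \<in> S"
      using emptyS sphere sphere_dim not_point_if_sphere_homology by blast
  next
    fix \<sigma> assume "\<sigma> \<in> S"
    then show "\<sigma> \<in> manifold_bdry TYPE('f) \<Delta>"
      unfolding manifold_bdry_def using point D(3) by blast
  qed
  have "manifold_bdry TYPE('f) S = {{}}"
    unfolding manifold_bdry_def using sphereS sphereS_dim not_point_if_sphere_homology by blast
  then have closed: "closed_homology_manifold TYPE('f) d S"
    unfolding closed_homology_manifold_def manifold_links_def
    using pure_sphere sphereS by blast
  have link_empty: "link {} X = X" for X :: "'v set set" by (auto simp: link_def)
  have hsphere: "homology_sphere TYPE('f) d S"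
    unfolding homology_sphere_def using closed sphereS[OF emptyS] by (simp add: link_empty)
  have "manifold_links TYPE('f) (d + 1) \<Delta>"
    unfolding manifold_links_def using pure_ball point sphere by blast
  then have "homology_ball TYPE('f) (d + 1) \<Delta>"
    unfolding homology_ball_def homology_manifold_def bdry
    using closed hsphere point[OF emptyS] by (simp add: link_empty)
  moreover have "skeleton (d - int l) \<Delta> = skeleton (d - int l) S"
  proof -
    have "\<sigma> \<in> S" if "\<sigma> \<in> \<Delta>" "face_dim \<sigma> \<le> d - int l" for \<sigma>
      using that low[of \<sigma>] d by (simp add: face_dim_def)
    then show ?thesis unfolding skeleton_def using D(3) by blast
  qed
  ultimately show ?thesis
    unfolding k_stacked_def using hsphere bdry l d by auto
qed


section \<open>Dehn-Sommerville relations for homology balls\<close>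

lemma alternating_star_sum:
  fixes X :: "'v set set"
  assumes X: "simplicial_complex X" and \<sigma>: "\<sigma> \<in> X"
  shows "(\<Sum>\<rho> | \<rho> \<in> X \<and> \<sigma> \<subseteq> \<rho>. (-1::int) ^ card \<rho>) =
    (-1) ^ card \<sigma> * (\<Sum>\<tau>\<in>link \<sigma> X. (-1) ^ card \<tau>)"
  unfolding sum_distrib_left
proof (rule sum.reindex_bij_witness[where i = "\<lambda>\<tau>. \<tau> \<union> \<sigma>" and j = "\<lambda>\<rho>. \<rho> - \<sigma>"])
  fix \<rho> assume \<rho>: "\<rho> \<in> {\<rho>. \<rho> \<in> X \<and> \<sigma> \<subseteq> \<rho>}"
  have "\<rho> - \<sigma> \<in> X" using simplicial_complexD(4)[OF X, of \<rho> "\<rho> - \<sigma>"] \<rho> by blast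
  moreover have "\<rho> - \<sigma> \<union> \<sigma> = \<rho>" using \<rho> by blast
  ultimately show "\<rho> - \<sigma> \<in> link \<sigma> X" using \<rho> unfolding link_def by auto
  have "finite \<rho>" using simplicial_complexD(3)[OF X] \<rho> by blast
  then have "card \<rho> = card \<sigma> + card (\<rho> - \<sigma>)"
    using \<rho> card_mono[of \<rho> \<sigma>] finite_subset[of \<sigma> \<rho>] by (simp add: card_Diff_subset)
  then show "(-1) ^ card \<sigma> * (-1) ^ card (\<rho> - \<sigma>) = (-1::int) ^ card \<rho>" by (simp add: power_add)
qed (auto simp: link_def)

text \<open>
The Euler characteristics of the links tell boundary from interior. The empty face belongs to the
boundary, in accordance with the acyclicity of the ball.
\<close>

lemma homology_ball_star_sum:
  fixes \<Delta> :: "'v::linorder set set"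
  assumes ball: "homology_ball TYPE('f::field) (int N - 1) \<Delta>" and N: "1 \<le> N" and \<sigma>: "\<sigma> \<in> \<Delta>"
  shows "(\<Sum>\<rho> | \<rho> \<in> \<Delta> \<and> \<sigma> \<subseteq> \<rho>. (-1::int) ^ card \<rho>) =
    (if \<sigma> \<in> manifold_bdry TYPE('f) \<Delta> then 0 else (-1) ^ N)"
proof -
  have links: "manifold_links TYPE('f) (int N - 1) \<Delta>" and pt: "has_point_homology TYPE('f) \<Delta>"
    using ball unfolding homology_ball_def homology_manifold_def by blast+
  have \<Delta>: "simplicial_complex \<Delta>" and dim: "complex_dim \<Delta> = int N - 1"
    using links unfolding manifold_links_def pure_complex_def by blast+
  note le = card_le_complex_dim[OF \<Delta> dim]
  have L: "simplicial_complex (link \<sigma> \<Delta>)" using simplicial_complex_link[OF \<Delta> \<sigma>] .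
  have sum_link: "(\<Sum>\<tau>\<in>link \<sigma> \<Delta>. (-1) ^ card \<tau>) =
      (\<Sum>m\<le>N. (-1) ^ m * betti TYPE('f) (int m - 1) (link \<sigma> \<Delta>))"
    using L by (rule alternating_face_sum) (use le in \<open>auto simp: link_def\<close>)
  show ?thesis
  proof (cases "\<sigma> \<in> manifold_bdry TYPE('f) \<Delta>")
    case True
    have "link {} \<Delta> = \<Delta>" by (auto simp: link_def)
    then have "has_point_homology TYPE('f) (link \<sigma> \<Delta>)"
      using True pt unfolding manifold_bdry_def by auto
    then show ?thesis
      using True sum_link alternating_star_sum[OF \<Delta> \<sigma>] by (simp add: has_point_homology_iff)
  next
    case False
    then have ne: "\<sigma> \<noteq> {}" "\<not> has_point_homology TYPE('f) (link \<sigma> \<Delta>)"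
      using \<sigma> unfolding manifold_bdry_def by auto
    then have "has_sphere_homology TYPE('f) (int N - 1 - int (card \<sigma>)) (link \<sigma> \<Delta>)"
      using links \<sigma> unfolding manifold_links_def by blast
    then have "betti TYPE('f) (int m - 1) (link \<sigma> \<Delta>) = (if m = N - card \<sigma> then 1 else 0)" for m
      using le[OF \<sigma>] by (subst (asm) has_sphere_homology_iff) auto
    then have "(\<Sum>\<tau>\<in>link \<sigma> \<Delta>. (-1) ^ card \<tau>) = (-1::int) ^ (N - card \<sigma>)"
      unfolding sum_link by (simp add: if_distrib[of "\<lambda>x. _ * x"] cong: if_cong)
    then have "(\<Sum>\<rho> | \<rho> \<in> \<Delta> \<and> \<sigma> \<subseteq> \<rho>. (-1::int) ^ card \<rho>) = (-1) ^ (card \<sigma> + (N - card \<sigma>))"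
      using alternating_star_sum[OF \<Delta> \<sigma>] by (simp add: power_add)
    then show ?thesis using False le[OF \<sigma>] by simp
  qed
qed

text \<open>
The Dehn-Sommerville relations of a ball: the indicator of the interior is replaced by the alternating
sum over the star, the order of summation is exchanged, and the sum over the subsets of a face
collapses by the binomial theorem.
\<close>

lemma face_poly_interior:
  fixes \<Delta> I :: "'v set set"
  assumes \<Delta>: "simplicial_complex \<Delta>" and le: "\<And>\<sigma>. \<sigma> \<in> \<Delta> \<Longrightarrow> card \<sigma> \<le> N" and I: "I \<subseteq> \<Delta>"
    and star: "\<And>\<sigma>. \<sigma> \<in> \<Delta> \<Longrightarrow>
      (\<Sum>\<rho> | \<rho> \<in> \<Delta> \<and> \<sigma> \<subseteq> \<rho>. (-1::int) ^ card \<rho>) = (if \<sigma> \<in> I then (-1) ^ N else 0)"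
  shows "face_poly N I = (\<Sum>\<rho>\<in>\<Delta>. [:-1, 1:] ^ (N - card \<rho>))"
proof -
  have fin: "finite \<Delta>" using simplicial_complexD(1)[OF \<Delta>] .
  define t :: "'v set \<Rightarrow> int poly" where "t \<sigma> = monom 1 (card \<sigma>) * [:1, -1:] ^ (N - card \<sigma>)" for \<sigma>
  have star': "(\<Sum>\<rho> | \<rho> \<in> \<Delta> \<and> \<sigma> \<subseteq> \<rho>. (-1 :: int poly) ^ card \<rho>) = (if \<sigma> \<in> I then (-1) ^ N else 0)"
    if "\<sigma> \<in> \<Delta>" for \<sigma>
  proof -
    have "(\<Sum>\<rho> | \<rho> \<in> \<Delta> \<and> \<sigma> \<subseteq> \<rho>. (-1 :: int poly) ^ card \<rho>) =
        of_int (\<Sum>\<rho> | \<rho> \<in> \<Delta> \<and> \<sigma> \<subseteq> \<rho>. (-1) ^ card \<rho>)" by simp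
    then show ?thesis unfolding star[OF that] by simp
  qed
  have "face_poly N I = (\<Sum>\<sigma>\<in>\<Delta>. if \<sigma> \<in> I then t \<sigma> else 0)"
    unfolding face_poly_def t_def using fin I
    by (simp add: sum.If_cases Int_absorb1)
  also have "\<dots> = (\<Sum>\<sigma>\<in>\<Delta>. (-1) ^ N * t \<sigma> * (\<Sum>\<rho> | \<rho> \<in> \<Delta> \<and> \<sigma> \<subseteq> \<rho>. (-1) ^ card \<rho>))"
  proof (rule sum.cong[OF refl])
    fix \<sigma> assume \<sigma>: "\<sigma> \<in> \<Delta>"
    have "(-1) ^ N * t \<sigma> * (-1) ^ N = t \<sigma> * ((-1) ^ N * (-1) ^ N)" by (simp only: ac_simps)
    also have "(-1) ^ N * (-1) ^ N = (1 :: int poly)" by (simp flip: power_mult_distrib)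
    finally show "(if \<sigma> \<in> I then t \<sigma> else 0) =
        (-1) ^ N * t \<sigma> * (\<Sum>\<rho> | \<rho> \<in> \<Delta> \<and> \<sigma> \<subseteq> \<rho>. (-1) ^ card \<rho>)"
      unfolding star'[OF \<sigma>] by simp
  qed
  also have "\<dots> = (\<Sum>\<rho>\<in>\<Delta>. \<Sum>\<sigma> | \<sigma> \<in> \<Delta> \<and> \<sigma> \<subseteq> \<rho>. (-1) ^ N * t \<sigma> * (-1) ^ card \<rho>)"
    unfolding sum_distrib_left by (rule sum.swap_restrict[OF fin fin])
  also have "\<dots> = (\<Sum>\<rho>\<in>\<Delta>. [:-1, 1:] ^ (N - card \<rho>))"
  proof (rule sum.cong[OF refl])
    fix \<rho> assume \<rho>: "\<rho> \<in> \<Delta>"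
    have f\<rho>: "finite \<rho>" using simplicial_complexD(3)[OF \<Delta> \<rho>] .
    have Pow: "{\<sigma>. \<sigma> \<in> \<Delta> \<and> \<sigma> \<subseteq> \<rho>} = Pow \<rho>" using simplicial_complexD(4)[OF \<Delta> \<rho>] by blast
    have "t \<sigma> = [:1, -1:] ^ (N - card \<rho>) * (monom 1 1 ^ card \<sigma> * [:1, -1:] ^ (card \<rho> - card \<sigma>))"
      if "\<sigma> \<in> Pow \<rho>" for \<sigma>
    proof -
      have "card \<sigma> \<le> card \<rho>" using that f\<rho> by (simp add: card_mono)
      then have "N - card \<sigma> = (N - card \<rho>) + (card \<rho> - card \<sigma>)" using le[OF \<rho>] by simp
      then show ?thesis by (simp add: t_def monom_power power_add algebra_simps)
    qed
    then have "(\<Sum>\<sigma>\<in>Pow \<rho>. t \<sigma>) = (\<Sum>\<sigma>\<in>Pow \<rho>. [:1, -1:] ^ (N - card \<rho>) *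
        (monom 1 1 ^ card \<sigma> * [:1, -1:] ^ (card \<rho> - card \<sigma>)))" by (rule sum.cong[OF refl])
    also have "\<dots> = [:1, -1:] ^ (N - card \<rho>) * (monom 1 1 + [:1, -1:]) ^ card \<rho>"
      unfolding sum_distrib_left[symmetric] sum_Pow_binomial[OF f\<rho>] ..
    also have "monom 1 1 + [:1, -1:] = (1 :: int poly)"
      by (simp add: monom_altdef one_pCons)
    finally have t: "(\<Sum>\<sigma>\<in>Pow \<rho>. t \<sigma>) = [:1, -1:] ^ (N - card \<rho>)" by simp
    have "(\<Sum>\<sigma> | \<sigma> \<in> \<Delta> \<and> \<sigma> \<subseteq> \<rho>. (-1) ^ N * t \<sigma> * (-1) ^ card \<rho>) =
        (-1) ^ N * (\<Sum>\<sigma>\<in>Pow \<rho>. t \<sigma>) * (-1) ^ card \<rho>"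
      unfolding Pow sum_distrib_left sum_distrib_right ..
    also have "\<dots> = ((-1) ^ (N + card \<rho>)) * [:1, -1:] ^ (N - card \<rho>)"
      unfolding t by (simp add: power_add algebra_simps)
    also have "N + card \<rho> = (N - card \<rho>) + 2 * card \<rho>" using le[OF \<rho>] by simp
    also have "(-1 :: int poly) ^ (N - card \<rho> + 2 * card \<rho>) = (-1) ^ (N - card \<rho>)"
      by (simp add: power_add power_mult)
    also have "(-1) ^ (N - card \<rho>) * [:1, -1:] ^ (N - card \<rho>) = ([:-1, 1:] :: int poly) ^ (N - card \<rho>)"
      by (simp add: power_mult_distrib[symmetric])
    finally show "(\<Sum>\<sigma> | \<sigma> \<in> \<Delta> \<and> \<sigma> \<subseteq> \<rho>. (-1) ^ N * t \<sigma> * (-1) ^ card \<rho>) = [:-1, 1:] ^ (N - card \<rho>)" .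
  qed
  finally show ?thesis .
qed

text \<open>
The right-hand side of \<open>face_poly_interior\<close> is the reversal \<open>x\<^sup>N G(1/x)\<close> of the face polynomial \<open>G\<close> of
the whole ball.
\<close>

lemma coeff_face_term_reversed:
  assumes "s \<le> N" "j \<le> N"
  shows "coeff (monom 1 s * [:1, -1:] ^ (N - s)) j = coeff ([:-1, 1:] ^ (N - s) :: int poly) (N - j)"
proof (cases "s \<le> j")
  case True
  have "(N - s) choose (N - j) = (N - s) choose (j - s)"
    using binomial_symmetric[of "j - s" "N - s"] True assms by simp
  moreover have "coeff ([:-1, 1:] ^ (N - s) :: int poly) (N - j) =
      of_nat ((N - s) choose (N - j)) * 1 ^ (N - j) * (-1) ^ (N - s - (N - j))"
    using True assms by (intro coeff_linear_poly_power) simp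
  moreover have "N - s - (N - j) = j - s" using True assms by simp
  ultimately show ?thesis using True assms by (simp add: coeff_face_term)
next
  case False
  then have "coeff ([:-1, 1:] ^ (N - s) :: int poly) (N - j) = 0"
    using assms by (intro coeff_eq_0) (simp add: degree_linear_power)
  then show ?thesis using False by (simp add: coeff_monom_mult)
qed

text \<open>
The interior contributes nothing in degree \<open>l + 1\<close> because its faces are too large; the whole ball
contributes nothing either, since by the Dehn-Sommerville relations its entry in degree \<open>l + 1\<close> is the
entry of the interior in degree \<open>N - (l + 1)\<close>. The sphere is the difference of the two.
\<close>

lemma g_vec_zero_if_k_stacked:
  fixes S :: "'v::linorder set set"
  assumes st: "k_stacked TYPE('f::field) d (int l) S" and l: "2 * int l \<le> d"
  shows "g_vec d (int (l + 1)) S = 0"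
proof -
  define N where "N = nat (d + 2)"
  have d: "int N = d + 2" "l + 1 \<le> N" "l + 1 < N - l" "1 \<le> N" using l by (auto simp: N_def)
  obtain \<Delta> where ball: "homology_ball TYPE('f) (d + 1) \<Delta>" and bdry: "manifold_bdry TYPE('f) \<Delta> = S"
    and skel: "skeleton (d - int l) \<Delta> = skeleton (d - int l) S"
    using st unfolding k_stacked_def by blast
  have dN: "d + 1 = int N - 1" using d by simp
  have links: "manifold_links TYPE('f) (d + 1) \<Delta>"
    using ball unfolding homology_ball_def homology_manifold_def by blast
  have \<Delta>: "simplicial_complex \<Delta>" and dim: "complex_dim \<Delta> = int N - 1"
    using links dN unfolding manifold_links_def pure_complex_def by auto
  have fin: "finite \<Delta>" using simplicial_complexD(1)[OF \<Delta>] .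
  note le = card_le_complex_dim[OF \<Delta> dim]
  have SD: "S \<subseteq> \<Delta>"
    using simplicial_complexD(2)[OF \<Delta>] unfolding bdry[symmetric] manifold_bdry_def by blast
  have high: "N - l \<le> card \<sigma>" if "\<sigma> \<in> \<Delta> - S" for \<sigma>
  proof (rule ccontr)
    assume "\<not> N - l \<le> card \<sigma>"
    then have "face_dim \<sigma> \<le> d - int l" using d by (simp add: face_dim_def)
    then have "\<sigma> \<in> skeleton (d - int l) \<Delta>" using that by (simp add: skeleton_def)
    then have "\<sigma> \<in> skeleton (d - int l) S" by (simp only: skel)
    then have "\<sigma> \<in> S" by (simp add: skeleton_def)
    then show False using that by simp
  qed
  \<comment> \<open>Interior faces have at least \<open>N - l\<close> vertices, so their face polynomial starts late; both degrees
    \<open>l + 1\<close> and \<open>N - (l + 1)\<close> lie below that, the first because \<open>2 l \<le> d\<close>.\<close>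
  have int0: "coeff (face_poly N (\<Delta> - S)) j = 0" if "j < N - l" for j
    unfolding face_poly_def coeff_sum
  proof (intro sum.neutral ballI)
    fix \<sigma> assume "\<sigma> \<in> \<Delta> - S"
    then have "j < card \<sigma>" using high that by fastforce
    then show "coeff (monom 1 (card \<sigma>) * [:1, -1:] ^ (N - card \<sigma>)) j = (0::int)"
      by (simp add: coeff_monom_mult)
  qed
  have star: "(\<Sum>\<rho> | \<rho> \<in> \<Delta> \<and> \<sigma> \<subseteq> \<rho>. (-1::int) ^ card \<rho>) = (if \<sigma> \<in> \<Delta> - S then (-1) ^ N else 0)"
    if "\<sigma> \<in> \<Delta>" for \<sigma>
    using homology_ball_star_sum[OF ball[unfolded dN] d(4) that] that by (simp add: bdry)
  have "face_poly N (\<Delta> - S) = (\<Sum>\<rho>\<in>\<Delta>. [:-1, 1:] ^ (N - card \<rho>))"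
    by (rule face_poly_interior[OF \<Delta> le _ star]) auto
  then have "coeff (face_poly N (\<Delta> - S)) (N - (l + 1)) =
      (\<Sum>\<rho>\<in>\<Delta>. coeff ([:-1, 1:] ^ (N - card \<rho>)) (N - (l + 1)))" by (simp only: coeff_sum)
  also have "\<dots> = coeff (face_poly N \<Delta>) (l + 1)"
    unfolding face_poly_def coeff_sum
    by (rule sum.cong[OF refl], rule coeff_face_term_reversed[OF le d(2), symmetric])
  finally have "coeff (face_poly N (\<Delta> - S)) (N - (l + 1)) = coeff (face_poly N \<Delta>) (l + 1)" .
  moreover have "N - (l + 1) < N - l" using d by simp
  ultimately have "coeff (face_poly N \<Delta>) (l + 1) = 0" using int0 by simp
  moreover have "face_poly N \<Delta> = face_poly N S + face_poly N (\<Delta> - S)"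
  proof -
    have "S \<union> (\<Delta> - S) = \<Delta>" using SD by blast
    then show ?thesis using face_poly_Un[of S "\<Delta> - S" N] fin SD finite_subset[OF SD fin] by auto
  qed
  ultimately have "coeff (face_poly N S) (l + 1) = 0" using int0[OF d(3)] by simp
  then show ?thesis
    using g_vec_eq_coeff[of S d "l + 1"] finite_subset[OF SD fin] le SD d unfolding N_def by auto
qed


section \<open>The lower bound theorem for tame spheres\<close>

theorem theorem1p2:
  fixes S :: "'v::linorder set set" and d l :: int
  assumes "tame_sphere d S"
    and "0 \<le> l" and "real_of_int l \<le> real_of_int d / 2"
  shows "g_vec d (l + 1) S \<ge> 0 \<and>
    (g_vec d (l + 1) S = 0 \<longleftrightarrow> k_stacked TYPE('f::field) d l S)"
proof -
  have "real_of_int (2 * l) \<le> real_of_int d" using assms(3) by simp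
  then have l2: "2 * int (nat l) \<le> d" using assms(2) by (simp only: of_int_le_iff int_nat_eq) simp
  have l: "int (nat l) = l" "int (nat l + 1) = l + 1" using assms(2) by simp_all
  note forward = tame_sphere_g_vec_filling[OF assms(1) l2, where ?'f = 'f, unfolded l(2)]
  show ?thesis
  proof (intro conjI iffI)
    show "0 \<le> g_vec d (l + 1) S" using forward by blast
  next
    assume "g_vec d (l + 1) S = 0"
    then obtain \<Delta> where "stacked_filling TYPE('f) (nat (d + 2)) (nat l) \<Delta> S" using forward by blast
    then show "k_stacked TYPE('f) d l S" using k_stacked_if_stacked_filling l2 l(1) by metis
  next
    assume "k_stacked TYPE('f) d l S"
    then have "k_stacked TYPE('f) d (int (nat l)) S" by (simp only: l(1))
    then show "g_vec d (l + 1) S = 0" using g_vec_zero_if_k_stacked[OF _ l2] l(2) by metis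
  qed
qed

end
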